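(* Let $k$ be a field of characteristic $0$, and let $\Theta$ be an action-type and nondegenerated variety of representations of Lie algebras over $k$ which is defined by identities with coefficients from $\mathbb{Z}$. Let $\mathfrak{A}$ be the group of all automorphisms of the category $\Theta^{0}$ and let $\mathfrak{Y}$ be the normal subgroup of all inner automorphisms of $\Theta^{0}$. Then $$\mathfrak{A}/\mathfrak{Y}\cong \mathrm{Aut}\,k ,$$ where $\mathrm{Aut}\,k$ is the group of all automorphisms of the field $k$.
   Context: Representations. A representation (of a Lie algebra over $k$) is a two-sorted algebra $H$: its first sort $H^{(1)}$ is a Lie algebra over $k$, its second sort $H^{(2)}$ is a vector space over $k$, and there is an operation $\circ: H^{(1)}\times H^{(2)}\to H^{(2)}$, a bilinear Lie action, i.e. $[l_1,l_2]\circ v=l_1\circ(l_2\circ v)-l_2\circ(l_1\circ v)$. Both the Lie algebra and the vector space vary. The signature is $\Omega=\{0^{(1)},-^{(1)},\lambda^{(1)}(\lambda\in k),+^{(1)},[\,,],0^{(2)},-^{(2)},\lambda^{(2)}(\lambda\in k),+^{(2)},\circ\}$ (the vector space operations on each sort, the Lie bracket, and the action). A homomorphism $H_1\to H_2$ is a pair consisting of a Lie algebra homomorphism $H_1^{(1)}\to H_2^{(1)}$ and a $k$-linear map $H_1^{(2)}\to H_2^{(2)}$ compatible with $\circ$. A variety of representations is the class of all representations over $k$ satisfying some set of (two-sorted) identities. Free representations. The absolutely free representation $F(X)$ on $X=X^{(1)}\cup X^{(2)}$ (disjoint union, elements of $X^{(i)}$ having sort $i$) has $F(X)^{(1)}=L(X^{(1)})$,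 the free Lie algebra over $k$ on $X^{(1)}$, and $F(X)^{(2)}=A(X^{(1)})X^{(2)}=\bigoplus_{x\in X^{(2)}}A(X^{(1)})x$, the free left module on $X^{(2)}$ over the free associative unital $k$-algebra $A(X^{(1)})$; $l\circ v=\iota(l)v$, where $\iota:L(X^{(1)})\to A(X^{(1)})$ is the canonical embedding. For a variety $\Theta$, $F_\Theta(X)=F(X)/\mathrm{Id}_\Theta(X)$ is the free representation of $\Theta$ on $X$, where $\mathrm{Id}_\Theta(X)$ is the congruence of all identities of $\Theta$ in variables from $X$; $F_\Theta(X)^{(1)}=L(X^{(1)})/I_\Theta(X^{(1)})$ with $I_\Theta(X^{(1)})$ an ideal. The category $\Theta^0$. Fix disjoint countably infinite sets of symbols $X_0^{(1)}$, $X_0^{(2)}$ and let $X_0=X_0^{(1)}\cup X_0^{(2)}$. Objects of $\Theta^0$ are the free representations $F_\Theta(X)$ for finite subsets $X\subset X_0$, where $X^{(i)}=X\cap X_0^{(i)}$ consists of generators of sort $i$; morphisms are all homomorphisms of these representations. Inner automorphisms. An automorphism $\Upsilon$ of a category $\mathfrak{K}$ is inner if it is isomorphic as a functor to the identity functor, i.e. for every object $F$ there is an isomorphism $\sigma_F:F\to\Upsilon(F)$ such that $\Upsilon(\mu)=\sigma_{F_2}\mu\sigma_{F_1}^{-1}$ for every morphism $\mu:F_1\to F_2$. Conditions on $\Theta$. $\Theta$ is an action-type variety if $I_\Theta(X^{(1)})=\{0\}$ for every finite $X^{(1)}\subset X_0^{(1)}$. $\Theta$ is degenerated if the identity $[x_1^{(1)},x_2^{(1)}]\circ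 x^{(2)}=0$ is fulfilled in $\Theta$, and nondegenerated otherwise (here $x^{(i)}, x_j^{(i)}$ denote variables of sort $i$). "Defined by identities with coefficients from $\mathbb{Z}$" means that $\Theta$ is the class of all representations over $k$ satisfying some set of identities of the form $u=0$, where $u$ is an element of an absolutely free representation which is a linear combination with integer coefficients of Lie monomials in the variables of sort $1$ (if $u$ has sort $1$), or of elements $m x$, with $m$ an associative monomial in the variables of sort $1$ and $x$ a variable of sort $2$ (if $u$ has sort $2$). *)

theory Defs
  imports "HOL-Algebra.Algebraic_Closure_Type" "HOL-Algebra.Coset" "HOL-Algebra.Bij"
    "HOL-Library.Poly_Mapping"
begin

section \<open>Representations of Lie algebras\<close>

text \<open>
  The ground field is a type \<open>'k\<close>; \<^const>\<open>ring_of_type_algebra\<close> turns it into a ring object, so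
  that vector spaces are modules over it in the sense of the algebra library. The record
  \<open>module\<close> inherits the fields \<open>mult\<close> and \<open>one\<close> from \<open>ring\<close>; they play no role in a module
  and are never used here.
\<close>

record ('k, 'l) lie_alg = "('k, 'l) module" +
  lie_bracket :: "'l \<Rightarrow> 'l \<Rightarrow> 'l"

record ('k, 'l, 'v) lie_rep =
  lie_sort :: "('k, 'l) lie_alg"
  vec_sort :: "('k, 'v) module"
  action :: "'l \<Rightarrow> 'v \<Rightarrow> 'v"

abbreviation vector_space_obj :: "('k::field, 'v, 'z) module_scheme \<Rightarrow> bool" where
  "vector_space_obj V \<equiv> module (ring_of_type_algebra :: 'k ring) V"

definition is_lie_algebra :: "('k::field, 'l) lie_alg \<Rightarrow> bool" where
  "is_lie_algebra L \<longleftrightarrow>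
     vector_space_obj L \<and>
     (\<forall>x\<in>carrier L. \<forall>y\<in>carrier L. lie_bracket L x y \<in> carrier L) \<and>
     (\<forall>x\<in>carrier L. \<forall>y\<in>carrier L. \<forall>z\<in>carrier L.
        lie_bracket L (x \<oplus>\<^bsub>L\<^esub> y) z = lie_bracket L x z \<oplus>\<^bsub>L\<^esub> lie_bracket L y z \<and>
        lie_bracket L z (x \<oplus>\<^bsub>L\<^esub> y) = lie_bracket L z x \<oplus>\<^bsub>L\<^esub> lie_bracket L z y) \<and>
     (\<forall>c. \<forall>x\<in>carrier L. \<forall>y\<in>carrier L.
        lie_bracket L (c \<odot>\<^bsub>L\<^esub> x) y = c \<odot>\<^bsub>L\<^esub> lie_bracket L x y \<and>
        lie_bracket L x (c \<odot>\<^bsub>L\<^esub> y) = c \<odot>\<^bsub>L\<^esub> lie_bracket L x y) \<and>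
     (\<forall>x\<in>carrier L. lie_bracket L x x = \<zero>\<^bsub>L\<^esub>) \<and>
     (\<forall>x\<in>carrier L. \<forall>y\<in>carrier L. \<forall>z\<in>carrier L.
        lie_bracket L x (lie_bracket L y z) \<oplus>\<^bsub>L\<^esub> lie_bracket L y (lie_bracket L z x)
          \<oplus>\<^bsub>L\<^esub> lie_bracket L z (lie_bracket L x y) = \<zero>\<^bsub>L\<^esub>)"

definition is_lie_rep :: "('k::field, 'l, 'v) lie_rep \<Rightarrow> bool" where
  "is_lie_rep H \<longleftrightarrow>
     (let L = lie_sort H; V = vec_sort H; act = action H in
     is_lie_algebra L \<and> vector_space_obj V \<and>
     (\<forall>l\<in>carrier L. \<forall>v\<in>carrier V. act l v \<in> carrier V) \<and>
     (\<forall>l\<in>carrier L. \<forall>m\<in>carrier L. \<forall>v\<in>carrier V.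
        act (l \<oplus>\<^bsub>L\<^esub> m) v = act l v \<oplus>\<^bsub>V\<^esub> act m v) \<and>
     (\<forall>l\<in>carrier L. \<forall>v\<in>carrier V. \<forall>w\<in>carrier V.
        act l (v \<oplus>\<^bsub>V\<^esub> w) = act l v \<oplus>\<^bsub>V\<^esub> act l w) \<and>
     (\<forall>c. \<forall>l\<in>carrier L. \<forall>v\<in>carrier V.
        act (c \<odot>\<^bsub>L\<^esub> l) v = c \<odot>\<^bsub>V\<^esub> act l v \<and> act l (c \<odot>\<^bsub>V\<^esub> v) = c \<odot>\<^bsub>V\<^esub> act l v) \<and>
     (\<forall>l\<in>carrier L. \<forall>m\<in>carrier L. \<forall>v\<in>carrier V.
        act (lie_bracket L l m) v = act l (act m v) \<ominus>\<^bsub>V\<^esub> act m (act l v)))"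

text \<open>
  Homomorphisms are extensional (\<open>undefined\<close> outside the carriers), so that equal
  homomorphisms are equal functions.
\<close>

definition linear_maps ::
    "('k, 'v, 'y) module_scheme \<Rightarrow> ('k, 'w, 'z) module_scheme \<Rightarrow> ('v \<Rightarrow> 'w) set" where
  "linear_maps V W = {g \<in> carrier V \<rightarrow>\<^sub>E carrier W.
     (\<forall>x\<in>carrier V. \<forall>y\<in>carrier V. g (x \<oplus>\<^bsub>V\<^esub> y) = g x \<oplus>\<^bsub>W\<^esub> g y) \<and>
     (\<forall>c. \<forall>x\<in>carrier V. g (c \<odot>\<^bsub>V\<^esub> x) = c \<odot>\<^bsub>W\<^esub> g x)}"

definition rep_hom ::
    "('k, 'l, 'v) lie_rep \<Rightarrow> ('k, 'm, 'w) lie_rep \<Rightarrow> (('l \<Rightarrow> 'm) \<times> ('v \<Rightarrow> 'w)) set" where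
  "rep_hom H1 H2 = {(f, g).
     f \<in> linear_maps (lie_sort H1) (lie_sort H2) \<and>
     g \<in> linear_maps (vec_sort H1) (vec_sort H2) \<and>
     (\<forall>x\<in>carrier (lie_sort H1). \<forall>y\<in>carrier (lie_sort H1).
        f (lie_bracket (lie_sort H1) x y) = lie_bracket (lie_sort H2) (f x) (f y)) \<and>
     (\<forall>l\<in>carrier (lie_sort H1). \<forall>v\<in>carrier (vec_sort H1).
        g (action H1 l v) = action H2 (f l) (g v))}"


section \<open>The free Lie algebra\<close>

text \<open>
  The variables of either sort are indexed by \<^typ>\<open>nat\<close>; the two sorts are kept apart by
  occurring in different types below. \<open>'k free_lie\<close> is the free Lie algebra on all variables of
  sort 1: Lie terms modulo the congruence generated by the axioms of Lie algebras over \<open>'k\<close>.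
\<close>

datatype 'k lie_term =
    LGen nat
  | LZero
  | LAdd "'k lie_term" "'k lie_term"
  | LScale 'k "'k lie_term"
  | LBracket "'k lie_term" "'k lie_term"

inductive lie_eq :: "'k::field lie_term \<Rightarrow> 'k lie_term \<Rightarrow> bool" where
  lie_refl: "lie_eq s s"
| lie_sym: "lie_eq s t \<Longrightarrow> lie_eq t s"
| lie_trans: "lie_eq s t \<Longrightarrow> lie_eq t u \<Longrightarrow> lie_eq s u"
| lie_cong_add: "lie_eq s s' \<Longrightarrow> lie_eq t t' \<Longrightarrow> lie_eq (LAdd s t) (LAdd s' t')"
| lie_cong_scale: "lie_eq s s' \<Longrightarrow> lie_eq (LScale c s) (LScale c s')"
| lie_cong_bracket: "lie_eq s s' \<Longrightarrow> lie_eq t t' \<Longrightarrow> lie_eq (LBracket s t) (LBracket s' t')"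
| lie_add_assoc: "lie_eq (LAdd (LAdd s t) u) (LAdd s (LAdd t u))"
| lie_add_commute: "lie_eq (LAdd s t) (LAdd t s)"
| lie_add_zero: "lie_eq (LAdd LZero s) s"
| lie_add_minus: "lie_eq (LAdd (LScale (- 1) s) s) LZero"
| lie_scale_add_right: "lie_eq (LScale c (LAdd s t)) (LAdd (LScale c s) (LScale c t))"
| lie_scale_add_left: "lie_eq (LScale (c + d) s) (LAdd (LScale c s) (LScale d s))"
| lie_scale_scale: "lie_eq (LScale (c * d) s) (LScale c (LScale d s))"
| lie_scale_one: "lie_eq (LScale 1 s) s"
| lie_bracket_add_left: "lie_eq (LBracket (LAdd s t) u) (LAdd (LBracket s u) (LBracket t u))"
| lie_bracket_add_right: "lie_eq (LBracket u (LAdd s t)) (LAdd (LBracket u s) (LBracket u t))"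
| lie_bracket_scale_left: "lie_eq (LBracket (LScale c s) t) (LScale c (LBracket s t))"
| lie_bracket_scale_right: "lie_eq (LBracket s (LScale c t)) (LScale c (LBracket s t))"
| lie_bracket_self: "lie_eq (LBracket s s) LZero"
| lie_jacobi: "lie_eq (LAdd (LAdd (LBracket s (LBracket t u)) (LBracket t (LBracket u s)))
    (LBracket u (LBracket s t))) LZero"

quotient_type (overloaded) 'k free_lie = "'k::field lie_term" / lie_eq
  by (intro equivpI reflpI sympI transpI) (fact lie_refl, fact lie_sym, fact lie_trans)

lift_definition fl_gen :: "nat \<Rightarrow> 'k::field free_lie" is LGen .
lift_definition fl_scale :: "'k::field \<Rightarrow> 'k free_lie \<Rightarrow> 'k free_lie" is LScale
  by (rule lie_cong_scale)
lift_definition fl_bracket :: "'k::field free_lie \<Rightarrow> 'k free_lie \<Rightarrow> 'k free_lie" is LBracket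
  by (rule lie_cong_bracket)

instantiation free_lie :: (field) ab_group_add
begin

lift_definition zero_free_lie :: "'a free_lie" is LZero .
lift_definition plus_free_lie :: "'a free_lie \<Rightarrow> 'a free_lie \<Rightarrow> 'a free_lie" is LAdd
  by (rule lie_cong_add)
lift_definition uminus_free_lie :: "'a free_lie \<Rightarrow> 'a free_lie" is "LScale (- 1)"
  by (rule lie_cong_scale)
definition minus_free_lie :: "'a free_lie \<Rightarrow> 'a free_lie \<Rightarrow> 'a free_lie" where
  "minus_free_lie u v = u + - v"

instance
proof
  fix a b c :: "'a free_lie"
  show "a + b + c = a + (b + c)" by transfer (rule lie_add_assoc)
  show "a + b = b + a" by transfer (rule lie_add_commute)
  show "0 + a = a" by transfer (rule lie_add_zero)
  show "- a + a = 0" by transfer (rule lie_add_minus)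
  show "a - b = a + - b" by (rule minus_free_lie_def)
qed

end

text \<open>\<open>free_lie_on Y\<close> is \<open>L(Y)\<close>, as the subalgebra generated by the variables in \<open>Y\<close>.\<close>

inductive_set free_lie_on :: "nat set \<Rightarrow> 'k::field free_lie set" for Y :: "nat set" where
  lie_on_gen: "x \<in> Y \<Longrightarrow> fl_gen x \<in> free_lie_on Y"
| lie_on_zero: "0 \<in> free_lie_on Y"
| lie_on_add: "u \<in> free_lie_on Y \<Longrightarrow> v \<in> free_lie_on Y \<Longrightarrow> u + v \<in> free_lie_on Y"
| lie_on_scale: "u \<in> free_lie_on Y \<Longrightarrow> fl_scale c u \<in> free_lie_on Y"
| lie_on_bracket: "u \<in> free_lie_on Y \<Longrightarrow> v \<in> free_lie_on Y \<Longrightarrow> fl_bracket u v \<in> free_lie_on Y"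


section \<open>The free associative algebra and its free modules\<close>

text \<open>
  Words form a monoid under concatenation (written additively, as \<^typ>\<open>'a \<Rightarrow>\<^sub>0 'b\<close> requires),
  which makes \<open>nat list \<Rightarrow>\<^sub>0 'k\<close> with its convolution product the free associative unital
  algebra. The scalar \<open>c\<close> is \<open>Poly_Mapping.single 0 c\<close>, and \<open>0\<close> is the empty word.
\<close>

instantiation list :: (type) monoid_add
begin
definition zero_list :: "'a list" where "zero_list = []"
definition plus_list :: "'a list \<Rightarrow> 'a list \<Rightarrow> 'a list" where "plus_list = append"
instance by standard (simp_all add: zero_list_def plus_list_def)
end

type_synonym 'k free_assoc = "nat list \<Rightarrow>\<^sub>0 'k"
type_synonym 'k free_mod = "nat \<Rightarrow>\<^sub>0 'k free_assoc"

text \<open>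
  An element of \<open>'k free_mod\<close> is a family of coefficients in the free associative algebra, with
  finite support, indexed by the variables of sort 2.
\<close>

definition fa_gen :: "nat \<Rightarrow> 'k::field free_assoc" where
  "fa_gen x = Poly_Mapping.single [x] 1"

definition fm_gen :: "nat \<Rightarrow> 'k::field free_mod" where
  "fm_gen x = Poly_Mapping.single x 1"

definition fm_mult :: "'k::field free_assoc \<Rightarrow> 'k free_mod \<Rightarrow> 'k free_mod" where
  "fm_mult a v = Poly_Mapping.map (\<lambda>b. a * b) v"

definition fm_scale :: "'k::field \<Rightarrow> 'k free_mod \<Rightarrow> 'k free_mod" where
  "fm_scale c v = fm_mult (Poly_Mapping.single 0 c) v"

definition free_assoc_on :: "nat set \<Rightarrow> 'k::field free_assoc set" where
  "free_assoc_on Y = {a. \<forall>w \<in> Poly_Mapping.keys a. set w \<subseteq> Y}"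

definition free_mod_on :: "nat set \<Rightarrow> nat set \<Rightarrow> 'k::field free_mod set" where
  "free_mod_on X1 X2 = {v. Poly_Mapping.keys v \<subseteq> X2 \<and>
     (\<forall>x. Poly_Mapping.lookup v x \<in> free_assoc_on X1)}"

lemma pm_induct [case_names zero add]:
  fixes v :: "'a \<Rightarrow>\<^sub>0 'b::monoid_add"
  assumes "P 0" and "\<And>a b v. P v \<Longrightarrow> P (Poly_Mapping.single a b + v)"
  shows "P v"
proof (induction v rule: Poly_Mapping.update_induct)
  case const
  show ?case by (rule assms(1))
next
  case (update v a b)
  have "Poly_Mapping.update a b v = Poly_Mapping.single a b + v"
    using update(1) by (intro poly_mapping_eqI)
      (auto simp: lookup_update lookup_add lookup_single when_def in_keys_iff)
  then show ?case using assms(2)[OF update(3)] by simp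
qed

lemma single0_central:
  "(a :: 'k::field free_assoc) * Poly_Mapping.single 0 c = Poly_Mapping.single 0 c * a"
  by (induction a rule: pm_induct) (simp_all add: mult_single algebra_simps)

text \<open>The canonical map from the free Lie algebra to the free associative algebra.\<close>

primrec iota_term :: "'k::field lie_term \<Rightarrow> 'k free_assoc" where
  "iota_term (LGen x) = fa_gen x"
| "iota_term LZero = 0"
| "iota_term (LAdd s t) = iota_term s + iota_term t"
| "iota_term (LScale c s) = Poly_Mapping.single 0 c * iota_term s"
| "iota_term (LBracket s t) = iota_term s * iota_term t - iota_term t * iota_term s"

lemma single0_minus_one: "Poly_Mapping.single 0 (- 1) = (- 1 :: 'k::field free_assoc)"
  by (simp add: single_uminus flip: single_one)

lemma iota_term_cong: "lie_eq s t \<Longrightarrow> iota_term s = iota_term t"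
proof (induction rule: lie_eq.induct)
  case (lie_scale_scale c d s)
  show ?case by (simp add: mult_single flip: mult.assoc)
next
  case (lie_bracket_scale_left c s t)
  show ?case
    by (simp add: right_diff_distrib mult.assoc) (metis mult.assoc single0_central)
next
  case (lie_bracket_scale_right s c t)
  have "iota_term s * (Poly_Mapping.single 0 c * iota_term t)
      = Poly_Mapping.single 0 c * (iota_term s * iota_term t)"
    by (metis mult.assoc single0_central)
  then show ?case
    by (simp add: right_diff_distrib mult.assoc)
qed (simp_all add: algebra_simps single_add single0_minus_one)

lift_definition fl_iota :: "'k::field free_lie \<Rightarrow> 'k free_assoc" is iota_term
  by (rule iota_term_cong)


section \<open>Absolutely free representations\<close>

definition abs_free_rep ::
    "nat set \<Rightarrow> nat set \<Rightarrow> ('k::field, 'k free_lie, 'k free_mod) lie_rep" where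
  "abs_free_rep X1 X2 =
    \<lparr>lie_sort = \<lparr>carrier = free_lie_on X1, monoid.mult = undefined, one = undefined,
                 ring.zero = 0, add = (+), module.smult = fl_scale, lie_bracket = fl_bracket\<rparr>,
     vec_sort = \<lparr>carrier = free_mod_on X1 X2, monoid.mult = undefined, one = undefined,
                 ring.zero = 0, add = (+), module.smult = fm_scale\<rparr>,
     action = (\<lambda>l v. fm_mult (fl_iota l) v)\<rparr>"


section \<open>Identities and varieties\<close>

text \<open>An identity is satisfied in \<open>H\<close> if it holds under every assignment of the variables, that
  is, under every homomorphism into \<open>H\<close> of the free representation on all variables.\<close>

definition sat_lie ::
    "('k::field, 'l, 'v) lie_rep \<Rightarrow> 'k free_lie \<Rightarrow> 'k free_lie \<Rightarrow> bool" where
  "sat_lie H u w \<longleftrightarrow> (\<forall>(f, g) \<in> rep_hom (abs_free_rep UNIV UNIV) H. f u = f w)"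

definition sat_vec ::
    "('k::field, 'l, 'v) lie_rep \<Rightarrow> 'k free_mod \<Rightarrow> 'k free_mod \<Rightarrow> bool" where
  "sat_vec H u w \<longleftrightarrow> (\<forall>(f, g) \<in> rep_hom (abs_free_rep UNIV UNIV) H. g u = g w)"

text \<open>
  The class \<open>\<Theta>\<close> consists of the representations whose carriers are sets of elements of two
  ambient types \<open>'l\<close> and \<open>'v\<close>. If \<open>'k free_lie\<close> injects into \<open>'l\<close> and \<open>'k free_mod\<close> injects
  into \<open>'v\<close>, then every quotient of the free representation on all variables has an isomorphic copy
  in these types, so that the identities of \<open>\<Theta>\<close> are the same as those of the proper class.
\<close>

definition variety :: "('k::field, 'l, 'v) lie_rep set \<Rightarrow> bool" where
  "variety \<Theta> \<longleftrightarrow> (\<exists>E1 E2. \<Theta> = {H. is_lie_rep H \<and>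
     (\<forall>(u, w) \<in> E1. sat_lie H u w) \<and> (\<forall>(u, w) \<in> E2. sat_vec H u w)})"

inductive_set lie_monomials :: "'k::field free_lie set" where
  lie_monomial_gen: "fl_gen x \<in> lie_monomials"
| lie_monomial_bracket: "u \<in> lie_monomials \<Longrightarrow> v \<in> lie_monomials \<Longrightarrow> fl_bracket u v \<in> lie_monomials"

definition int_free_lie :: "'k::field free_lie set" where
  "int_free_lie = {u. \<exists>S (c :: 'k free_lie \<Rightarrow> int). finite S \<and> S \<subseteq> lie_monomials \<and>
     u = (\<Sum>m\<in>S. fl_scale (of_int (c m)) m)}"

definition int_free_mod :: "'k::field free_mod set" where
  "int_free_mod = {u. \<forall>x m. Poly_Mapping.lookup (Poly_Mapping.lookup u x) m \<in> \<int>}"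

definition defined_over_int :: "('k::field, 'l, 'v) lie_rep set \<Rightarrow> bool" where
  "defined_over_int \<Theta> \<longleftrightarrow> (\<exists>U1 U2. U1 \<subseteq> int_free_lie \<and> U2 \<subseteq> int_free_mod \<and>
     \<Theta> = {H. is_lie_rep H \<and> (\<forall>u\<in>U1. sat_lie H u 0) \<and> (\<forall>u\<in>U2. sat_vec H u 0)})"

definition degenerated :: "('k::field, 'l, 'v) lie_rep set \<Rightarrow> bool" where
  "degenerated \<Theta> \<longleftrightarrow>
     (\<forall>H\<in>\<Theta>. sat_vec H (fm_mult (fl_iota (fl_bracket (fl_gen 0) (fl_gen 1))) (fm_gen 0)) 0)"

text \<open>The two sorts of the congruence of all identities of \<open>\<Theta>\<close> in given variables.\<close>

definition Id_lie ::
    "('k::field, 'l, 'v) lie_rep set \<Rightarrow> nat set \<Rightarrow> ('k free_lie \<times> 'k free_lie) set" where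
  "Id_lie \<Theta> X1 = {(u, w). u \<in> free_lie_on X1 \<and> w \<in> free_lie_on X1 \<and> (\<forall>H\<in>\<Theta>. sat_lie H u w)}"

definition Id_vec ::
    "('k::field, 'l, 'v) lie_rep set \<Rightarrow> nat set \<Rightarrow> nat set \<Rightarrow> ('k free_mod \<times> 'k free_mod) set" where
  "Id_vec \<Theta> X1 X2 =
     {(u, w). u \<in> free_mod_on X1 X2 \<and> w \<in> free_mod_on X1 X2 \<and> (\<forall>H\<in>\<Theta>. sat_vec H u w)}"

definition lie_ideal :: "('k::field, 'l, 'v) lie_rep set \<Rightarrow> nat set \<Rightarrow> 'k free_lie set" where
  "lie_ideal \<Theta> X1 = {u. (u, 0) \<in> Id_lie \<Theta> X1}"

definition action_type :: "('k::field, 'l, 'v) lie_rep set \<Rightarrow> bool" where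
  "action_type \<Theta> \<longleftrightarrow> (\<forall>X1. finite X1 \<longrightarrow> lie_ideal \<Theta> X1 = {0})"


section \<open>Free representations of a variety\<close>

definition quotient_rep ::
    "('k, 'l, 'v) lie_rep \<Rightarrow> ('l \<times> 'l) set \<Rightarrow> ('v \<times> 'v) set \<Rightarrow> ('k, 'l set, 'v set) lie_rep" where
  "quotient_rep H R S = (let L = lie_sort H; V = vec_sort H in
    \<lparr>lie_sort = \<lparr>carrier = carrier L // R, monoid.mult = undefined, one = undefined,
                 ring.zero = R `` {\<zero>\<^bsub>L\<^esub>},
                 add = (\<lambda>A B. \<Union>a\<in>A. \<Union>b\<in>B. R `` {a \<oplus>\<^bsub>L\<^esub> b}),
                 module.smult = (\<lambda>c A. \<Union>a\<in>A. R `` {c \<odot>\<^bsub>L\<^esub> a}),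
                 lie_bracket = (\<lambda>A B. \<Union>a\<in>A. \<Union>b\<in>B. R `` {lie_bracket L a b})\<rparr>,
     vec_sort = \<lparr>carrier = carrier V // S, monoid.mult = undefined, one = undefined,
                 ring.zero = S `` {\<zero>\<^bsub>V\<^esub>},
                 add = (\<lambda>A B. \<Union>a\<in>A. \<Union>b\<in>B. S `` {a \<oplus>\<^bsub>V\<^esub> b}),
                 module.smult = (\<lambda>c A. \<Union>a\<in>A. S `` {c \<odot>\<^bsub>V\<^esub> a})\<rparr>,
     action = (\<lambda>A B. \<Union>a\<in>A. \<Union>b\<in>B. S `` {action H a b})\<rparr>)"

definition free_rep ::
    "('k::field, 'l, 'v) lie_rep set \<Rightarrow> nat set \<Rightarrow> nat set \<Rightarrow>
     ('k, 'k free_lie set, 'k free_mod set) lie_rep" where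
  "free_rep \<Theta> X1 X2 = quotient_rep (abs_free_rep X1 X2) (Id_lie \<Theta> X1) (Id_vec \<Theta> X1 X2)"


section \<open>Categories and their automorphisms\<close>

record ('o, 'a) cat =
  Ob :: "'o set"
  Arr :: "'a set"
  Dom :: "'a \<Rightarrow> 'o"
  Cod :: "'a \<Rightarrow> 'o"
  Ident :: "'o \<Rightarrow> 'a"
  Comp :: "'a \<Rightarrow> 'a \<Rightarrow> 'a"

locale is_category =
  fixes C :: "('o, 'a) cat"
  assumes dom_closed [simp]: "a \<in> Arr C \<Longrightarrow> Dom C a \<in> Ob C"
    and cod_closed [simp]: "a \<in> Arr C \<Longrightarrow> Cod C a \<in> Ob C"
    and ident_closed [simp]: "A \<in> Ob C \<Longrightarrow> Ident C A \<in> Arr C"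
    and dom_ident [simp]: "A \<in> Ob C \<Longrightarrow> Dom C (Ident C A) = A"
    and cod_ident [simp]: "A \<in> Ob C \<Longrightarrow> Cod C (Ident C A) = A"
    and comp_closed [simp]:
      "a \<in> Arr C \<Longrightarrow> b \<in> Arr C \<Longrightarrow> Dom C b = Cod C a \<Longrightarrow> Comp C b a \<in> Arr C"
    and dom_comp [simp]:
      "a \<in> Arr C \<Longrightarrow> b \<in> Arr C \<Longrightarrow> Dom C b = Cod C a \<Longrightarrow> Dom C (Comp C b a) = Dom C a"
    and cod_comp [simp]:
      "a \<in> Arr C \<Longrightarrow> b \<in> Arr C \<Longrightarrow> Dom C b = Cod C a \<Longrightarrow> Cod C (Comp C b a) = Cod C b"
    and comp_ident [simp]: "a \<in> Arr C \<Longrightarrow> Dom C a = A \<Longrightarrow> Comp C a (Ident C A) = a"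
    and ident_comp [simp]: "a \<in> Arr C \<Longrightarrow> Cod C a = A \<Longrightarrow> Comp C (Ident C A) a = a"
    and comp_assoc:
      "a \<in> Arr C \<Longrightarrow> b \<in> Arr C \<Longrightarrow> c \<in> Arr C \<Longrightarrow> Dom C b = Cod C a \<Longrightarrow> Dom C c = Cod C b \<Longrightarrow>
       Comp C c (Comp C b a) = Comp C (Comp C c b) a"

text \<open>An automorphism is given by its (extensional) maps on objects and on arrows.\<close>

definition cat_automorphisms :: "('o, 'a) cat \<Rightarrow> (('o \<Rightarrow> 'o) \<times> ('a \<Rightarrow> 'a)) set" where
  "cat_automorphisms C = {(F, f). F \<in> Bij (Ob C) \<and> f \<in> Bij (Arr C) \<and>
     (\<forall>a\<in>Arr C. Dom C (f a) = F (Dom C a) \<and> Cod C (f a) = F (Cod C a)) \<and>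
     (\<forall>A\<in>Ob C. f (Ident C A) = Ident C (F A)) \<and>
     (\<forall>a\<in>Arr C. \<forall>b\<in>Arr C. Dom C b = Cod C a \<longrightarrow> f (Comp C b a) = Comp C (f b) (f a))}"

definition cat_Aut :: "('o, 'a) cat \<Rightarrow> (('o \<Rightarrow> 'o) \<times> ('a \<Rightarrow> 'a)) monoid" where
  "cat_Aut C = \<lparr>carrier = cat_automorphisms C,
     monoid.mult = (\<lambda>(F, f) (G, g). (compose (Ob C) F G, compose (Arr C) f g)),
     one = (restrict id (Ob C), restrict id (Arr C))\<rparr>"

definition inverse_arrows :: "('o, 'a) cat \<Rightarrow> 'a \<Rightarrow> 'a \<Rightarrow> bool" where
  "inverse_arrows C s t \<longleftrightarrow> s \<in> Arr C \<and> t \<in> Arr C \<and> Dom C t = Cod C s \<and> Cod C t = Dom C s \<and>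
     Comp C t s = Ident C (Dom C s) \<and> Comp C s t = Ident C (Cod C s)"

definition inner_automorphisms :: "('o, 'a) cat \<Rightarrow> (('o \<Rightarrow> 'o) \<times> ('a \<Rightarrow> 'a)) set" where
  "inner_automorphisms C = {(F, f) \<in> cat_automorphisms C. \<exists>\<sigma> \<tau>.
     (\<forall>A\<in>Ob C. inverse_arrows C (\<sigma> A) (\<tau> A) \<and> Dom C (\<sigma> A) = A \<and> Cod C (\<sigma> A) = F A) \<and>
     (\<forall>a\<in>Arr C. f a = Comp C (\<sigma> (Cod C a)) (Comp C a (\<tau> (Dom C a))))}"


section \<open>The category of free representations and the automorphism group of the field\<close>

text \<open>An arrow is a homomorphism together with its domain and codomain.\<close>

type_synonym ('k, 'l, 'v) rep_arrow =
  "('k, 'l, 'v) lie_rep \<times> (('l \<Rightarrow> 'l) \<times> ('v \<Rightarrow> 'v)) \<times> ('k, 'l, 'v) lie_rep"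

definition rep_category ::
    "('k, 'l, 'v) lie_rep set \<Rightarrow> (('k, 'l, 'v) lie_rep, ('k, 'l, 'v) rep_arrow) cat" where
  "rep_category \<C> =
    \<lparr>Ob = \<C>,
     Arr = {(H1, h, H2). H1 \<in> \<C> \<and> H2 \<in> \<C> \<and> h \<in> rep_hom H1 H2},
     Dom = (\<lambda>(H1, h, H2). H1),
     Cod = (\<lambda>(H1, h, H2). H2),
     Ident = (\<lambda>H. (H, (restrict id (carrier (lie_sort H)), restrict id (carrier (vec_sort H))), H)),
     Comp = (\<lambda>(H2, (f', g'), H3) (H1, (f, g), H2').
       (H1, (compose (carrier (lie_sort H1)) f' f, compose (carrier (vec_sort H1)) g' g), H3))\<rparr>"

definition Theta0 ::
    "('k::field, 'l, 'v) lie_rep set \<Rightarrow>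
     (('k, 'k free_lie set, 'k free_mod set) lie_rep,
      ('k, 'k free_lie set, 'k free_mod set) rep_arrow) cat" where
  "Theta0 \<Theta> = rep_category {free_rep \<Theta> X1 X2 |X1 X2. finite X1 \<and> finite X2}"

definition field_Aut :: "('k::field \<Rightarrow> 'k) monoid" where
  "field_Aut = \<lparr>carrier = ring_iso ring_of_type_algebra ring_of_type_algebra,
     monoid.mult = (\<circ>), one = id\<rparr>"

section \<open>The inner automorphisms form a normal subgroup\<close>

lemma (in is_category) group_cat_Aut: "group (cat_Aut C)"
proof (rule groupI)
  fix x y assume xy: "x \<in> carrier (cat_Aut C)" "y \<in> carrier (cat_Aut C)"
  obtain F f G g where [simp]: "x = (F, f)" "y = (G, g)" by fastforce
  have "compose (Ob C) F G \<in> Bij (Ob C)" "compose (Arr C) f g \<in> Bij (Arr C)"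
    using xy by (auto simp: cat_Aut_def cat_automorphisms_def intro: compose_Bij)
  moreover have "g a \<in> Arr C" if "a \<in> Arr C" for a
    using that xy
    by (auto simp: cat_Aut_def cat_automorphisms_def dest: Bij_imp_funcset[THEN funcset_mem])
  ultimately show "x \<otimes>\<^bsub>cat_Aut C\<^esub> y \<in> carrier (cat_Aut C)"
    using xy by (simp add: cat_Aut_def cat_automorphisms_def compose_eq Bij_imp_funcset[THEN funcset_mem])
next
  show "\<one>\<^bsub>cat_Aut C\<^esub> \<in> carrier (cat_Aut C)"
    using id_Bij[of "Ob C"] id_Bij[of "Arr C"]
    by (auto simp: cat_Aut_def cat_automorphisms_def id_def)
next
  fix x y z assume "x \<in> carrier (cat_Aut C)" "y \<in> carrier (cat_Aut C)" "z \<in> carrier (cat_Aut C)"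
  then show "x \<otimes>\<^bsub>cat_Aut C\<^esub> y \<otimes>\<^bsub>cat_Aut C\<^esub> z = x \<otimes>\<^bsub>cat_Aut C\<^esub> (y \<otimes>\<^bsub>cat_Aut C\<^esub> z)"
    by (auto simp: cat_Aut_def cat_automorphisms_def compose_def fun_eq_iff
      Bij_imp_funcset[THEN funcset_mem])
next
  fix x assume "x \<in> carrier (cat_Aut C)"
  then show "\<one>\<^bsub>cat_Aut C\<^esub> \<otimes>\<^bsub>cat_Aut C\<^esub> x = x"
    by (auto simp: cat_Aut_def cat_automorphisms_def id_def Bij_imp_funcset Bij_imp_extensional)
next
  fix x assume x: "x \<in> carrier (cat_Aut C)"
  obtain F f where [simp]: "x = (F, f)" by fastforce
  let ?F = "\<lambda>A\<in>Ob C. inv_into (Ob C) F A" and ?f = "\<lambda>a\<in>Arr C. inv_into (Arr C) f a"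
  have Ff: "F \<in> Bij (Ob C)" "f \<in> Bij (Arr C)"
    using x by (auto simp: cat_Aut_def cat_automorphisms_def)
  have d: "Dom C (f a) = F (Dom C a)" "Cod C (f a) = F (Cod C a)" if "a \<in> Arr C" for a
    using x that by (auto simp: cat_Aut_def cat_automorphisms_def)
  have i: "f (Ident C A) = Ident C (F A)" if "A \<in> Ob C" for A
    using x that by (auto simp: cat_Aut_def cat_automorphisms_def)
  have c: "f (Comp C b a) = Comp C (f b) (f a)"
    if "a \<in> Arr C" "b \<in> Arr C" "Dom C b = Cod C a" for a b
    using x that by (auto simp: cat_Aut_def cat_automorphisms_def)
  from Ff have bF: "bij_betw F (Ob C) (Ob C)" and bf: "bij_betw f (Arr C) (Arr C)"
    by (auto simp: Bij_def)
  have F1: "inv_into (Ob C) F (F A) = A" if "A \<in> Ob C" for A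
    using bF that by (simp add: bij_betw_inv_into_left)
  have f1: "inv_into (Arr C) f (f a) = a" if "a \<in> Arr C" for a
    using bf that by (simp add: bij_betw_inv_into_left)
  have f2: "\<exists>b\<in>Arr C. a = f b" if "a \<in> Arr C" for a
    using bf that by (auto simp: bij_betw_def)
  have F2: "\<exists>B\<in>Ob C. A = F B" if "A \<in> Ob C" for A
    using bF that by (auto simp: bij_betw_def)
  have fA: "f a \<in> Arr C" if "a \<in> Arr C" for a using bf that by (auto simp: bij_betw_def)
  have FO: "F A \<in> Ob C" if "A \<in> Ob C" for A using bF that by (auto simp: bij_betw_def)
  have inj: "F A = F B \<longleftrightarrow> A = B" if "A \<in> Ob C" "B \<in> Ob C" for A B
    using bF that by (auto simp: bij_betw_def inj_on_def)
  have D: "Dom C (?f a) = ?F (Dom C a) \<and> Cod C (?f a) = ?F (Cod C a)" if "a \<in> Arr C" for a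
    using f2[OF that] fA by (auto simp: f1 d F1)
  have I: "?f (Ident C A) = Ident C (?F A)" if "A \<in> Ob C" for A
    using F2[OF that] FO by (auto simp: F1 f1 simp flip: i)
  have CC: "?f (Comp C b a) = Comp C (?f b) (?f a)"
    if ab: "a \<in> Arr C" "b \<in> Arr C" "Dom C b = Cod C a" for a b
  proof -
    obtain a' b' where ab': "a' \<in> Arr C" "b' \<in> Arr C" "a = f a'" "b = f b'"
      using f2 ab by blast
    then have "Dom C b' = Cod C a'" using ab(3) inj by (simp add: d)
    then show ?thesis using ab' fA by (simp add: f1 flip: c)
  qed
  have "(?F, ?f) \<in> carrier (cat_Aut C)"
    using D I CC Ff restrict_inv_into_Bij[of F] restrict_inv_into_Bij[of f]
    by (auto simp: cat_Aut_def cat_automorphisms_def)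
  moreover have "(?F, ?f) \<otimes>\<^bsub>cat_Aut C\<^esub> x = \<one>\<^bsub>cat_Aut C\<^esub>"
    using Ff by (simp add: cat_Aut_def Bij_compose_restrict_eq id_def)
  ultimately show "\<exists>y\<in>carrier (cat_Aut C). y \<otimes>\<^bsub>cat_Aut C\<^esub> x = \<one>\<^bsub>cat_Aut C\<^esub>" by blast
qed


lemma (in is_category) inner_normal: "inner_automorphisms C \<lhd> cat_Aut C"
proof -
  interpret G: group "cat_Aut C" by (rule group_cat_Aut)
  have sub: "inner_automorphisms C \<subseteq> carrier (cat_Aut C)"
    by (auto simp: inner_automorphisms_def cat_Aut_def)
  have mult: "(F, f) \<otimes>\<^bsub>cat_Aut C\<^esub> (G, g) = (compose (Ob C) F G, compose (Arr C) f g)" for F f G g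
    by (simp add: cat_Aut_def)
  have autD: "F A \<in> Ob C" "f a \<in> Arr C" "Dom C (f a) = F (Dom C a)" "Cod C (f a) = F (Cod C a)"
    "f (Ident C A) = Ident C (F A)"
    "b \<in> Arr C \<Longrightarrow> Dom C b = Cod C a \<Longrightarrow> f (Comp C b a) = Comp C (f b) (f a)"
    if "(F, f) \<in> carrier (cat_Aut C)" "A \<in> Ob C" "a \<in> Arr C" for F f A a b
    using that by (auto simp: cat_Aut_def cat_automorphisms_def Bij_imp_funcset[THEN funcset_mem])
  have inv: "F (F' A) = A \<and> F' (F A) = A" if "A \<in> Ob C"
      "(F, f) \<in> carrier (cat_Aut C)" "inv\<^bsub>cat_Aut C\<^esub> (F, f) = (F', f')" for F f F' f' A
    using G.l_inv[OF that(2)] G.r_inv[OF that(2)] that(1)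
    by (auto simp: that(3) mult) (auto simp: cat_Aut_def fun_eq_iff compose_def split: if_splits)
  have inv': "f (f' a) = a \<and> f' (f a) = a" if "a \<in> Arr C"
      "(F, f) \<in> carrier (cat_Aut C)" "inv\<^bsub>cat_Aut C\<^esub> (F, f) = (F', f')" for F f F' f' a
    using G.l_inv[OF that(2)] G.r_inv[OF that(2)] that(1)
    by (auto simp: that(3) mult) (auto simp: cat_Aut_def fun_eq_iff compose_def split: if_splits)
  define P where "P F f s t \<longleftrightarrow> (\<forall>A\<in>Ob C. s A \<in> Arr C \<and> t A \<in> Arr C \<and> Dom C (s A) = A \<and>
     Cod C (s A) = F A \<and> Dom C (t A) = F A \<and> Cod C (t A) = A \<and> Comp C (t A) (s A) = Ident C A \<and>
     Comp C (s A) (t A) = Ident C (F A)) \<and>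
     (\<forall>a\<in>Arr C. f a = Comp C (s (Cod C a)) (Comp C a (t (Dom C a))))" for F f s t
  have inner_iff: "(F, f) \<in> inner_automorphisms C \<longleftrightarrow>
      (F, f) \<in> carrier (cat_Aut C) \<and> (\<exists>s t. P F f s t)" for F f
    unfolding inner_automorphisms_def P_def cat_Aut_def inverse_arrows_def mem_Collect_eq
      prod.case partial_object.simps
    by (rule conj_cong[OF refl], rule iff_exI, rule iff_exI, rule conj_cong[OF ball_cong[OF refl] refl])
      auto
  have one: "\<one>\<^bsub>cat_Aut C\<^esub> \<in> inner_automorphisms C"
  proof -
    have "P (restrict id (Ob C)) (restrict id (Arr C)) (Ident C) (Ident C)"
      by (auto simp: P_def)
    then show ?thesis using G.one_closed unfolding inner_iff[symmetric]
      by (metis cat_Aut_def inner_iff monoid.select_convs(2))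
  qed
  have inv_closed: "inv\<^bsub>cat_Aut C\<^esub> x \<in> inner_automorphisms C" if x: "x \<in> inner_automorphisms C" for x
  proof -
    obtain F f where [simp]: "x = (F, f)" by fastforce
    obtain F' f' where i: "inv\<^bsub>cat_Aut C\<^esub> (F, f) = (F', f')" by fastforce
    obtain s t where c: "(F, f) \<in> carrier (cat_Aut C)" and P: "P F f s t"
      using x by (auto simp: inner_iff)
    have c': "(F', f') \<in> carrier (cat_Aut C)" using G.inv_closed[OF c] i by simp
    have "f' a = Comp C (t (F' (Cod C a))) (Comp C a (s (F' (Dom C a))))" if a: "a \<in> Arr C" for a
    proof -
      define b where "b = f' a"
      have D: "Dom C b = F' (Dom C a)" "Cod C b = F' (Cod C a)" and b: "b \<in> Arr C"
        using a autD[OF c' dom_closed[OF a] a] by (auto simp: b_def)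
      have ab: "a = Comp C (s (Cod C b)) (Comp C b (t (Dom C b)))"
        using P b inv'[OF a c i] by (auto simp: P_def b_def)
      let ?s = "s (Dom C b)" and ?t = "t (Dom C b)" and ?s' = "s (Cod C b)" and ?t' = "t (Cod C b)"
      have facts: "?s \<in> Arr C" "?t \<in> Arr C" "?s' \<in> Arr C" "?t' \<in> Arr C" "Dom C ?s = Dom C b"
        "Cod C ?s = F (Dom C b)" "Dom C ?t = F (Dom C b)" "Cod C ?t = Dom C b"
        "Dom C ?s' = Cod C b" "Cod C ?s' = F (Cod C b)" "Dom C ?t' = F (Cod C b)" "Cod C ?t' = Cod C b"
        "Comp C ?t ?s = Ident C (Dom C b)" "Comp C ?t' ?s' = Ident C (Cod C b)"
        using P b by (auto simp: P_def)
      have "Comp C ?t' (Comp C a ?s) = Comp C ?t' (Comp C ?s' (Comp C (Comp C b ?t) ?s))"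
        unfolding ab using facts b by (simp add: comp_assoc)
      also have "Comp C (Comp C b ?t) ?s = b"
        using facts b by (simp flip: comp_assoc)
      also have "Comp C ?t' (Comp C ?s' b) = b"
        using facts b by (simp add: comp_assoc)
      finally show ?thesis by (simp add: b_def[symmetric] D)
    qed
    moreover have "F' A \<in> Ob C \<and> F (F' A) = A" if "A \<in> Ob C" for A
      using inv[OF that c i] c' that
      by (auto simp: cat_Aut_def cat_automorphisms_def Bij_imp_funcset[THEN funcset_mem])
    ultimately have "P F' f' (\<lambda>A. t (F' A)) (\<lambda>A. s (F' A))"
      using P unfolding P_def by simp
    then show ?thesis using c' by (auto simp: i inner_iff)
  qed
  have comp4: "Comp C (Comp C d c) (Comp C b a) = Comp C d (Comp C (Comp C c b) a)"
    if "a \<in> Arr C" "b \<in> Arr C" "c \<in> Arr C" "d \<in> Arr C" "Dom C b = Cod C a" "Dom C c = Cod C b"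
      "Dom C d = Cod C c" for a b c d
    using that by (simp add: comp_assoc)
  have mult_closed: "x \<otimes>\<^bsub>cat_Aut C\<^esub> y \<in> inner_automorphisms C"
    if x: "x \<in> inner_automorphisms C" and y: "y \<in> inner_automorphisms C" for x y
  proof -
    obtain F f G g where [simp]: "x = (F, f)" "y = (G, g)" by fastforce
    obtain s t where c: "(F, f) \<in> carrier (cat_Aut C)" and P: "P F f s t"
      using x by (auto simp: inner_iff)
    obtain s' t' where c': "(G, g) \<in> carrier (cat_Aut C)" and P': "P G g s' t'"
      using y by (auto simp: inner_iff)
    have GO: "G A \<in> Ob C" if "A \<in> Ob C" for A
      using c' that by (auto simp: cat_Aut_def cat_automorphisms_def Bij_imp_funcset[THEN funcset_mem])
    note Pd = P[unfolded P_def, THEN conjunct1, rule_format]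
    note Pd' = P'[unfolded P_def, THEN conjunct1, rule_format]
    have 1: "Comp C (Comp C (t' A) (t (G A))) (Comp C (s (G A)) (s' A)) = Ident C A"
      and 2: "Comp C (Comp C (s (G A)) (s' A)) (Comp C (t' A) (t (G A))) = Ident C (F (G A))"
      if A: "A \<in> Ob C" for A
    proof -
      note facts = Pd[OF GO[OF A]] Pd'[OF A]
      have "Comp C (Comp C (t' A) (t (G A))) (Comp C (s (G A)) (s' A))
          = Comp C (t' A) (Comp C (Comp C (t (G A)) (s (G A))) (s' A))"
        using facts GO[OF A] A by (intro comp4) auto
      then show "Comp C (Comp C (t' A) (t (G A))) (Comp C (s (G A)) (s' A)) = Ident C A"
        using facts by simp
      have "Comp C (Comp C (s (G A)) (s' A)) (Comp C (t' A) (t (G A)))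
          = Comp C (s (G A)) (Comp C (Comp C (s' A) (t' A)) (t (G A)))"
        using facts GO[OF A] A by (intro comp4) auto
      then show "Comp C (Comp C (s (G A)) (s' A)) (Comp C (t' A) (t (G A))) = Ident C (F (G A))"
        using facts by simp
    qed
    have 3: "f (g a) = Comp C (Comp C (s (G (Cod C a))) (s' (Cod C a)))
        (Comp C a (Comp C (t' (Dom C a)) (t (G (Dom C a)))))" if a: "a \<in> Arr C" for a
    proof -
      have g: "g a \<in> Arr C" "Dom C (g a) = G (Dom C a)" "Cod C (g a) = G (Cod C a)"
        using autD[OF c' dom_closed[OF a] a] by auto
      have ga: "g a = Comp C (s' (Cod C a)) (Comp C a (t' (Dom C a)))"
        using P' a by (auto simp: P_def)
      have "f (g a) = Comp C (s (G (Cod C a))) (Comp C (g a) (t (G (Dom C a))))"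
        using P g by (auto simp: P_def)
      then show ?thesis unfolding ga
        using a Pd[OF GO, OF dom_closed[OF a]] Pd[OF GO, OF cod_closed[OF a]]
          Pd'[OF dom_closed[OF a]] Pd'[OF cod_closed[OF a]]
        by (simp add: comp_assoc)
    qed
    have "P (compose (Ob C) F G) (compose (Arr C) f g)
        (\<lambda>A. Comp C (s (G A)) (s' A)) (\<lambda>A. Comp C (t' A) (t (G A)))"
      unfolding P_def using Pd[OF GO] Pd' 1 2 3 by (simp add: compose_eq)
    then show ?thesis using G.m_closed[OF c c'] by (auto simp: mult inner_iff)
  qed
  have conj_closed: "x \<otimes>\<^bsub>cat_Aut C\<^esub> y \<otimes>\<^bsub>cat_Aut C\<^esub> inv\<^bsub>cat_Aut C\<^esub> x \<in> inner_automorphisms C"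
    if x: "x \<in> carrier (cat_Aut C)" and y: "y \<in> inner_automorphisms C" for x y
  proof -
    obtain F f G g where [simp]: "x = (F, f)" "y = (G, g)" by fastforce
    obtain F' f' where i: "inv\<^bsub>cat_Aut C\<^esub> (F, f) = (F', f')" by fastforce
    have c: "(F, f) \<in> carrier (cat_Aut C)" using x by simp
    have c': "(F', f') \<in> carrier (cat_Aut C)" using G.inv_closed[OF c] i by simp
    obtain s t where cG: "(G, g) \<in> carrier (cat_Aut C)" and P: "P G g s t"
      using y by (auto simp: inner_iff)
    have FO: "F A \<in> Ob C" "F' A \<in> Ob C" "G A \<in> Ob C" if "A \<in> Ob C" for A
      using c c' cG that
      by (auto simp: cat_Aut_def cat_automorphisms_def Bij_imp_funcset[THEN funcset_mem])
    have f: "f a \<in> Arr C" "Dom C (f a) = F (Dom C a)" "Cod C (f a) = F (Cod C a)"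
      if "a \<in> Arr C" for a
      using autD[OF c dom_closed[OF that] that] by auto
    have f': "f' a \<in> Arr C" "Dom C (f' a) = F' (Dom C a)" "Cod C (f' a) = F' (Cod C a)"
      if "a \<in> Arr C" for a
      using autD[OF c' dom_closed[OF that] that] by auto
    have g: "g a \<in> Arr C" if "a \<in> Arr C" for a
      using autD[OF cG dom_closed[OF that] that] by auto
    have fc: "f (Comp C b a) = Comp C (f b) (f a)"
      if "a \<in> Arr C" "b \<in> Arr C" "Dom C b = Cod C a" for a b
      using autD(6)[OF c dom_closed[OF that(1)] that] .
    have fi: "f (Ident C A) = Ident C (F A)" if "A \<in> Ob C" for A
      using autD(5)[OF c that ident_closed[OF that]] .
    have ii: "F (F' A) = A" if "A \<in> Ob C" for A using inv[OF that c i] by simp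
    have ii': "f (f' a) = a" if "a \<in> Arr C" for a using inv'[OF that c i] by simp
    note Pd = P[unfolded P_def, THEN conjunct1, rule_format]
    note Pa = P[unfolded P_def, THEN conjunct2, rule_format]
    have 1: "f (s (F' A)) \<in> Arr C \<and> f (t (F' A)) \<in> Arr C \<and> Dom C (f (s (F' A))) = A \<and>
        Cod C (f (s (F' A))) = F (G (F' A)) \<and> Dom C (f (t (F' A))) = F (G (F' A)) \<and>
        Cod C (f (t (F' A))) = A \<and>
        Comp C (f (t (F' A))) (f (s (F' A))) = Ident C A \<and>
        Comp C (f (s (F' A))) (f (t (F' A))) = Ident C (F (G (F' A)))" if A: "A \<in> Ob C" for A
      using Pd[OF FO(2)[OF A]] FO[OF FO(2)[OF A]] FO(2)[OF A] by (simp add: f fi ii A flip: fc)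
    have 2: "f (g (f' a)) = Comp C (f (s (F' (Cod C a)))) (Comp C a (f (t (F' (Dom C a)))))"
      if a: "a \<in> Arr C" for a
      using Pa[OF f'(1)[OF a]] f'[OF a] Pd[OF FO(2), OF dom_closed[OF a]]
        Pd[OF FO(2), OF cod_closed[OF a]] by (simp add: fc ii' a)
    have "P (compose (Ob C) (compose (Ob C) F G) F') (compose (Arr C) (compose (Arr C) f g) f')
        (\<lambda>A. f (s (F' A))) (\<lambda>A. f (t (F' A)))"
      unfolding P_def using 1 2 FO f' g by (simp add: compose_eq)
    moreover have "x \<otimes>\<^bsub>cat_Aut C\<^esub> y \<otimes>\<^bsub>cat_Aut C\<^esub> inv\<^bsub>cat_Aut C\<^esub> x \<in> carrier (cat_Aut C)"
      using c cG by simp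
    ultimately show ?thesis by (auto simp: i mult inner_iff)
  qed
  have "subgroup (inner_automorphisms C) (cat_Aut C)"
    using sub one inv_closed mult_closed by (intro G.subgroupI) auto
  then show ?thesis
    using conj_closed by (simp add: G.normal_inv_iff)
qed


lemma linear_maps_id:
  assumes "module R V" and "carrier R = UNIV"
  shows "restrict id (carrier V) \<in> linear_maps V V"
proof -
  interpret module R V by fact
  show ?thesis using assms(2) by (auto simp: linear_maps_def)
qed

lemma linear_maps_compose:
  assumes "f \<in> linear_maps U V" and "g \<in> linear_maps V W"
    and "module R U" and "carrier R = UNIV"
  shows "compose (carrier U) g f \<in> linear_maps U W"
proof -
  interpret module R U by fact
  show ?thesis
    using assms by (auto simp: linear_maps_def compose_def PiE_iff extensional_def)
qed

lemma rep_category_is_category: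
  assumes "\<And>H. H \<in> \<C> \<Longrightarrow> is_lie_rep (H :: ('k::field, 'l, 'v) lie_rep)"
  shows "is_category (rep_category \<C>)"
proof -
  note K = ring_of_type_algebra_def
  have m: "module (ring_of_type_algebra :: 'k ring) (lie_sort H)"
    "module (ring_of_type_algebra :: 'k ring) (vec_sort H)" 
    "\<And>x y. x \<in> carrier (lie_sort H) \<Longrightarrow> y \<in> carrier (lie_sort H) \<Longrightarrow>
       lie_bracket (lie_sort H) x y \<in> carrier (lie_sort H)"
    "\<And>l v. l \<in> carrier (lie_sort H) \<Longrightarrow> v \<in> carrier (vec_sort H) \<Longrightarrow>
       action H l v \<in> carrier (vec_sort H)" if "H \<in> \<C>" for H
    using assms[OF that] by (auto simp: is_lie_rep_def is_lie_algebra_def Let_def)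
  have K: "carrier (ring_of_type_algebra :: 'k ring) = UNIV" by (simp add: K)
  have mem: "f x \<in> carrier W" if "f \<in> linear_maps V W" "x \<in> carrier V" 
    for f x and V :: "('k, 'x, 'y) module_scheme" and W :: "('k, 'z, 'w) module_scheme"
    using that by (auto simp: linear_maps_def)
  have idh: "(\<lambda>x\<in>carrier (lie_sort H). x, \<lambda>x\<in>carrier (vec_sort H). x) \<in> rep_hom H H"
    if "H \<in> \<C>" for H
    using m[OF that] linear_maps_id[OF m(1)[OF that] K] linear_maps_id[OF m(2)[OF that] K]
    by (auto simp: rep_hom_def id_def)
  have ch: "(compose (carrier (lie_sort H1)) f' f, compose (carrier (vec_sort H1)) g' g) \<in> rep_hom H1 H3"
    if "H1 \<in> \<C>" "(f, g) \<in> rep_hom H1 H2" "(f', g') \<in> rep_hom H2 H3"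
    for H1 H2 H3 :: "('k, 'l, 'v) lie_rep" and f g f' g'
    using that m[OF that(1)] linear_maps_compose[of f "lie_sort H1" "lie_sort H2" f', OF _ _ m(1)[OF that(1)] K]
      linear_maps_compose[of g "vec_sort H1" "vec_sort H2" g', OF _ _ m(2)[OF that(1)] K]
    by (auto simp: rep_hom_def compose_eq mem)
  have ext: "f \<in> extensional (carrier (lie_sort H1))" "f \<in> carrier (lie_sort H1) \<rightarrow> carrier (lie_sort H2)"
    "g \<in> extensional (carrier (vec_sort H1))" "g \<in> carrier (vec_sort H1) \<rightarrow> carrier (vec_sort H2)"
    if "(f, g) \<in> rep_hom H1 H2" for f g and H1 H2 :: "('k, 'l, 'v) lie_rep"
    using that by (auto simp: rep_hom_def linear_maps_def PiE_def)
  have cid: "compose A f (\<lambda>x\<in>A. x) = f" if "f \<in> extensional A" for f :: "'x \<Rightarrow> 'y" and A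
    using that by (auto simp: compose_def fun_eq_iff extensional_def)
  have idc: "compose A (\<lambda>x\<in>B. x) f = f" if "f \<in> extensional A" "f \<in> A \<rightarrow> B"
    for f :: "'x \<Rightarrow> 'y" and A B
    using that by (auto simp: compose_def fun_eq_iff extensional_def)
  show ?thesis
    by unfold_locales
      (auto simp: rep_category_def id_def idh ch ext cid idc intro!: compose_assoc dest: ext)
qed

lemma lookup_fm_mult [simp]: "Poly_Mapping.lookup (fm_mult a v) x = a * Poly_Mapping.lookup v x"
  unfolding fm_mult_def by transfer (auto simp: when_def)

lemma fm_mult_simps:
  "fm_mult a (v + w) = fm_mult a v + fm_mult a w"
  "fm_mult (a + b) v = fm_mult a v + fm_mult b v"
  "fm_mult (a * b) v = fm_mult a (fm_mult b v)"
  "fm_mult 1 v = v"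
  "fm_mult (a - b) v = fm_mult a v - fm_mult b v"
  by (auto intro!: poly_mapping_eqI simp: lookup_add algebra_simps)

lemma fl_iota_simps:
  "fl_iota (fl_gen x) = fa_gen x"
  "fl_iota 0 = 0"
  "fl_iota (u + w) = fl_iota u + fl_iota w"
  "fl_iota (fl_scale c u) = Poly_Mapping.single 0 c * fl_iota u"
  "fl_iota (fl_bracket u w) = fl_iota u * fl_iota w - fl_iota w * fl_iota u"
proof -
  show "fl_iota (fl_gen x) = fa_gen x" by transfer simp
  show "fl_iota 0 = 0" by transfer simp
  show "fl_iota (u + w) = fl_iota u + fl_iota w" by transfer simp
  show "fl_iota (fl_scale c u) = Poly_Mapping.single 0 c * fl_iota u" by transfer simp
  show "fl_iota (fl_bracket u w) = fl_iota u * fl_iota w - fl_iota w * fl_iota u"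
    by transfer simp
qed

lemma free_assoc_on_closed:
  "0 \<in> free_assoc_on Y"
  "a \<in> free_assoc_on Y \<Longrightarrow> b \<in> free_assoc_on Y \<Longrightarrow> a + b \<in> free_assoc_on Y"
  "a \<in> free_assoc_on Y \<Longrightarrow> b \<in> free_assoc_on Y \<Longrightarrow> a - b \<in> free_assoc_on Y"
  "a \<in> free_assoc_on Y \<Longrightarrow> b \<in> free_assoc_on Y \<Longrightarrow> a * b \<in> free_assoc_on Y"
  "Poly_Mapping.single 0 c \<in> free_assoc_on Y"
  "x \<in> Y \<Longrightarrow> fa_gen x \<in> free_assoc_on Y"
proof -
  show "a + b \<in> free_assoc_on Y" if "a \<in> free_assoc_on Y" "b \<in> free_assoc_on Y"
    using that keys_add[of a b] by (fastforce simp: free_assoc_on_def)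
  show "a - b \<in> free_assoc_on Y" if "a \<in> free_assoc_on Y" "b \<in> free_assoc_on Y"
    using that keys_diff[of a b] by (fastforce simp: free_assoc_on_def)
  show "a * b \<in> free_assoc_on Y" if "a \<in> free_assoc_on Y" "b \<in> free_assoc_on Y"
    using that keys_mult[of a b] by (fastforce simp: free_assoc_on_def plus_list_def)
qed (auto simp: free_assoc_on_def fa_gen_def zero_list_def split: if_splits)

lemma fl_iota_closed: "u \<in> free_lie_on Y \<Longrightarrow> fl_iota u \<in> free_assoc_on Y"
  by (induction rule: free_lie_on.induct)
     (auto simp: fl_iota_simps intro: free_assoc_on_closed)

lemma free_mod_on_closed:
  "0 \<in> free_mod_on X1 X2"
  "v \<in> free_mod_on X1 X2 \<Longrightarrow> w \<in> free_mod_on X1 X2 \<Longrightarrow> v + w \<in> free_mod_on X1 X2"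
  "a \<in> free_assoc_on X1 \<Longrightarrow> v \<in> free_mod_on X1 X2 \<Longrightarrow> fm_mult a v \<in> free_mod_on X1 X2"
proof -
  show "0 \<in> free_mod_on X1 X2" by (simp add: free_mod_on_def free_assoc_on_closed)
  show "v + w \<in> free_mod_on X1 X2" if "v \<in> free_mod_on X1 X2" "w \<in> free_mod_on X1 X2"
    using that keys_add[of v w] by (auto simp: free_mod_on_def lookup_add free_assoc_on_closed)
  show "fm_mult a v \<in> free_mod_on X1 X2" if "a \<in> free_assoc_on X1" "v \<in> free_mod_on X1 X2"
    using that by (fastforce simp: free_mod_on_def free_assoc_on_closed in_keys_iff)
qed

lemma fl_simps:
  "fl_scale c (u + w) = fl_scale c u + fl_scale c w"
  "fl_scale (c + d) u = fl_scale c u + fl_scale d u"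
  "fl_scale (c * d) u = fl_scale c (fl_scale d u)"
  "fl_scale 1 u = u"
  "fl_scale (- 1) u = - u"
  "fl_bracket (u + v) w = fl_bracket u w + fl_bracket v w"
  "fl_bracket w (u + v) = fl_bracket w u + fl_bracket w v"
  "fl_bracket (fl_scale c u) w = fl_scale c (fl_bracket u w)"
  "fl_bracket u (fl_scale c w) = fl_scale c (fl_bracket u w)"
  "fl_bracket u u = 0"
  "fl_bracket u (fl_bracket v w) + fl_bracket v (fl_bracket w u) + fl_bracket w (fl_bracket u v) = 0"
proof -
  show "fl_scale c (u + w) = fl_scale c u + fl_scale c w" by transfer (rule lie_scale_add_right)
  show "fl_scale (c + d) u = fl_scale c u + fl_scale d u" by transfer (rule lie_scale_add_left)
  show "fl_scale (c * d) u = fl_scale c (fl_scale d u)" by transfer (rule lie_scale_scale)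
  show "fl_scale 1 u = u" by transfer (rule lie_scale_one)
  show "fl_scale (- 1) u = - u" by transfer (rule lie_refl)
  show "fl_bracket (u + v) w = fl_bracket u w + fl_bracket v w"
    by transfer (rule lie_bracket_add_left)
  show "fl_bracket w (u + v) = fl_bracket w u + fl_bracket w v"
    by transfer (rule lie_bracket_add_right)
  show "fl_bracket (fl_scale c u) w = fl_scale c (fl_bracket u w)"
    by transfer (rule lie_bracket_scale_left)
  show "fl_bracket u (fl_scale c w) = fl_scale c (fl_bracket u w)"
    by transfer (rule lie_bracket_scale_right)
  show "fl_bracket u u = 0" by transfer (rule lie_bracket_self)
  show "fl_bracket u (fl_bracket v w) + fl_bracket v (fl_bracket w u)
      + fl_bracket w (fl_bracket u v) = 0"
    by transfer (rule lie_jacobi)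
qed

lemma is_lie_rep_abs_free_rep: "is_lie_rep (abs_free_rep X1 X2 :: ('k::field, _, _) lie_rep)"
proof -
  let ?K = "ring_of_type_algebra :: 'k ring"
  let ?H = "abs_free_rep X1 X2 :: ('k, _, _) lie_rep"
  note K = ring_of_type_algebra_def and H = abs_free_rep_def
  have s: "fm_scale c v \<in> free_mod_on X1 X2" if "v \<in> free_mod_on X1 X2" for c and v :: "'k free_mod"
    using that by (simp add: fm_scale_def free_mod_on_closed free_assoc_on_closed)
  have L: "module ?K (lie_sort ?H)"
  proof (rule moduleI)
    show "abelian_group (lie_sort ?H)"
    proof (rule abelian_groupI)
      fix x assume "x \<in> carrier (lie_sort ?H)"
      then show "\<exists>y\<in>carrier (lie_sort ?H). y \<oplus>\<^bsub>lie_sort ?H\<^esub> x = \<zero>\<^bsub>lie_sort ?H\<^esub>"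
        using lie_on_scale[of x X1 "- 1"] by (intro bexI[of _ "- x"]) (auto simp: H fl_simps)
    qed (auto simp: H lie_on_zero lie_on_add algebra_simps)
  qed (auto simp: H K fl_simps lie_on_scale intro: cring_from_type_algebra[unfolded K])
  have V: "module ?K (vec_sort ?H)"
  proof (rule moduleI)
    show "abelian_group (vec_sort ?H)"
    proof (rule abelian_groupI)
      fix x assume "x \<in> carrier (vec_sort ?H)"
      then show "\<exists>y\<in>carrier (vec_sort ?H). y \<oplus>\<^bsub>vec_sort ?H\<^esub> x = \<zero>\<^bsub>vec_sort ?H\<^esub>"
        using s[of x "- 1"] by (intro bexI[of _ "fm_scale (- 1) x"])
          (auto simp: H fm_scale_def single0_minus_one intro!: poly_mapping_eqI simp: lookup_add)
    qed (auto simp: H free_mod_on_closed algebra_simps)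
  next
    fix c d :: 'k and x assume "x \<in> carrier (vec_sort ?H)"
    have "fm_scale (c * d) x = fm_scale c (fm_scale d x)"
      unfolding fm_scale_def fm_mult_simps(3)[symmetric] by (simp add: mult_single)
    then show "(c \<otimes>\<^bsub>?K\<^esub> d) \<odot>\<^bsub>vec_sort ?H\<^esub> x = c \<odot>\<^bsub>vec_sort ?H\<^esub> (d \<odot>\<^bsub>vec_sort ?H\<^esub> x)"
      by (simp add: H K)
  qed (use s in \<open>auto simp: H K fm_scale_def fm_mult_simps single_add
    intro: cring_from_type_algebra[unfolded K]\<close>)
  interpret V: module ?K "vec_sort ?H" by (rule V)
  have minus: "x \<ominus>\<^bsub>vec_sort ?H\<^esub> y = x - y" if "x \<in> free_mod_on X1 X2" "y \<in> free_mod_on X1 X2" for x y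
  proof -
    have "\<ominus>\<^bsub>vec_sort ?H\<^esub> y = fm_scale (- 1) y"
      by (rule V.minus_equality) (use that s[of y "- 1"] in \<open>auto simp: H fm_scale_def single0_minus_one
        intro!: poly_mapping_eqI simp: lookup_add\<close>)
    then show ?thesis
      by (auto simp: a_minus_def H fm_scale_def single0_minus_one intro!: poly_mapping_eqI
        simp: lookup_add lookup_minus)
  qed
  have A: "fm_mult (fl_iota l) v \<in> free_mod_on X1 X2"
    if "l \<in> free_lie_on X1" "v \<in> free_mod_on X1 X2" for l and v :: "'k free_mod"
    using that by (simp add: free_mod_on_closed fl_iota_closed)
  have "is_lie_algebra (lie_sort ?H)"
    using L by (auto simp: is_lie_algebra_def H fl_simps lie_on_bracket)
  moreover have "fm_mult (fl_iota l) (fm_scale c v) = fm_scale c (fm_mult (fl_iota l) v)"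
    "fm_mult (fl_iota (fl_scale c l)) v = fm_scale c (fm_mult (fl_iota l) v)" for c l v
    unfolding fm_scale_def fm_mult_simps(3)[symmetric] fl_iota_simps by (simp_all add: single0_central)
  moreover have sel: "carrier (lie_sort ?H) = free_lie_on X1" "carrier (vec_sort ?H) = free_mod_on X1 X2"
    "add (lie_sort ?H) = (+)" "add (vec_sort ?H) = (+)" "lie_bracket (lie_sort ?H) = fl_bracket"
    "module.smult (lie_sort ?H) = fl_scale" "module.smult (vec_sort ?H) = fm_scale"
    "action ?H = (\<lambda>l v. fm_mult (fl_iota l) v)"
    by (simp_all add: H)
  ultimately show ?thesis
    using V A unfolding is_lie_rep_def Let_def sel
    by (auto simp: minus) (auto simp: fl_iota_simps fm_mult_simps)
qed

lemma UN_class1: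
  assumes "equiv A r" "equiv B s" "a \<in> A" "\<And>x y. (x, y) \<in> r \<Longrightarrow> (f x, f y) \<in> s"
  shows "(\<Union>x \<in> r `` {a}. s `` {f x}) = s `` {f a}"
proof -
  have "s `` {f x} = s `` {f a}" if "x \<in> r `` {a}" for x
    using assms(4)[of a x] that assms(2) by (auto simp: equiv_class_eq_iff)
  moreover have "a \<in> r `` {a}" by (rule equiv_class_self[OF assms(1,3)])
  ultimately show ?thesis by blast
qed

lemma UN_class2:
  assumes "equiv A r" "equiv A' r'" "equiv B s" "a \<in> A" "b \<in> A'"
    "\<And>x y x' y'. (x, y) \<in> r \<Longrightarrow> (x', y') \<in> r' \<Longrightarrow> (f x x', f y y') \<in> s"
  shows "(\<Union>x \<in> r `` {a}. \<Union>y \<in> r' `` {b}. s `` {f x y}) = s `` {f a b}"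
proof -
  have "s `` {f x y} = s `` {f a b}" if "x \<in> r `` {a}" "y \<in> r' `` {b}" for x y
    using assms(6)[of a x b y] that assms(3) by (auto simp: equiv_class_eq_iff)
  moreover have "a \<in> r `` {a}" by (rule equiv_class_self[OF assms(1,4)])
  moreover have "b \<in> r' `` {b}" by (rule equiv_class_self[OF assms(2,5)])
  ultimately show ?thesis by blast
qed

lemma is_lie_rep_quotient_rep:
  fixes H :: "('k::field, 'l, 'v) lie_rep"
  assumes H: "is_lie_rep H"
    and R: "equiv (carrier (lie_sort H)) R" and S: "equiv (carrier (vec_sort H)) S"
    and Radd: "\<And>a b c d. (a, b) \<in> R \<Longrightarrow> (c, d) \<in> R \<Longrightarrow> (a \<oplus>\<^bsub>lie_sort H\<^esub> c, b \<oplus>\<^bsub>lie_sort H\<^esub> d) \<in> R"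
    and Rsc: "\<And>a b k. (a, b) \<in> R \<Longrightarrow> (k \<odot>\<^bsub>lie_sort H\<^esub> a, k \<odot>\<^bsub>lie_sort H\<^esub> b) \<in> R"
    and Rbr: "\<And>a b c d. (a, b) \<in> R \<Longrightarrow> (c, d) \<in> R \<Longrightarrow>
      (lie_bracket (lie_sort H) a c, lie_bracket (lie_sort H) b d) \<in> R"
    and Sadd: "\<And>a b c d. (a, b) \<in> S \<Longrightarrow> (c, d) \<in> S \<Longrightarrow> (a \<oplus>\<^bsub>vec_sort H\<^esub> c, b \<oplus>\<^bsub>vec_sort H\<^esub> d) \<in> S"
    and Ssc: "\<And>a b k. (a, b) \<in> S \<Longrightarrow> (k \<odot>\<^bsub>vec_sort H\<^esub> a, k \<odot>\<^bsub>vec_sort H\<^esub> b) \<in> S"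
    and RS: "\<And>a b c d. (a, b) \<in> R \<Longrightarrow> (c, d) \<in> S \<Longrightarrow> (action H a c, action H b d) \<in> S"
  shows "is_lie_rep (quotient_rep H R S)"
proof -
  let ?K = "ring_of_type_algebra :: 'k ring"
  let ?L = "lie_sort H" and ?V = "vec_sort H"
  let ?Q = "quotient_rep H R S"
  let ?L' = "lie_sort ?Q" and ?V' = "vec_sort ?Q"
  have lie: "is_lie_algebra ?L" and V: "module ?K ?V" using H by (auto simp: is_lie_rep_def Let_def)
  then have L: "module ?K ?L" by (simp add: is_lie_algebra_def)
  interpret L: module ?K ?L by (rule L)
  interpret V: module ?K ?V by (rule V)
  have K: "carrier ?K = UNIV" by (simp add: ring_of_type_algebra_def)
  define q where "q a = R `` {a}" for a
  define p where "p a = S `` {a}" for a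
  have cL: "carrier ?L' = q ` carrier ?L" and cV: "carrier ?V' = p ` carrier ?V"
    by (auto simp: quotient_rep_def Let_def quotient_def q_def p_def)
  have z: "\<zero>\<^bsub>?L'\<^esub> = q \<zero>\<^bsub>?L\<^esub>" "\<zero>\<^bsub>?V'\<^esub> = p \<zero>\<^bsub>?V\<^esub>"
    by (auto simp: quotient_rep_def Let_def q_def p_def)
  have opsL: "q a \<oplus>\<^bsub>?L'\<^esub> q b = q (a \<oplus>\<^bsub>?L\<^esub> b)" "k \<odot>\<^bsub>?L'\<^esub> q a = q (k \<odot>\<^bsub>?L\<^esub> a)"
    "lie_bracket ?L' (q a) (q b) = q (lie_bracket ?L a b)"
    if "a \<in> carrier ?L" "b \<in> carrier ?L" for a b k
    unfolding quotient_rep_def Let_def q_def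
    using UN_class2[OF R R R that Radd] UN_class2[OF R R R that Rbr] UN_class1[OF R R that(1) Rsc[of _ _ k]]
    by simp_all
  have opsV: "p a \<oplus>\<^bsub>?V'\<^esub> p b = p (a \<oplus>\<^bsub>?V\<^esub> b)" "k \<odot>\<^bsub>?V'\<^esub> p a = p (k \<odot>\<^bsub>?V\<^esub> a)"
    if "a \<in> carrier ?V" "b \<in> carrier ?V" for a b k
    unfolding quotient_rep_def Let_def p_def
    using UN_class2[OF S S S that Sadd] UN_class1[OF S S that(1) Ssc[of _ _ k]]
    by simp_all
  have opA: "action ?Q (q a) (p b) = p (action H a b)" if "a \<in> carrier ?L" "b \<in> carrier ?V" for a b
    unfolding quotient_rep_def Let_def p_def q_def using UN_class2[OF R S S that RS] by simp
  have L': "module ?K ?L'"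
  proof (rule moduleI)
    show "abelian_group ?L'"
    proof (rule abelian_groupI)
      fix x assume "x \<in> carrier ?L'"
      then obtain a where "a \<in> carrier ?L" "x = q a" by (auto simp: cL)
      then show "\<exists>y\<in>carrier ?L'. y \<oplus>\<^bsub>?L'\<^esub> x = \<zero>\<^bsub>?L'\<^esub>"
        by (intro bexI[of _ "q (\<ominus>\<^bsub>?L\<^esub> a)"]) (auto simp: opsL z cL L.l_neg)
    qed (auto simp: cL opsL z L.a_ac)
  qed (auto simp: cL opsL z L.smult_l_distr L.smult_r_distr L.smult_assoc1 K
      intro: cring_from_type_algebra)
  have V': "module ?K ?V'"
  proof (rule moduleI)
    show "abelian_group ?V'"
    proof (rule abelian_groupI)
      fix x assume "x \<in> carrier ?V'"
      then obtain a where "a \<in> carrier ?V" "x = p a" by (auto simp: cV)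
      then show "\<exists>y\<in>carrier ?V'. y \<oplus>\<^bsub>?V'\<^esub> x = \<zero>\<^bsub>?V'\<^esub>"
        by (intro bexI[of _ "p (\<ominus>\<^bsub>?V\<^esub> a)"]) (auto simp: opsV z cV V.l_neg)
    qed (auto simp: cV opsV z V.a_ac)
  qed (auto simp: cV opsV z V.smult_l_distr V.smult_r_distr V.smult_assoc1 K
      intro: cring_from_type_algebra)
  interpret V': module ?K ?V' by (rule V')
  have minus: "p a \<ominus>\<^bsub>?V'\<^esub> p b = p (a \<ominus>\<^bsub>?V\<^esub> b)" if "a \<in> carrier ?V" "b \<in> carrier ?V" for a b
  proof -
    have "\<ominus>\<^bsub>?V'\<^esub> p b = p (\<ominus>\<^bsub>?V\<^esub> b)"
      using that by (intro V'.minus_equality) (auto simp: cV z opsV V.l_neg)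
    then show ?thesis using that by (simp add: a_minus_def opsV)
  qed
  have closedL: "k \<odot>\<^bsub>?L\<^esub> a \<in> carrier ?L" if "a \<in> carrier ?L" for a k using that K by simp
  have closedV: "k \<odot>\<^bsub>?V\<^esub> a \<in> carrier ?V" if "a \<in> carrier ?V" for a k using that K by simp
  have lieL': "is_lie_algebra ?L'"
    using lie L' by (auto simp: is_lie_algebra_def cL opsL z closedL)
  show ?thesis
    using H lieL' V' lie by (auto simp: is_lie_rep_def is_lie_algebra_def Let_def cL cV opsL opsV opA
      minus closedL closedV)
qed

lemma is_lie_rep_free_rep:
  fixes \<Theta> :: "('k::field, 'l, 'v) lie_rep set"
  shows "is_lie_rep (free_rep \<Theta> X1 X2)"
  unfolding free_rep_def
proof (rule is_lie_rep_quotient_rep)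
  let ?H = "abs_free_rep X1 X2 :: ('k, _, _) lie_rep"
  let ?U = "abs_free_rep UNIV UNIV :: ('k, _, _) lie_rep"
  have U: "free_lie_on UNIV = (UNIV :: 'k free_lie set)" "free_mod_on UNIV UNIV = (UNIV :: 'k free_mod set)"
  proof -
    have "u \<in> free_lie_on UNIV" for u :: "'k free_lie"
    proof (induction u)
      case (1 t)
      show ?case
      proof (induction t)
        case (LGen x)
        have "abs_free_lie (LGen x) = (fl_gen x :: 'k free_lie)" by (simp add: fl_gen_def)
        then show ?case by (simp add: lie_on_gen)
      next
        case LZero
        have "abs_free_lie LZero = (0 :: 'k free_lie)" by (simp add: zero_free_lie_def)
        then show ?case by (simp add: lie_on_zero)
      qed (simp_all flip: plus_free_lie.abs_eq fl_scale.abs_eq fl_bracket.abs_eq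
            add: lie_on_add lie_on_scale lie_on_bracket)
    qed
    then show "free_lie_on UNIV = (UNIV :: 'k free_lie set)" by auto
    show "free_mod_on UNIV UNIV = (UNIV :: 'k free_mod set)"
      by (auto simp: free_mod_on_def free_assoc_on_def)
  qed
  have hom: "f (u + w) = f u \<oplus>\<^bsub>lie_sort H\<^esub> f w" "f (fl_scale c u) = c \<odot>\<^bsub>lie_sort H\<^esub> f u"
    "f (fl_bracket u w) = lie_bracket (lie_sort H) (f u) (f w)"
    "g (x + y) = g x \<oplus>\<^bsub>vec_sort H\<^esub> g y" "g (fm_scale c x) = c \<odot>\<^bsub>vec_sort H\<^esub> g x"
    "g (fm_mult (fl_iota u) x) = action H (f u) (g x)"
    if "(f, g) \<in> rep_hom ?U H" for f g u w c x y and H :: "('k, 'l, 'v) lie_rep"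
    using that by (auto simp: rep_hom_def linear_maps_def abs_free_rep_def U)
  have sc: "fm_scale c v \<in> free_mod_on X1 X2" if "v \<in> free_mod_on X1 X2" for c and v :: "'k free_mod"
    using that by (simp add: fm_scale_def free_mod_on_closed free_assoc_on_closed)
  have sel: "carrier (lie_sort ?H) = free_lie_on X1" "carrier (vec_sort ?H) = free_mod_on X1 X2"
    "add (lie_sort ?H) = (+)" "add (vec_sort ?H) = (+)" "lie_bracket (lie_sort ?H) = fl_bracket"
    "module.smult (lie_sort ?H) = fl_scale" "module.smult (vec_sort ?H) = fm_scale"
    "action ?H = (\<lambda>l v. fm_mult (fl_iota l) v)"
    by (simp_all add: abs_free_rep_def)
  have l: "(u, w) \<in> Id_lie \<Theta> X1 \<longleftrightarrow> u \<in> free_lie_on X1 \<and> w \<in> free_lie_on X1 \<and>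
      (\<forall>H f g. H \<in> \<Theta> \<longrightarrow> (f, g) \<in> rep_hom ?U H \<longrightarrow> f u = f w)" for u w
    by (auto simp: Id_lie_def sat_lie_def)
  have v: "(u, w) \<in> Id_vec \<Theta> X1 X2 \<longleftrightarrow> u \<in> free_mod_on X1 X2 \<and> w \<in> free_mod_on X1 X2 \<and>
      (\<forall>H f g. H \<in> \<Theta> \<longrightarrow> (f, g) \<in> rep_hom ?U H \<longrightarrow> g u = g w)" for u w
    by (auto simp: Id_vec_def sat_vec_def)
  show "is_lie_rep ?H" by (rule is_lie_rep_abs_free_rep)
  show "equiv (carrier (lie_sort ?H)) (Id_lie \<Theta> X1)" unfolding sel
  proof (rule equivI)
    show "Id_lie \<Theta> X1 \<subseteq> free_lie_on X1 \<times> free_lie_on X1" by (auto simp: Id_lie_def)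
    show "refl_on (free_lie_on X1) (Id_lie \<Theta> X1)" by (auto simp: refl_on_def l)
    show "Relation.sym (Id_lie \<Theta> X1)" by (rule symI, unfold l) metis
    show "Relation.trans (Id_lie \<Theta> X1)" by (rule transI, unfold l) metis
  qed
  show "equiv (carrier (vec_sort ?H)) (Id_vec \<Theta> X1 X2)" unfolding sel
  proof (rule equivI)
    show "Id_vec \<Theta> X1 X2 \<subseteq> free_mod_on X1 X2 \<times> free_mod_on X1 X2" by (auto simp: Id_vec_def)
    show "refl_on (free_mod_on X1 X2) (Id_vec \<Theta> X1 X2)" by (auto simp: refl_on_def v)
    show "Relation.sym (Id_vec \<Theta> X1 X2)" by (rule symI, unfold v) metis
    show "Relation.trans (Id_vec \<Theta> X1 X2)" by (rule transI, unfold v) metis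
  qed
  show "(a \<oplus>\<^bsub>lie_sort ?H\<^esub> c, b \<oplus>\<^bsub>lie_sort ?H\<^esub> d) \<in> Id_lie \<Theta> X1"
    if "(a, b) \<in> Id_lie \<Theta> X1" "(c, d) \<in> Id_lie \<Theta> X1" for a b c d
    using that by (auto simp: sel l hom lie_on_add) metis+
  show "(k \<odot>\<^bsub>lie_sort ?H\<^esub> a, k \<odot>\<^bsub>lie_sort ?H\<^esub> b) \<in> Id_lie \<Theta> X1"
    if "(a, b) \<in> Id_lie \<Theta> X1" for a b k
    using that by (auto simp: sel l hom lie_on_scale) metis+
  show "(lie_bracket (lie_sort ?H) a c, lie_bracket (lie_sort ?H) b d) \<in> Id_lie \<Theta> X1"
    if "(a, b) \<in> Id_lie \<Theta> X1" "(c, d) \<in> Id_lie \<Theta> X1" for a b c d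
    using that by (auto simp: sel l hom lie_on_bracket) metis+
  show "(a \<oplus>\<^bsub>vec_sort ?H\<^esub> c, b \<oplus>\<^bsub>vec_sort ?H\<^esub> d) \<in> Id_vec \<Theta> X1 X2"
    if "(a, b) \<in> Id_vec \<Theta> X1 X2" "(c, d) \<in> Id_vec \<Theta> X1 X2" for a b c d
    using that by (auto simp: sel v hom free_mod_on_closed) metis+
  show "(k \<odot>\<^bsub>vec_sort ?H\<^esub> a, k \<odot>\<^bsub>vec_sort ?H\<^esub> b) \<in> Id_vec \<Theta> X1 X2"
    if "(a, b) \<in> Id_vec \<Theta> X1 X2" for a b k
    using that by (auto simp: sel v hom sc) metis+
  show "(action ?H a c, action ?H b d) \<in> Id_vec \<Theta> X1 X2"
    if "(a, b) \<in> Id_lie \<Theta> X1" "(c, d) \<in> Id_vec \<Theta> X1 X2" for a b c d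
    using that by (auto simp: sel l v hom free_mod_on_closed fl_iota_closed) metis+
qed

theorem inner_automorphisms_Theta0_normal:
  "inner_automorphisms (Theta0 \<Theta>) \<lhd> cat_Aut (Theta0 \<Theta>)"
proof -
  interpret is_category "Theta0 \<Theta>"
    unfolding Theta0_def by (rule rep_category_is_category) (auto intro: is_lie_rep_free_rep)
  show ?thesis by (rule inner_normal)
qed

end

theory Submission
  imports Defs
begin

text \<open>
  Let \<open>\<Phi>\<close> be an automorphism of the category. The objects of rank one in either sort are the nonzero
  objects without zero divisors among their endomorphisms, and the two sorts are told apart because
  \<open>[x\<^sub>0, x\<^sub>1]\<close> is killed by every map to \<open>F(x)\<close>; so \<open>\<Phi>\<close> preserves both kinds. Elements of an object
  \<open>A\<close> are maps from the rank one objects to \<open>A\<close>, whence natural bijections \<open>s\<close> from the sorts of \<open>A\<close> to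
  those of \<open>\<Phi>(A)\<close>. Pulling the operations back along \<open>s\<close> gives operations on the free objects
  given by words, and since scalars go to scalars, these words are homogeneous: eigenvectors of
  the endomorphisms that rescale the generators. So the pulled back addition is the
  addition, the bracket is \<open>\<gamma>[x, y]\<close> and the action is \<open>\<delta>(l \<circ> v)\<close>. Scalars are changed by one
  and the same field automorphism in both sorts, nondegeneracy gives \<open>\<gamma> = \<delta> \<noteq> 0\<close>, and rescaling the
  Lie sort by \<open>\<delta>\<close> turns \<open>s\<close> into a natural family of semilinear isomorphisms. Its field automorphism is
  determined by \<open>\<Phi>\<close>, depends multiplicatively on \<open>\<Phi>\<close>, and is trivial exactly when \<open>\<Phi>\<close> is inner. It
  is arbitrary, because identities over \<open>\<int>\<close> are stable under the action of field automorphisms on coefficients.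
\<close>

section \<open>Substitutions in the absolutely free representation\<close>

text \<open>Two difficulties shape the argument. In the Lie sort an element of an object is, by
  action type, a single element of a free Lie algebra, but in the second sort it is a class modulo
  the unknown subspace \<open>vec_ideal\<close>. Homogeneity there can only be argued modulo this
  subspace, which works because it is stable under all substitutions. Secondly, the maps of scalars
  \<open>\<phi>1\<close> and \<open>\<phi>2\<close> start as mere multiplicative bijections of k,
  and nothing relates them. So the degree of a word is tested on the source side: for sums and
  brackets, the factor that comes out is some value of \<open>\<phi>1\<close>, and going back
  through \<open>s\<close> undoes it without knowing that value. Only for the action do both maps
  occur, and by then additivity has given that both fix 2. The test factors 2 and 3 serve because
  products of their powers are distinct in characteristic 0. The constants \<gamma> and \<delta>
  agree because the pulled back operations again satisfy the law of a Lie action, in which the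
  bracket term carries \<delta>\<gamma> and the two iterated actions carry \<delta>\<delta>.\<close>

primrec lie_eval :: "(nat \<Rightarrow> 'k::field free_lie) \<Rightarrow> 'k lie_term \<Rightarrow> 'k free_lie" where
  "lie_eval \<sigma> (LGen x) = \<sigma> x"
| "lie_eval \<sigma> LZero = 0"
| "lie_eval \<sigma> (LAdd s t) = lie_eval \<sigma> s + lie_eval \<sigma> t"
| "lie_eval \<sigma> (LScale c s) = fl_scale c (lie_eval \<sigma> s)"
| "lie_eval \<sigma> (LBracket s t) = fl_bracket (lie_eval \<sigma> s) (lie_eval \<sigma> t)"

lemma lie_eval_cong: "lie_eq s t \<Longrightarrow> lie_eval \<sigma> s = lie_eval \<sigma> t"
proof (induction rule: lie_eq.induct)
  case (lie_jacobi s t u)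
  show ?case using fl_simps(11) by simp
qed (simp_all add: fl_simps algebra_simps)

lift_definition fl_subst :: "(nat \<Rightarrow> 'k::field free_lie) \<Rightarrow> 'k free_lie \<Rightarrow> 'k free_lie" is lie_eval
  by (rule lie_eval_cong)

lemma fl_subst_simps [simp]:
  "fl_subst \<sigma> (fl_gen x) = \<sigma> x"
  "fl_subst \<sigma> 0 = 0"
  "fl_subst \<sigma> (u + w) = fl_subst \<sigma> u + fl_subst \<sigma> w"
  "fl_subst \<sigma> (fl_scale c u) = fl_scale c (fl_subst \<sigma> u)"
  "fl_subst \<sigma> (fl_bracket u w) = fl_bracket (fl_subst \<sigma> u) (fl_subst \<sigma> w)"
proof -
  show "fl_subst \<sigma> (fl_gen x) = \<sigma> x" by transfer simp
  show "fl_subst \<sigma> 0 = 0" by transfer simp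
  show "fl_subst \<sigma> (u + w) = fl_subst \<sigma> u + fl_subst \<sigma> w" by transfer simp
  show "fl_subst \<sigma> (fl_scale c u) = fl_scale c (fl_subst \<sigma> u)" by transfer simp
  show "fl_subst \<sigma> (fl_bracket u w) = fl_bracket (fl_subst \<sigma> u) (fl_subst \<sigma> w)" by transfer simp
qed

lemma free_lie_induct [case_names gen zero add scale bracket]:
  assumes "\<And>x. P (fl_gen x)" "P 0" "\<And>u w. P u \<Longrightarrow> P w \<Longrightarrow> P (u + w)"
    "\<And>c u. P u \<Longrightarrow> P (fl_scale c u)" "\<And>u w. P u \<Longrightarrow> P w \<Longrightarrow> P (fl_bracket u w)"
  shows "P u"
proof (induction u)
  case (1 t)
  show ?case
    by (induction t) (use assms in \<open>simp_all flip: fl_gen.abs_eq zero_free_lie.abs_eq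
      plus_free_lie.abs_eq fl_scale.abs_eq fl_bracket.abs_eq\<close>)
qed

lemma free_lie_on_UNIV [simp]: "free_lie_on UNIV = UNIV"
proof -
  have "u \<in> free_lie_on UNIV" for u :: "'a free_lie"
    by (induction u rule: free_lie_induct) (auto intro: free_lie_on.intros)
  then show ?thesis by auto
qed

lemma free_mod_on_UNIV [simp]: "free_mod_on UNIV UNIV = UNIV"
  by (auto simp: free_mod_on_def free_assoc_on_def)

lemma free_lie_on_uminus: "u \<in> free_lie_on X1 \<Longrightarrow> - u \<in> free_lie_on X1"
  using lie_on_scale[of u X1 "-1"] by (simp add: fl_simps)

lemma free_lie_on_diff: "u \<in> free_lie_on X1 \<Longrightarrow> w \<in> free_lie_on X1 \<Longrightarrow> u - w \<in> free_lie_on X1"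
  unfolding minus_free_lie_def by (intro lie_on_add free_lie_on_uminus)

lemma fl_subst_closed:
  assumes "u \<in> free_lie_on X1" and "\<And>x. x \<in> X1 \<Longrightarrow> \<sigma> x \<in> free_lie_on Y1"
  shows "fl_subst \<sigma> u \<in> free_lie_on Y1"
  using assms(1) by induction (auto intro: free_lie_on.intros assms(2))

interpretation fl: vector_space fl_scale
  by unfold_locales (simp_all add: fl_simps)

text \<open>The algebra endomorphism that sends the variable \<open>x\<close> to
  \<open>\<rho> x\<close>, evaluated word by word. Coefficients may stand on the left because
  scalars are central.\<close>

definition fa_subst :: "(nat \<Rightarrow> 'k::field free_assoc) \<Rightarrow> 'k free_assoc \<Rightarrow> 'k free_assoc" where
  "fa_subst \<rho> a = (\<Sum>w\<in>Poly_Mapping.keys a.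
     Poly_Mapping.single 0 (Poly_Mapping.lookup a w) * prod_list (map \<rho> w))"

text \<open>Gives two polynomials and their sum a common index set, since terms may cancel in the
  sum.\<close>

lemma fa_subst_superset:
  assumes "finite S" "Poly_Mapping.keys a \<subseteq> S"
  shows "fa_subst \<rho> a = (\<Sum>w\<in>S. Poly_Mapping.single 0 (Poly_Mapping.lookup a w) * prod_list (map \<rho> w))"
  unfolding fa_subst_def using assms
  by (intro sum.mono_neutral_left) (auto simp: in_keys_iff)

lemma fa_subst_0 [simp]: "fa_subst \<rho> 0 = 0"
  by (simp add: fa_subst_def)

lemma fa_subst_single: "fa_subst \<rho> (Poly_Mapping.single w c) = Poly_Mapping.single 0 c * prod_list (map \<rho> w)"
  by (subst fa_subst_superset[of "{w}"]) auto

lemma fa_subst_add: "fa_subst \<rho> (a + b) = fa_subst \<rho> a + fa_subst \<rho> b"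
proof -
  let ?S = "Poly_Mapping.keys a \<union> Poly_Mapping.keys b"
  have f: "finite ?S" by simp
  show ?thesis
    unfolding fa_subst_superset[OF f keys_add] fa_subst_superset[OF f Un_upper1]
      fa_subst_superset[OF f Un_upper2]
    by (simp add: lookup_add single_add distrib_right sum.distrib)
qed

lemma single0_mult: "Poly_Mapping.single 0 (c * d) = (Poly_Mapping.single 0 c * Poly_Mapping.single 0 d :: 'k::field free_assoc)"
  by (simp add: mult_single)

text \<open>By bilinearity only products of two words matter; there the scalar of the second word is
  moved past the image of the first by centrality.\<close>

lemma fa_subst_mult: "fa_subst \<rho> (a * b) = fa_subst \<rho> a * fa_subst \<rho> b"
proof (induction a rule: pm_induct)
  case (add w c a)
  have "fa_subst \<rho> (Poly_Mapping.single w c * b) = fa_subst \<rho> (Poly_Mapping.single w c) * fa_subst \<rho> b"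
  proof (induction b rule: pm_induct)
    case (add w' c' b)
    let ?P = "prod_list (map \<rho> w)" and ?Q = "prod_list (map \<rho> w')"
    have "fa_subst \<rho> (Poly_Mapping.single (w + w') (c * c'))
        = Poly_Mapping.single 0 c * (Poly_Mapping.single 0 c' * ?P) * ?Q"
      by (simp only: fa_subst_single plus_list_def map_append prod_list.append single0_mult mult.assoc)
    also have "Poly_Mapping.single 0 c' * ?P = ?P * Poly_Mapping.single 0 c'"
      by (rule single0_central[symmetric])
    finally have "fa_subst \<rho> (Poly_Mapping.single (w + w') (c * c'))
        = fa_subst \<rho> (Poly_Mapping.single w c) * fa_subst \<rho> (Poly_Mapping.single w' c')"
      by (simp only: fa_subst_single mult.assoc)
    then show ?case using add by (simp only: distrib_left fa_subst_add mult_single)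
  qed simp
  then show ?case using add by (simp only: distrib_right fa_subst_add)
qed simp

lemma fa_subst_minus: "fa_subst \<rho> (a - b) = fa_subst \<rho> a - fa_subst \<rho> b"
  using fa_subst_add[of \<rho> "a - b" b] by (simp add: algebra_simps)

lemma fa_subst_gen [simp]: "fa_subst \<rho> (fa_gen x) = \<rho> x"
  by (simp add: fa_gen_def fa_subst_single)

lemma fa_subst_scalar [simp]: "fa_subst \<rho> (Poly_Mapping.single 0 c) = Poly_Mapping.single 0 c"
  by (simp add: fa_subst_single zero_list_def)

lemma fl_iota_subst: "fl_iota (fl_subst \<sigma> u) = fa_subst (\<lambda>x. fl_iota (\<sigma> x)) (fl_iota u)"
  by (induction u rule: free_lie_induct)
    (simp_all add: fl_iota_simps fa_subst_add fa_subst_mult fa_subst_minus)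

text \<open>The second component of the endomorphism of the free representation given by
  \<open>\<sigma>\<close> in sort 1 and \<open>\<tau>\<close> in sort 2. Coefficients are mapped by
  the algebra endomorphism that extends \<open>\<sigma>\<close> along \<iota>;
  \<open>fl_iota_subst\<close> makes this compatible with the action.\<close>

definition fm_subst ::
    "(nat \<Rightarrow> 'k::field free_lie) \<Rightarrow> (nat \<Rightarrow> 'k free_mod) \<Rightarrow> 'k free_mod \<Rightarrow> 'k free_mod" where
  "fm_subst \<sigma> \<tau> v = (\<Sum>y\<in>Poly_Mapping.keys v.
     fm_mult (fa_subst (\<lambda>x. fl_iota (\<sigma> x)) (Poly_Mapping.lookup v y)) (\<tau> y))"

lemma fm_mult_0_left [simp]: "fm_mult 0 v = 0"
  by (auto intro: poly_mapping_eqI)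

lemma fm_mult_0_right [simp]: "fm_mult a 0 = 0"
  by (auto intro: poly_mapping_eqI)

lemma fm_mult_single: "fm_mult a (Poly_Mapping.single y b) = Poly_Mapping.single y (a * b)"
  by (auto intro!: poly_mapping_eqI simp: lookup_single when_def)

lemma fm_subst_superset:
  assumes "finite S" "Poly_Mapping.keys v \<subseteq> S"
  shows "fm_subst \<sigma> \<tau> v =
    (\<Sum>y\<in>S. fm_mult (fa_subst (\<lambda>x. fl_iota (\<sigma> x)) (Poly_Mapping.lookup v y)) (\<tau> y))"
  unfolding fm_subst_def using assms
  by (intro sum.mono_neutral_left) (auto simp: in_keys_iff)

lemma fm_subst_0 [simp]: "fm_subst \<sigma> \<tau> 0 = 0"
  by (simp add: fm_subst_def)

lemma fm_subst_single:
  "fm_subst \<sigma> \<tau> (Poly_Mapping.single y a) = fm_mult (fa_subst (\<lambda>x. fl_iota (\<sigma> x)) a) (\<tau> y)"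
  by (subst fm_subst_superset[of "{y}"]) auto

lemma fm_subst_gen [simp]: "fm_subst \<sigma> \<tau> (fm_gen y) = \<tau> y"
proof -
  have "fa_subst \<rho> 1 = 1" for \<rho> :: "nat \<Rightarrow> 'a free_assoc"
    using fa_subst_scalar[of \<rho> 1] by (simp only: single_one)
  then show ?thesis by (simp add: fm_gen_def fm_subst_single fm_mult_simps)
qed

lemma fm_subst_add [simp]: "fm_subst \<sigma> \<tau> (v + w) = fm_subst \<sigma> \<tau> v + fm_subst \<sigma> \<tau> w"
proof -
  let ?S = "Poly_Mapping.keys v \<union> Poly_Mapping.keys w"
  have f: "finite ?S" by simp
  show ?thesis
    unfolding fm_subst_superset[OF f keys_add] fm_subst_superset[OF f Un_upper1]
      fm_subst_superset[OF f Un_upper2]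
    by (simp add: lookup_add fa_subst_add fm_mult_simps sum.distrib)
qed

lemma fm_subst_mult: "fm_subst \<sigma> \<tau> (fm_mult a v) = fm_mult (fa_subst (\<lambda>x. fl_iota (\<sigma> x)) a) (fm_subst \<sigma> \<tau> v)"
proof (induction v rule: pm_induct)
  case (add y b v)
  then show ?case
    by (simp add: fm_mult_single fm_subst_single fa_subst_mult fm_mult_simps)
qed simp

lemma fm_subst_action [simp]:
  "fm_subst \<sigma> \<tau> (fm_mult (fl_iota u) v) = fm_mult (fl_iota (fl_subst \<sigma> u)) (fm_subst \<sigma> \<tau> v)"
  by (simp add: fm_subst_mult fl_iota_subst)

lemma fm_subst_scale [simp]: "fm_subst \<sigma> \<tau> (fm_scale c v) = fm_scale c (fm_subst \<sigma> \<tau> v)"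
  by (simp add: fm_scale_def fm_subst_mult)

section \<open>Scalars, closure properties and induction in the free modules\<close>

lemma fm_scale_simps:
  "fm_scale c (v + w) = fm_scale c v + fm_scale c w"
  "fm_scale (c + d) v = fm_scale c v + fm_scale d v"
  "fm_scale c (fm_scale d v) = fm_scale (c * d) v"
  "fm_scale 1 v = v"
  unfolding fm_scale_def by (simp_all add: fm_mult_simps single_add mult_single flip: fm_mult_simps(3))

interpretation fm: vector_space fm_scale
  by unfold_locales (simp_all add: fm_scale_simps)

lemma fm_mult_scale: "fm_mult a (fm_scale c v) = fm_scale c (fm_mult a v)"
  unfolding fm_scale_def by (simp add: single0_central flip: fm_mult_simps(3))

lemma fm_mult_iota_scale: "fm_mult (fl_iota (fl_scale c u)) v = fm_scale c (fm_mult (fl_iota u) v)"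
  unfolding fm_scale_def by (simp add: fl_iota_simps fm_mult_simps)

lemma free_mod_on_scale: "v \<in> free_mod_on X1 X2 \<Longrightarrow> fm_scale c v \<in> free_mod_on X1 X2"
  by (simp add: fm_scale_def free_mod_on_closed free_assoc_on_closed)

lemma free_mod_on_diff: "v \<in> free_mod_on X1 X2 \<Longrightarrow> w \<in> free_mod_on X1 X2 \<Longrightarrow> v - w \<in> free_mod_on X1 X2"
  using free_mod_on_closed(2)[OF _ free_mod_on_scale[of w X1 X2 "-1"], of v]
  by (simp add: fm.scale_minus_left)

lemma free_mod_on_gen: "y \<in> X2 \<Longrightarrow> fm_gen y \<in> free_mod_on X1 X2"
  using free_assoc_on_closed(5)[of 1 X1] free_assoc_on_closed(1)[of X1]
  by (auto simp: fm_gen_def free_mod_on_def lookup_single when_def)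

lemma free_mod_on_action:
  "u \<in> free_lie_on X1 \<Longrightarrow> v \<in> free_mod_on X1 X2 \<Longrightarrow> fm_mult (fl_iota u) v \<in> free_mod_on X1 X2"
  by (intro free_mod_on_closed fl_iota_closed)

text \<open>Every element is a sum of scalar multiples of words applied to generators, and a word
  acts letter by letter. So the last case is stated for single variables, which lie in the image of
  \<iota>, unlike a general associative polynomial.\<close>

lemma free_mod_on_induct [consumes 1, case_names gen zero add scale action]:
  fixes v :: "'k::field free_mod"
  assumes v: "v \<in> free_mod_on X1 X2" and gen: "\<And>y. y \<in> X2 \<Longrightarrow> P (fm_gen y)" and zero: "P 0"
    and add: "\<And>v w. v \<in> free_mod_on X1 X2 \<Longrightarrow> w \<in> free_mod_on X1 X2 \<Longrightarrow> P v \<Longrightarrow> P w \<Longrightarrow> P (v + w)"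
    and scale: "\<And>c v. v \<in> free_mod_on X1 X2 \<Longrightarrow> P v \<Longrightarrow> P (fm_scale c v)"
    and action: "\<And>x v. x \<in> X1 \<Longrightarrow> v \<in> free_mod_on X1 X2 \<Longrightarrow> P v \<Longrightarrow> P (fm_mult (fa_gen x) v)"
  shows "P v"
proof -
  have word: "(Poly_Mapping.single y (Poly_Mapping.single w 1) :: 'k free_mod) \<in> free_mod_on X1 X2
      \<and> P (Poly_Mapping.single y (Poly_Mapping.single w 1))" if "set w \<subseteq> X1" "y \<in> X2" for w y
    using that(1)
  proof (induction w)
    case Nil
    have "Poly_Mapping.single y (Poly_Mapping.single [] 1) = (fm_gen y :: 'k free_mod)"
      by (simp add: fm_gen_def flip: zero_list_def)
    then show ?case using gen[OF that(2)] free_mod_on_gen[OF that(2)] by simp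
  next
    case (Cons x w)
    have "(Poly_Mapping.single y (Poly_Mapping.single (x # w) 1) :: 'k free_mod)
        = fm_mult (fa_gen x) (Poly_Mapping.single y (Poly_Mapping.single w 1))"
      by (simp add: fm_mult_single fa_gen_def mult_single plus_list_def)
    moreover have "fa_gen x \<in> free_assoc_on X1" using Cons by (intro free_assoc_on_closed) auto
    ultimately show ?case using Cons action by (auto intro: free_mod_on_closed)
  qed
  have mono: "Poly_Mapping.single y (Poly_Mapping.single w c) \<in> free_mod_on X1 X2
      \<and> P (Poly_Mapping.single y (Poly_Mapping.single w c))" if "set w \<subseteq> X1" "y \<in> X2" for w y c
  proof -
    have "Poly_Mapping.single y (Poly_Mapping.single w c)
        = fm_scale c (Poly_Mapping.single y (Poly_Mapping.single w 1))"
      by (simp add: fm_scale_def fm_mult_single mult_single)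
    then show ?thesis using word[OF that] scale free_mod_on_scale by auto
  qed
  have part: "(\<Sum>w\<in>S. Poly_Mapping.single y (Poly_Mapping.single w (c w))) \<in> free_mod_on X1 X2
      \<and> P (\<Sum>w\<in>S. Poly_Mapping.single y (Poly_Mapping.single w (c w)))"
    if "finite S" "\<And>w. w \<in> S \<Longrightarrow> set w \<subseteq> X1" "y \<in> X2" for S y c
    using that(1,2)
  proof (induction S)
    case (insert w S)
    then show ?case using mono[of w y "c w"] that(3) add[OF conjunct1 conjunct1] by (simp add: free_mod_on_closed add)
  qed (simp add: zero free_mod_on_closed)
  have decomp: "a = (\<Sum>w\<in>Poly_Mapping.keys a. Poly_Mapping.single w (Poly_Mapping.lookup a w))"
    for a :: "'x \<Rightarrow>\<^sub>0 'y::comm_monoid_add"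
  proof (rule poly_mapping_eqI)
    fix k
    have "(\<Sum>w\<in>Poly_Mapping.keys a. Poly_Mapping.lookup a w when w = k) = Poly_Mapping.lookup a k"
      by (auto simp: when_def sum.delta in_keys_iff)
    then show "Poly_Mapping.lookup a k = Poly_Mapping.lookup (\<Sum>w\<in>Poly_Mapping.keys a.
        Poly_Mapping.single w (Poly_Mapping.lookup a w)) k"
      by (simp add: lookup_sum lookup_single)
  qed
  have sum_single: "Poly_Mapping.single y (sum f S) = (\<Sum>w\<in>S. Poly_Mapping.single y (f w))"
    for f :: "'z \<Rightarrow> 'k free_assoc" and S and y :: nat
    by (induction S rule: infinite_finite_induct) (simp_all add: single_add)
  have coeff: "Poly_Mapping.single y (Poly_Mapping.lookup v y) \<in> free_mod_on X1 X2
      \<and> P (Poly_Mapping.single y (Poly_Mapping.lookup v y))" if "y \<in> Poly_Mapping.keys v" for y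
  proof -
    let ?a = "Poly_Mapping.lookup v y"
    have "y \<in> X2" "set w \<subseteq> X1" if "w \<in> Poly_Mapping.keys ?a" for w
      using v \<open>y \<in> Poly_Mapping.keys v\<close> that unfolding free_mod_on_def free_assoc_on_def by blast+
    moreover have "y \<in> X2" using v that unfolding free_mod_on_def by blast
    moreover have "Poly_Mapping.single y ?a = (\<Sum>w\<in>Poly_Mapping.keys ?a.
        Poly_Mapping.single y (Poly_Mapping.single w (Poly_Mapping.lookup ?a w)))"
      by (subst (1) decomp) (rule sum_single)
    ultimately show ?thesis using part[of "Poly_Mapping.keys ?a" y "Poly_Mapping.lookup ?a"] by simp
  qed
  have "(\<Sum>y\<in>S. Poly_Mapping.single y (Poly_Mapping.lookup v y)) \<in> free_mod_on X1 X2
      \<and> P (\<Sum>y\<in>S. Poly_Mapping.single y (Poly_Mapping.lookup v y))"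
    if "finite S" "S \<subseteq> Poly_Mapping.keys v" for S
    using that
  proof (induction S)
    case (insert w S)
    then show ?case using coeff[of w] add by (simp add: free_mod_on_closed)
  qed (simp add: zero free_mod_on_closed)
  from this[OF finite_keys subset_refl] show ?thesis unfolding decomp[of v, symmetric] by simp
qed

lemma fm_subst_closed:
  assumes "v \<in> free_mod_on X1 X2" and "\<And>x. x \<in> X1 \<Longrightarrow> \<sigma> x \<in> free_lie_on Y1"
    and "\<And>y. y \<in> X2 \<Longrightarrow> \<tau> y \<in> free_mod_on Y1 Y2"
  shows "fm_subst \<sigma> \<tau> v \<in> free_mod_on Y1 Y2"
  using assms(1)
proof (induction rule: free_mod_on_induct)
  case (action x v)
  then show ?case using assms(2) by (simp add: fm_subst_mult free_mod_on_action)
qed (use assms in \<open>simp_all add: free_mod_on_closed free_mod_on_scale\<close>)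

text \<open>The reason why identities are closed under substitution: an assignment precomposed with
  a substitution is again an assignment.\<close>

lemma subst_hom_comp:
  assumes "(f, g) \<in> rep_hom (abs_free_rep UNIV UNIV) H"
  shows "(f \<circ> fl_subst \<sigma>, g \<circ> fm_subst \<sigma> \<tau>) \<in> rep_hom (abs_free_rep UNIV UNIV) H"
  using assms by (auto simp: rep_hom_def linear_maps_def abs_free_rep_def)

section \<open>The free representations of a variety of action type\<close>

abbreviation "lie_car H \<equiv> carrier (lie_sort H)"
abbreviation "vec_car H \<equiv> carrier (vec_sort H)"

lemma abs_hom_simps:
  assumes "(f, g) \<in> rep_hom (abs_free_rep UNIV UNIV) H"
  shows "f (u + w) = f u \<oplus>\<^bsub>lie_sort H\<^esub> f w" "f (fl_scale c u) = c \<odot>\<^bsub>lie_sort H\<^esub> f u"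
    "f (fl_bracket u w) = lie_bracket (lie_sort H) (f u) (f w)"
    "g (x + y) = g x \<oplus>\<^bsub>vec_sort H\<^esub> g y" "g (fm_scale c x) = c \<odot>\<^bsub>vec_sort H\<^esub> g x"
    "g (fm_mult (fl_iota u) x) = action H (f u) (g x)"
  using assms by (auto simp: rep_hom_def linear_maps_def abs_free_rep_def)

lemma hom_simps:
  assumes "h \<in> rep_hom H1 H2"
  shows "x \<in> lie_car H1 \<Longrightarrow> fst h x \<in> lie_car H2"
    "v \<in> vec_car H1 \<Longrightarrow> snd h v \<in> vec_car H2"
    "x \<in> lie_car H1 \<Longrightarrow> y \<in> lie_car H1 \<Longrightarrow>
      fst h (x \<oplus>\<^bsub>lie_sort H1\<^esub> y) = fst h x \<oplus>\<^bsub>lie_sort H2\<^esub> fst h y"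
    "x \<in> lie_car H1 \<Longrightarrow> fst h (c \<odot>\<^bsub>lie_sort H1\<^esub> x) = c \<odot>\<^bsub>lie_sort H2\<^esub> fst h x"
    "x \<in> lie_car H1 \<Longrightarrow> y \<in> lie_car H1 \<Longrightarrow>
      fst h (lie_bracket (lie_sort H1) x y) = lie_bracket (lie_sort H2) (fst h x) (fst h y)"
    "v \<in> vec_car H1 \<Longrightarrow> w \<in> vec_car H1 \<Longrightarrow>
      snd h (v \<oplus>\<^bsub>vec_sort H1\<^esub> w) = snd h v \<oplus>\<^bsub>vec_sort H2\<^esub> snd h w"
    "v \<in> vec_car H1 \<Longrightarrow> snd h (c \<odot>\<^bsub>vec_sort H1\<^esub> v) = c \<odot>\<^bsub>vec_sort H2\<^esub> snd h v"
    "x \<in> lie_car H1 \<Longrightarrow> v \<in> vec_car H1 \<Longrightarrow>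
      snd h (action H1 x v) = action H2 (fst h x) (snd h v)"
  using assms by (auto simp: rep_hom_def linear_maps_def)

lemma hom_ext:
  assumes "h \<in> rep_hom H1 H2" "h' \<in> rep_hom H1 H2"
    and "\<And>x. x \<in> lie_car H1 \<Longrightarrow> fst h x = fst h' x"
    and "\<And>v. v \<in> vec_car H1 \<Longrightarrow> snd h v = snd h' v"
  shows "h = h'"
proof (rule prod_eqI)
  show "fst h = fst h'"
    by (rule extensionalityI[where A = "lie_car H1"])
      (use assms in \<open>auto simp: rep_hom_def linear_maps_def PiE_def\<close>)
  show "snd h = snd h'"
    by (rule extensionalityI[where A = "vec_car H1"])
      (use assms in \<open>auto simp: rep_hom_def linear_maps_def PiE_def\<close>)
qed

locale action_variety =
  fixes \<Theta> :: "('k::field_char_0, 'l, 'v) lie_rep set"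
  assumes action_type: "action_type \<Theta>" and nondegenerate: "\<not> degenerated \<Theta>"
begin

definition vec_ideal :: "'k free_mod set" where
  "vec_ideal = {v. \<forall>H\<in>\<Theta>. sat_vec H v 0}"

abbreviation obj where "obj X1 X2 \<equiv> free_rep \<Theta> X1 X2"

definition vcls :: "nat set \<Rightarrow> nat set \<Rightarrow> 'k free_mod \<Rightarrow> 'k free_mod set" where
  "vcls X1 X2 v = Id_vec \<Theta> X1 X2 `` {v}"

lemma vec_idealD:
  assumes "v \<in> vec_ideal" "H \<in> \<Theta>" "(f, g) \<in> rep_hom (abs_free_rep UNIV UNIV) H"
  shows "g v = g 0"
  using assms by (auto simp: vec_ideal_def sat_vec_def)

lemma vec_idealI:
  assumes "\<And>H f g. H \<in> \<Theta> \<Longrightarrow> (f, g) \<in> rep_hom (abs_free_rep UNIV UNIV) H \<Longrightarrow> g v = g 0"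
  shows "v \<in> vec_ideal"
  using assms by (auto simp: vec_ideal_def sat_vec_def)

lemma vec_ideal_0 [simp]: "0 \<in> vec_ideal"
  by (rule vec_idealI) simp

lemma vec_ideal_add: "v \<in> vec_ideal \<Longrightarrow> w \<in> vec_ideal \<Longrightarrow> v + w \<in> vec_ideal"
proof (rule vec_idealI)
  fix H f g assume *: "v \<in> vec_ideal" "w \<in> vec_ideal" "H \<in> \<Theta>" "(f, g) \<in> rep_hom (abs_free_rep UNIV UNIV) H"
  then show "g (v + w) = g 0"
    using abs_hom_simps(4)[OF *(4), of v w] abs_hom_simps(4)[OF *(4), of 0 0] vec_idealD[OF *(1,3,4)] vec_idealD[OF *(2,3,4)] by simp
qed

lemma vec_ideal_scale: "v \<in> vec_ideal \<Longrightarrow> fm_scale c v \<in> vec_ideal"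
proof (rule vec_idealI)
  fix H f g assume *: "v \<in> vec_ideal" "H \<in> \<Theta>" "(f, g) \<in> rep_hom (abs_free_rep UNIV UNIV) H"
  then show "g (fm_scale c v) = g 0"
    using abs_hom_simps(5)[OF *(3), of c v] abs_hom_simps(5)[OF *(3), of c 0] vec_idealD[OF *] by simp
qed

lemma vec_ideal_scale_iff: "c \<noteq> 0 \<Longrightarrow> fm_scale c v \<in> vec_ideal \<longleftrightarrow> v \<in> vec_ideal"
  using vec_ideal_scale[of v c] vec_ideal_scale[of "fm_scale c v" "inverse c"] by auto

lemma vec_ideal_uminus: "v \<in> vec_ideal \<Longrightarrow> - v \<in> vec_ideal"
  using vec_ideal_scale[of v "-1"] by (simp add: fm.scale_minus_left)

lemma vec_ideal_action: "v \<in> vec_ideal \<Longrightarrow> fm_mult (fl_iota u) v \<in> vec_ideal"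
proof (rule vec_idealI)
  fix H f g assume *: "v \<in> vec_ideal" "H \<in> \<Theta>" "(f, g) \<in> rep_hom (abs_free_rep UNIV UNIV) H"
  then show "g (fm_mult (fl_iota u) v) = g 0"
    using abs_hom_simps(6)[OF *(3), of u v] abs_hom_simps(6)[OF *(3), of u 0] vec_idealD[OF *] by simp
qed

lemma vec_ideal_subst: "v \<in> vec_ideal \<Longrightarrow> fm_subst \<sigma> \<tau> v \<in> vec_ideal"
proof (rule vec_idealI)
  fix H f g assume *: "v \<in> vec_ideal" "H \<in> \<Theta>" "(f, g) \<in> rep_hom (abs_free_rep UNIV UNIV) H"
  show "g (fm_subst \<sigma> \<tau> v) = g 0"
    using vec_idealD[OF *(1,2) subst_hom_comp[OF *(3)], of \<sigma> \<tau>] by simp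
qed

lemma Id_vec_iff:
  "(v, w) \<in> Id_vec \<Theta> X1 X2 \<longleftrightarrow> v \<in> free_mod_on X1 X2 \<and> w \<in> free_mod_on X1 X2 \<and> v - w \<in> vec_ideal"
proof -
  have "(\<forall>H\<in>\<Theta>. sat_vec H v w) \<longleftrightarrow> v - w \<in> vec_ideal"
  proof
    assume *: "\<forall>H\<in>\<Theta>. sat_vec H v w"
    show "v - w \<in> vec_ideal"
    proof (rule vec_idealI)
      fix H f g assume H: "H \<in> \<Theta>" "(f, g) \<in> rep_hom (abs_free_rep UNIV UNIV) H"
      then have "g v = g w" using * by (auto simp: sat_vec_def)
      then show "g (v - w) = g 0"
        using abs_hom_simps(4)[OF H(2), of v "- w"] abs_hom_simps(4)[OF H(2), of w "- w"] by simp
    qed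
  next
    assume *: "v - w \<in> vec_ideal"
    have "g v = g w" if H: "H \<in> \<Theta>" "(f, g) \<in> rep_hom (abs_free_rep UNIV UNIV) H" for H f g
      using vec_idealD[OF * H] abs_hom_simps(4)[OF H(2), of "v - w" w] abs_hom_simps(4)[OF H(2), of 0 w]
      by simp
    then show "\<forall>H\<in>\<Theta>. sat_vec H v w" by (auto simp: sat_vec_def)
  qed
  then show ?thesis by (auto simp: Id_vec_def)
qed

text \<open>Action type enters here: an identity between \<open>u\<close> and \<open>w\<close> makes
  \<open>u - w\<close> vanish identically, so it lies in an ideal that is zero. Hence the classes of
  sort 1 are singletons.\<close>

lemma Id_lie_iff:
  assumes "finite X1"
  shows "(u, w) \<in> Id_lie \<Theta> X1 \<longleftrightarrow> u \<in> free_lie_on X1 \<and> u = w"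
proof -
  have "u = w" if *: "u \<in> free_lie_on X1" "w \<in> free_lie_on X1" "\<forall>H\<in>\<Theta>. sat_lie H u w"
  proof -
    have "f (u - w) = f 0" if H: "H \<in> \<Theta>" "(f, g) \<in> rep_hom (abs_free_rep UNIV UNIV) H" for H f g
    proof -
      have "f u = f w" using * H by (auto simp: sat_lie_def)
      then show ?thesis
        using abs_hom_simps(1)[OF H(2), of u "- w"] abs_hom_simps(1)[OF H(2), of w "- w"] by simp
    qed
    then have "u - w \<in> lie_ideal \<Theta> X1"
      using * by (auto simp: lie_ideal_def Id_lie_def sat_lie_def free_lie_on_diff lie_on_zero)
    then show ?thesis using action_type assms by (auto simp: action_type_def)
  qed
  then show ?thesis by (auto simp: Id_lie_def sat_lie_def)
qed

section \<open>The objects of the category in concrete form\<close>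

lemma lie_class: "finite X1 \<Longrightarrow> u \<in> free_lie_on X1 \<Longrightarrow> Id_lie \<Theta> X1 `` {u} = {u}"
  by (auto simp: Id_lie_iff)

lemma equiv_Id_vec: "equiv (free_mod_on X1 X2) (Id_vec \<Theta> X1 X2)"
proof (rule equivI)
  show "Id_vec \<Theta> X1 X2 \<subseteq> free_mod_on X1 X2 \<times> free_mod_on X1 X2" by (auto simp: Id_vec_iff)
  show "refl_on (free_mod_on X1 X2) (Id_vec \<Theta> X1 X2)" by (auto simp: refl_on_def Id_vec_iff)
  show "Relation.sym (Id_vec \<Theta> X1 X2)"
    using vec_ideal_uminus by (auto intro!: symI simp: Id_vec_iff) fastforce
  show "Relation.trans (Id_vec \<Theta> X1 X2)"
  proof (rule transI)
    fix u v w assume "(u, v) \<in> Id_vec \<Theta> X1 X2" "(v, w) \<in> Id_vec \<Theta> X1 X2"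
    then show "(u, w) \<in> Id_vec \<Theta> X1 X2" using vec_ideal_add[of "u - v" "v - w"] by (simp add: Id_vec_iff)
  qed
qed

lemma vcls_eq_iff:
  "v \<in> free_mod_on X1 X2 \<Longrightarrow> w \<in> free_mod_on X1 X2 \<Longrightarrow> vcls X1 X2 v = vcls X1 X2 w \<longleftrightarrow> v - w \<in> vec_ideal"
  by (simp add: vcls_def eq_equiv_class_iff[OF equiv_Id_vec] Id_vec_iff)

lemma vcls_self: "v \<in> free_mod_on X1 X2 \<Longrightarrow> v \<in> vcls X1 X2 v"
  by (simp add: vcls_def Id_vec_iff)

lemma obj_lie_carrier: "finite X1 \<Longrightarrow> lie_car (obj X1 X2) = (\<lambda>u. {u}) ` free_lie_on X1"
  by (auto simp: free_rep_def quotient_rep_def abs_free_rep_def Let_def quotient_def lie_class)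

lemma obj_vec_carrier: "vec_car (obj X1 X2) = vcls X1 X2 ` free_mod_on X1 X2"
  by (auto simp: vcls_def free_rep_def quotient_rep_def abs_free_rep_def Let_def quotient_def)

lemma obj_lie_simps:
  assumes "finite X1" "u \<in> free_lie_on X1"
  shows "w \<in> free_lie_on X1 \<Longrightarrow> {u} \<oplus>\<^bsub>lie_sort (obj X1 X2)\<^esub> {w} = {u + w}"
    "c \<odot>\<^bsub>lie_sort (obj X1 X2)\<^esub> {u} = {fl_scale c u}"
    "w \<in> free_lie_on X1 \<Longrightarrow> lie_bracket (lie_sort (obj X1 X2)) {u} {w} = {fl_bracket u w}"
  using assms by (simp_all add: free_rep_def quotient_rep_def abs_free_rep_def Let_def lie_class
      free_lie_on.intros)

lemma obj_vec_simps:
  assumes "v \<in> free_mod_on X1 X2"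
  shows "w \<in> free_mod_on X1 X2 \<Longrightarrow> vcls X1 X2 v \<oplus>\<^bsub>vec_sort (obj X1 X2)\<^esub> vcls X1 X2 w = vcls X1 X2 (v + w)"
    "c \<odot>\<^bsub>vec_sort (obj X1 X2)\<^esub> vcls X1 X2 v = vcls X1 X2 (fm_scale c v)"
proof -
  note E = equiv_Id_vec[of X1 X2]
  have "(v + v', w + w') \<in> Id_vec \<Theta> X1 X2"
    if "(v, w) \<in> Id_vec \<Theta> X1 X2" "(v', w') \<in> Id_vec \<Theta> X1 X2" for v w v' w'
    using that vec_ideal_add[of "v - w" "v' - w'"]
    by (simp add: Id_vec_iff free_mod_on_closed algebra_simps)
  then show "vcls X1 X2 v \<oplus>\<^bsub>vec_sort (obj X1 X2)\<^esub> vcls X1 X2 w = vcls X1 X2 (v + w)"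
    if "w \<in> free_mod_on X1 X2"
    using UN_class2[OF E E E assms that, of "(+)"] by (simp add: vcls_def free_rep_def quotient_rep_def abs_free_rep_def Let_def)
  have "(fm_scale c v, fm_scale c w) \<in> Id_vec \<Theta> X1 X2" if "(v, w) \<in> Id_vec \<Theta> X1 X2" for v w
    using that vec_ideal_scale[of "v - w" c] by (simp add: Id_vec_iff free_mod_on_scale fm.scale_right_diff_distrib)
  then show "c \<odot>\<^bsub>vec_sort (obj X1 X2)\<^esub> vcls X1 X2 v = vcls X1 X2 (fm_scale c v)"
    using UN_class1[OF E E assms, of "fm_scale c"] by (simp add: vcls_def free_rep_def quotient_rep_def abs_free_rep_def Let_def)
qed

lemma obj_action:
  assumes "finite X1" "u \<in> free_lie_on X1" "v \<in> free_mod_on X1 X2"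
  shows "action (obj X1 X2) {u} (vcls X1 X2 v) = vcls X1 X2 (fm_mult (fl_iota u) v)"
proof -
  note E = equiv_Id_vec[of X1 X2]
  have "fm_mult a (v - w) = fm_mult a v - fm_mult a w" for a and v w :: "'k free_mod"
    using fm_mult_simps(1)[of a "v - w" w] by simp
  then have "(fm_mult (fl_iota u) v, fm_mult (fl_iota u) w) \<in> Id_vec \<Theta> X1 X2"
    if "(v, w) \<in> Id_vec \<Theta> X1 X2" for v w
    using that vec_ideal_action[of "v - w" u] assms(2) by (simp add: Id_vec_iff free_mod_on_action)
  then show ?thesis
    using UN_class1[OF E E assms(3), of "fm_mult (fl_iota u)"] assms
    by (simp add: vcls_def free_rep_def quotient_rep_def abs_free_rep_def Let_def lie_class)
qed

section \<open>Homomorphisms between objects as substitutions\<close>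

definition subst_hom ::
    "nat set \<Rightarrow> nat set \<Rightarrow> nat set \<Rightarrow> nat set \<Rightarrow> (nat \<Rightarrow> 'k free_lie) \<Rightarrow> (nat \<Rightarrow> 'k free_mod) \<Rightarrow>
     ('k free_lie set \<Rightarrow> 'k free_lie set) \<times> ('k free_mod set \<Rightarrow> 'k free_mod set)" where
  "subst_hom X1 X2 Y1 Y2 \<sigma> \<tau> =
    (\<lambda>A\<in>lie_car (obj X1 X2). {fl_subst \<sigma> (the_elem A)},
     \<lambda>B\<in>vec_car (obj X1 X2). vcls Y1 Y2 (fm_subst \<sigma> \<tau> (SOME v. v \<in> B)))"

definition valid_subst where
  "valid_subst X1 X2 Y1 Y2 \<sigma> \<tau> \<longleftrightarrow>
    (\<forall>x\<in>X1. \<sigma> x \<in> free_lie_on Y1) \<and> (\<forall>y\<in>X2. \<tau> y \<in> free_mod_on Y1 Y2)"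

lemma valid_substD:
  assumes "valid_subst X1 X2 Y1 Y2 \<sigma> \<tau>"
  shows "u \<in> free_lie_on X1 \<Longrightarrow> fl_subst \<sigma> u \<in> free_lie_on Y1"
    "v \<in> free_mod_on X1 X2 \<Longrightarrow> fm_subst \<sigma> \<tau> v \<in> free_mod_on Y1 Y2"
  using assms by (auto simp: valid_subst_def intro: fl_subst_closed fm_subst_closed)

text \<open>\<open>subst_hom\<close> picks a representative of each class. The choice does not
  matter: in sort 1 the classes are singletons, and in sort 2 \<open>vec_ideal\<close> is closed
  under substitution.\<close>

lemma subst_hom_simps:
  assumes "valid_subst X1 X2 Y1 Y2 \<sigma> \<tau>"
  shows "finite X1 \<Longrightarrow> u \<in> free_lie_on X1 \<Longrightarrow> fst (subst_hom X1 X2 Y1 Y2 \<sigma> \<tau>) {u} = {fl_subst \<sigma> u}"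
    "v \<in> free_mod_on X1 X2 \<Longrightarrow>
      snd (subst_hom X1 X2 Y1 Y2 \<sigma> \<tau>) (vcls X1 X2 v) = vcls Y1 Y2 (fm_subst \<sigma> \<tau> v)"
proof -
  show "finite X1 \<Longrightarrow> u \<in> free_lie_on X1 \<Longrightarrow> fst (subst_hom X1 X2 Y1 Y2 \<sigma> \<tau>) {u} = {fl_subst \<sigma> u}"
    by (simp add: subst_hom_def obj_lie_carrier)
  assume v: "v \<in> free_mod_on X1 X2"
  define w where "w = (SOME w. w \<in> vcls X1 X2 v)"
  have "w \<in> vcls X1 X2 v" unfolding w_def using vcls_self[OF v] by (rule someI)
  then have w: "w \<in> free_mod_on X1 X2" "v - w \<in> vec_ideal" by (auto simp: vcls_def Id_vec_iff)
  have "fm_subst \<sigma> \<tau> (v - w) + fm_subst \<sigma> \<tau> w = fm_subst \<sigma> \<tau> v" by (simp flip: fm_subst_add)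
  then have "fm_subst \<sigma> \<tau> v - fm_subst \<sigma> \<tau> w = fm_subst \<sigma> \<tau> (v - w)" by (simp add: algebra_simps)
  with vec_ideal_subst[OF w(2)] have "fm_subst \<sigma> \<tau> v - fm_subst \<sigma> \<tau> w \<in> vec_ideal" by simp
  then have "vcls Y1 Y2 (fm_subst \<sigma> \<tau> v) = vcls Y1 Y2 (fm_subst \<sigma> \<tau> w)"
    using valid_substD[OF assms] v w by (simp add: vcls_eq_iff)
  then show "snd (subst_hom X1 X2 Y1 Y2 \<sigma> \<tau>) (vcls X1 X2 v) = vcls Y1 Y2 (fm_subst \<sigma> \<tau> v)"
    using v by (simp add: subst_hom_def obj_vec_carrier w_def)
qed

lemma subst_hom_in_hom:
  assumes X: "finite X1" "finite Y1" and v: "valid_subst X1 X2 Y1 Y2 \<sigma> \<tau>"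
  shows "subst_hom X1 X2 Y1 Y2 \<sigma> \<tau> \<in> rep_hom (obj X1 X2) (obj Y1 Y2)"
proof -
  let ?h = "subst_hom X1 X2 Y1 Y2 \<sigma> \<tau>"
  note d = valid_substD[OF v] and s = subst_hom_simps[OF v]
  have e: "fst ?h \<in> extensional (lie_car (obj X1 X2))"
    "snd ?h \<in> extensional (vec_car (obj X1 X2))"
    by (auto simp: subst_hom_def)
  have "fst ?h \<in> linear_maps (lie_sort (obj X1 X2)) (lie_sort (obj Y1 Y2))"
    using e(1) X d by (auto simp: linear_maps_def PiE_def obj_lie_carrier s obj_lie_simps free_lie_on.intros)
  moreover have "snd ?h \<in> linear_maps (vec_sort (obj X1 X2)) (vec_sort (obj Y1 Y2))"
    using e(2) d by (auto simp: linear_maps_def PiE_def obj_vec_carrier s obj_vec_simps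
        free_mod_on_closed free_mod_on_scale)
  moreover have "fst ?h (lie_bracket (lie_sort (obj X1 X2)) x y)
      = lie_bracket (lie_sort (obj Y1 Y2)) (fst ?h x) (fst ?h y)"
    if "x \<in> lie_car (obj X1 X2)" "y \<in> lie_car (obj X1 X2)" for x y
    using X d that by (auto simp: obj_lie_carrier s obj_lie_simps free_lie_on.intros)
  moreover have "snd ?h (action (obj X1 X2) l w) = action (obj Y1 Y2) (fst ?h l) (snd ?h w)"
    if "l \<in> lie_car (obj X1 X2)" "w \<in> vec_car (obj X1 X2)" for l w
    using X d that by (auto simp: obj_lie_carrier obj_vec_carrier s obj_action free_mod_on_action)
  ultimately show ?thesis by (auto simp: rep_hom_def split: prod.split)
qed

lemma hom_is_subst:
  assumes X: "finite X1" "finite Y1" and h: "h \<in> rep_hom (obj X1 X2) (obj Y1 Y2)"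
    and v: "valid_subst X1 X2 Y1 Y2 \<sigma> \<tau>"
    and g1: "\<And>x. x \<in> X1 \<Longrightarrow> fst h {fl_gen x} = {\<sigma> x}"
    and g2: "\<And>y. y \<in> X2 \<Longrightarrow> snd h (vcls X1 X2 (fm_gen y)) = vcls Y1 Y2 (\<tau> y)"
  shows "h = subst_hom X1 X2 Y1 Y2 \<sigma> \<tau>"
proof (rule hom_ext[OF h subst_hom_in_hom[OF X v]])
  note s = subst_hom_simps[OF v] and d = valid_substD[OF v]
  let ?H = "obj X1 X2" and ?K = "obj Y1 Y2"
  note hs = hom_simps[OF h]
  have cL: "{u} \<in> lie_car ?H" if "u \<in> free_lie_on X1" for u
    using that X by (simp add: obj_lie_carrier)
  have cV: "vcls X1 X2 v \<in> vec_car ?H" if "v \<in> free_mod_on X1 X2" for v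
    using that by (simp add: obj_vec_carrier)
  have 1: "fst h {u} = {fl_subst \<sigma> u}" if "u \<in> free_lie_on X1" for u
    using that
  proof induction
    case (lie_on_gen x)
    then show ?case by (simp add: g1)
  next
    case lie_on_zero
    \<comment> \<open>Homomorphisms are only known to preserve sums and scalar multiples, so the
      image of zero is computed as \<open>0\<close> times an element of the target.\<close>
    have "fst h (0 \<odot>\<^bsub>lie_sort ?H\<^esub> {0}) = 0 \<odot>\<^bsub>lie_sort ?K\<^esub> fst h {0}"
      by (intro hs cL free_lie_on.lie_on_zero)
    moreover have "fst h {0} \<in> lie_car ?K"
      by (intro hs cL free_lie_on.lie_on_zero)
    then obtain u where "u \<in> free_lie_on Y1" "fst h {0} = {u}" using X by (auto simp: obj_lie_carrier)
    ultimately show ?case using X by (simp add: obj_lie_simps free_lie_on.lie_on_zero)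
  next
    case (lie_on_add u w)
    then show ?case using hs(3)[OF cL cL, of u w] X d by (simp add: obj_lie_simps)
  next
    case (lie_on_scale u c)
    then show ?case using hs(4)[OF cL, of u c] X d by (simp add: obj_lie_simps)
  next
    case (lie_on_bracket u w)
    then show ?case using hs(5)[OF cL cL, of u w] X d by (simp add: obj_lie_simps)
  qed
  have 2: "snd h (vcls X1 X2 v) = vcls Y1 Y2 (fm_subst \<sigma> \<tau> v)" if "v \<in> free_mod_on X1 X2" for v
    using that
  proof (induction rule: free_mod_on_induct)
    case zero
    have "snd h (0 \<odot>\<^bsub>vec_sort ?H\<^esub> vcls X1 X2 0) = 0 \<odot>\<^bsub>vec_sort ?K\<^esub> snd h (vcls X1 X2 0)"
      by (intro hs cV free_mod_on_closed)
    moreover have "snd h (vcls X1 X2 0) \<in> vec_car ?K"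
      by (intro hs cV free_mod_on_closed)
    then obtain u where "u \<in> free_mod_on Y1 Y2" "snd h (vcls X1 X2 0) = vcls Y1 Y2 u"
      by (auto simp: obj_vec_carrier)
    ultimately show ?case by (simp add: obj_vec_simps free_mod_on_closed)
  next
    case (add v w)
    then show ?case using hs(6)[OF cV cV, of v w] d by (simp add: obj_vec_simps)
  next
    case (scale c v)
    then show ?case using hs(7)[OF cV, of v c] d by (simp add: obj_vec_simps)
  next
    case (action x v)
    then have "{fl_gen x} \<in> lie_car ?H" by (intro cL lie_on_gen)
    from hs(8)[OF this cV[OF action(2)]] show ?case using action X v d
      by (simp add: obj_action lie_on_gen g1 valid_subst_def flip: fl_iota_simps(1))
  qed (simp add: g2)
  show "fst h x = fst (subst_hom X1 X2 Y1 Y2 \<sigma> \<tau>) x" if "x \<in> lie_car ?H" for x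
    using that 1 X by (auto simp: obj_lie_carrier s)
  show "snd h x = snd (subst_hom X1 X2 Y1 Y2 \<sigma> \<tau>) x" if "x \<in> vec_car ?H" for x
    using that 2 by (auto simp: obj_vec_carrier s)
qed

lemma gen_carrier:
  "finite X1 \<Longrightarrow> x \<in> X1 \<Longrightarrow> {fl_gen x} \<in> lie_car (obj X1 X2)"
  "y \<in> X2 \<Longrightarrow> vcls X1 X2 (fm_gen y) \<in> vec_car (obj X1 X2)"
  by (auto simp: obj_lie_carrier lie_on_gen obj_vec_carrier free_mod_on_gen)

lemma hom_subst_ex:
  assumes X: "finite X1" "finite Y1" and h: "h \<in> rep_hom (obj X1 X2) (obj Y1 Y2)"
  obtains \<sigma> \<tau> where "valid_subst X1 X2 Y1 Y2 \<sigma> \<tau>" "h = subst_hom X1 X2 Y1 Y2 \<sigma> \<tau>"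
proof -
  have "\<exists>u. u \<in> free_lie_on Y1 \<and> fst h {fl_gen x} = {u}" if "x \<in> X1" for x
    using hom_simps(1)[OF h gen_carrier(1)[OF X(1) that]] X by (auto simp: obj_lie_carrier)
  then obtain \<sigma> where "\<And>x. x \<in> X1 \<Longrightarrow> \<sigma> x \<in> free_lie_on Y1 \<and> fst h {fl_gen x} = {\<sigma> x}" by metis
  moreover have "\<exists>v. v \<in> free_mod_on Y1 Y2 \<and> snd h (vcls X1 X2 (fm_gen y)) = vcls Y1 Y2 v" if "y \<in> X2" for y
    using hom_simps(2)[OF h gen_carrier(2)[OF that]] by (auto simp: obj_vec_carrier)
  then obtain \<tau> where "\<And>y. y \<in> X2 \<Longrightarrow> \<tau> y \<in> free_mod_on Y1 Y2 \<and> snd h (vcls X1 X2 (fm_gen y)) = vcls Y1 Y2 (\<tau> y)"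
    by metis
  ultimately show ?thesis
    using that[of \<sigma> \<tau>] hom_is_subst[OF X h, of \<sigma> \<tau>] by (auto simp: valid_subst_def)
qed

lemma hom_eqI:
  assumes X: "finite X1" "finite Y1"
    and h: "h \<in> rep_hom (obj X1 X2) (obj Y1 Y2)" "h' \<in> rep_hom (obj X1 X2) (obj Y1 Y2)"
    and g: "\<And>x. x \<in> X1 \<Longrightarrow> fst h {fl_gen x} = fst h' {fl_gen x}"
      "\<And>y. y \<in> X2 \<Longrightarrow> snd h (vcls X1 X2 (fm_gen y)) = snd h' (vcls X1 X2 (fm_gen y))"
  shows "h = h'"
proof -
  obtain \<sigma> \<tau> where s: "valid_subst X1 X2 Y1 Y2 \<sigma> \<tau>" "h' = subst_hom X1 X2 Y1 Y2 \<sigma> \<tau>"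
    using hom_subst_ex[OF X h(2)] .
  show ?thesis unfolding s(2)
    by (rule hom_is_subst[OF X h(1) s(1)]) (use g X in \<open>simp_all add: s subst_hom_simps lie_on_gen free_mod_on_gen\<close>)
qed

text \<open>Together with \<open>hom_eqI\<close> this is freeness: homomorphisms from an object
  correspond to arbitrary values on its generators.\<close>

lemma hom_ex:
  assumes X: "finite X1" "finite Y1"
    and a: "\<And>x. x \<in> X1 \<Longrightarrow> a x \<in> lie_car (obj Y1 Y2)"
    and b: "\<And>y. y \<in> X2 \<Longrightarrow> b y \<in> vec_car (obj Y1 Y2)"
  obtains h where "h \<in> rep_hom (obj X1 X2) (obj Y1 Y2)"
    "\<And>x. x \<in> X1 \<Longrightarrow> fst h {fl_gen x} = a x"
    "\<And>y. y \<in> X2 \<Longrightarrow> snd h (vcls X1 X2 (fm_gen y)) = b y"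
proof -
  have "\<forall>x\<in>X1. \<exists>u. u \<in> free_lie_on Y1 \<and> a x = {u}" using a X by (auto simp: obj_lie_carrier)
  then obtain \<sigma> where \<sigma>: "\<And>x. x \<in> X1 \<Longrightarrow> \<sigma> x \<in> free_lie_on Y1 \<and> a x = {\<sigma> x}" by metis
  have "\<forall>y\<in>X2. \<exists>v. v \<in> free_mod_on Y1 Y2 \<and> b y = vcls Y1 Y2 v" using b by (auto simp: obj_vec_carrier)
  then obtain \<tau> where \<tau>: "\<And>y. y \<in> X2 \<Longrightarrow> \<tau> y \<in> free_mod_on Y1 Y2 \<and> b y = vcls Y1 Y2 (\<tau> y)" by metis
  have "valid_subst X1 X2 Y1 Y2 \<sigma> \<tau>" using \<sigma> \<tau> by (auto simp: valid_subst_def)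
  from that[OF subst_hom_in_hom[OF X this]] subst_hom_simps[OF this] \<sigma> \<tau> X show ?thesis
    by (simp add: lie_on_gen free_mod_on_gen)
qed

end

section \<open>Homogeneous elements\<close>

text \<open>Independence of eigenvectors, modulo an invariant subspace. Write S for the sum. The
  operator T - e_k kills the summand of \<open>k\<close> and commutes with T - c, so the induction
  hypothesis applies to (T - e_k) S and puts it into \<open>I\<close>. Its difference to (T - c) S
  is a nonzero multiple of S.\<close>

lemma (in vector_space) eigen_complement:
  assumes I: "subspace I" "\<And>v. v \<in> I \<Longrightarrow> T v \<in> I"
    and T: "\<And>u v. T (u + v) = T u + T v" "\<And>a v. T (scale a v) = scale a (T v)"
  shows "finite J \<Longrightarrow> (\<And>j. j \<in> J \<Longrightarrow> T (w j) = scale (e j) (w j)) \<Longrightarrow> (\<And>j. j \<in> J \<Longrightarrow> e j \<noteq> c) \<Longrightarrow>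
    T (sum w J) - scale c (sum w J) \<in> I \<Longrightarrow> sum w J \<in> I"
proof (induction J arbitrary: w rule: finite_induct)
  case empty
  show ?case using I(1) by (simp add: subspace_0)
next
  case (insert k J)
  have Tm: "T (u - v) = T u - T v" for u v
    using T(1)[of "u - v" v] by (simp add: algebra_simps)
  have T0: "T 0 = 0" using T(2)[of 0 0] by simp
  have Tsum: "T (sum g J) = (\<Sum>j\<in>J. T (g j))" for g
    using insert(1) by (induction J rule: finite_induct) (simp_all add: T T0)
  let ?S = "sum w (insert k J)"
  let ?w = "\<lambda>j. scale (e j - e k) (w j)"
  have "sum ?w J = (\<Sum>j\<in>J. T (w j)) - scale (e k) (sum w J)"
    using insert(4) by (simp add: scale_left_diff_distrib sum_subtractf scale_sum_right)
  then have S: "sum ?w J = T ?S - scale (e k) ?S"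
    using insert(1,2,4) by (simp add: T Tsum scale_right_distrib)
  have R: "T ?S - scale c ?S \<in> I" by (rule insert(6))
  have "T (sum ?w J) - scale c (sum ?w J) = T (T ?S - scale c ?S) - scale (e k) (T ?S - scale c ?S)"
    unfolding S by (simp add: Tm T(2) scale_right_diff_distrib scale_left_commute algebra_simps)
  also have "\<dots> \<in> I" by (rule subspace_diff[OF I(1) I(2)[OF R] subspace_scale[OF I(1) R]])
  finally have "sum ?w J \<in> I"
    by (intro insert.IH) (use insert(4,5) in \<open>auto simp: T(2) scale_left_commute\<close>)
  from subspace_diff[OF I(1) R this[unfolded S]]
  have "(T ?S - scale c ?S) - (T ?S - scale (e k) ?S) \<in> I" .
  then have "scale (e k - c) ?S \<in> I" by (simp add: scale_left_diff_distrib)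
  from subspace_scale[OF I(1) this, of "inverse (e k - c)"] show ?case
    using insert(5)[of k] by simp
qed

text \<open>Split a combination of eigenvectors by eigenvalue: the part with eigenvalue
  \<open>c\<close> contributes nothing to \<open>T u - scale c u\<close>, so the remaining part
  meets the hypothesis of \<open>eigen_complement\<close> and falls into \<open>I\<close>.\<close>

lemma (in vector_space) eigen_component:
  assumes I: "subspace I" "\<And>v. v \<in> I \<Longrightarrow> T v \<in> I"
    and T: "\<And>u v. T (u + v) = T u + T v" "\<And>a v. T (scale a v) = scale a (T v)"
    and M: "\<And>m. m \<in> M \<Longrightarrow> \<exists>a. T m = scale a m"
    and u: "u \<in> span M" "T u - scale c u \<in> I"
  shows "\<exists>u' \<in> span {m \<in> M. T m = scale c m}. u - u' \<in> I"
proof -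
  obtain t r where t: "finite t" "t \<subseteq> M" "u = (\<Sum>a\<in>t. scale (r a) a)"
    using u(1) by (auto simp: span_explicit)
  have Tm: "T (u - v) = T u - T v" for u v
    using T(1)[of "u - v" v] by (simp add: algebra_simps)
  have T0: "T 0 = 0" using T(2)[of 0 0] by simp
  have Tsum: "T (sum g J) = (\<Sum>j\<in>J. T (g j))" if "finite J" for g :: "'b \<Rightarrow> 'b" and J
    using that by (induction J rule: finite_induct) (simp_all add: T T0)
  let ?E = "{m \<in> t. T m = scale c m}" and ?N = "{m \<in> t. T m \<noteq> scale c m}"
  define u' where "u' = (\<Sum>a\<in>?E. scale (r a) a)"
  define w where "w = (\<Sum>a\<in>?N. scale (r a) a)"
  have "t = ?E \<union> ?N" by auto
  then have uw: "u = u' + w"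
    unfolding t(3) u'_def w_def using t(1) by (subst sum.union_disjoint[symmetric]) auto
  have Tu': "T u' = scale c u'"
    unfolding u'_def using t(1) by (simp add: Tsum T(2) scale_sum_right mult.commute)
  obtain e where e: "\<And>m. m \<in> M \<Longrightarrow> T m = scale (e m) m" using M by metis
  have "T w - scale c w = T u - scale c u"
    unfolding uw by (simp add: T Tu' scale_right_distrib)
  then have "T w - scale c w \<in> I" using u(2) by simp
  then have "w \<in> I"
    unfolding w_def by (intro eigen_complement[OF I T, of ?N "\<lambda>a. scale (r a) a" e c])
      (use t e in \<open>auto simp: T(2) scale_left_commute\<close>)
  moreover have "u' \<in> span {m \<in> M. T m = scale c m}"
    unfolding u'_def using t(2) by (intro span_sum span_scale span_base) auto
  ultimately show ?thesis using uw by (intro bexI[of _ u']) auto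
qed

section \<open>Bihomogeneous Lie monomials in two variables\<close>

inductive bimon :: "nat \<Rightarrow> nat \<Rightarrow> 'k::field free_lie \<Rightarrow> bool" where
  bimon_0: "bimon 1 0 (fl_gen 0)"
| bimon_1: "bimon 0 1 (fl_gen 1)"
| bimon_bracket: "bimon a b u \<Longrightarrow> bimon a' b' w \<Longrightarrow> bimon (a + a') (b + b') (fl_bracket u w)"

lemma bimon_pos: "bimon a b u \<Longrightarrow> a + b > 0"
  by (induction rule: bimon.induct) auto

lemma bimon_scaling:
  "bimon a b u \<Longrightarrow> fl_subst (\<lambda>x. fl_scale (c x) (fl_gen x)) u = fl_scale (c 0 ^ a * c 1 ^ b) u"
  by (induction rule: bimon.induct) (simp_all add: fl_simps(8,9) power_add mult_ac)

text \<open>Both factors of a bracket have positive degree, so a bracket has total degree at least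
  two.\<close>

lemma bimon_linear:
  assumes "bimon a b u" "a + b = 1"
  shows "a = 1 \<and> u = fl_gen 0 \<or> a = 0 \<and> u = fl_gen 1"
  using assms(1)
proof (cases rule: bimon.cases)
  case (bimon_bracket c d v c' d' w)
  have "c + d > 0" "c' + d' > 0"
    by (rule bimon_pos[OF bimon_bracket(4)]) (rule bimon_pos[OF bimon_bracket(5)])
  moreover have "(c + c') + (d + d') = 1" using assms(2) bimon_bracket(1,2) by simp
  ultimately have False by presburger
  then show ?thesis ..
qed simp_all

lemma fl_bracket_swap: "fl_bracket u w = - fl_bracket w u"
proof -
  have "fl_bracket (u + w) (u + w) = fl_bracket u w + fl_bracket w u"
    unfolding fl_simps(6,7) by (simp add: fl_simps(10))
  then have "fl_bracket u w + fl_bracket w u = 0" by (simp add: fl_simps(10))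
  then show ?thesis by (simp add: eq_neg_iff_add_eq_0)
qed

text \<open>Positive degrees leave only the two brackets of the distinct generators, and these
  differ by a sign.\<close>

lemma bimon_11:
  assumes "bimon a b u" "a = 1" "b = 1"
  shows "u \<in> fl.span {fl_bracket (fl_gen 0) (fl_gen 1)}"
  using assms(1)
proof (cases rule: bimon.cases)
  case (bimon_bracket c d v c' d' w)
  have "c + c' = 1" "d + d' = 1" using bimon_bracket(1,2) assms(2,3) by simp_all
  moreover have "c + d > 0" "c' + d' > 0"
    by (rule bimon_pos[OF bimon_bracket(4)]) (rule bimon_pos[OF bimon_bracket(5)])
  ultimately consider "c = 1" "d = 0" "c' = 0" "d' = 1" | "c = 0" "d = 1" "c' = 1" "d' = 0"
    by linarith
  then show ?thesis
  proof cases
    case 1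
    show ?thesis
      unfolding bimon_bracket(3) using bimon_linear[OF bimon_bracket(4)] bimon_linear[OF bimon_bracket(5)] 1
      by (intro fl.span_base) simp
  next
    case 2
    show ?thesis
      unfolding bimon_bracket(3) fl_bracket_swap[of v]
      using bimon_linear[OF bimon_bracket(4)] bimon_linear[OF bimon_bracket(5)] 2
      by (intro fl.span_neg fl.span_base) simp
  qed
next
  case bimon_0
  then show ?thesis using assms(3) by simp
next
  case bimon_1
  then show ?thesis using assms(2) by simp
qed

lemma span_bimon:
  assumes "u \<in> free_lie_on {0, 1}"
  shows "u \<in> fl.span {m. \<exists>a b. bimon a b m}" (is "_ \<in> fl.span ?M")
  using assms
proof induction
  case (lie_on_gen x)
  then have "fl_gen x \<in> ?M" using bimon_0 bimon_1 by fastforce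
  then show ?case by (rule fl.span_base)
next
  case (lie_on_bracket u w)
  have "fl_bracket m w \<in> fl.span ?M" if m: "m \<in> ?M" for m
    using lie_on_bracket(4)
  proof (induction rule: fl.span_induct_alt)
    case base
    have "fl_bracket m 0 = 0" using fl_simps(9)[of m 0 0] by simp
    then show ?case by (simp add: fl.span_zero)
  next
    case (step c n w)
    have "fl_bracket m n \<in> ?M" using m step bimon_bracket by blast
    then show ?case using step by (simp add: fl_simps(7,9) fl.span_add fl.span_scale fl.span_base)
  qed
  note * = this
  from lie_on_bracket(3) show ?case
  proof (induction rule: fl.span_induct_alt)
    case base
    have "fl_bracket 0 w = 0" using fl_simps(8)[of 0 0 w] by simp
    then show ?case by (simp add: fl.span_zero)
  next
    case (step c n u)
    then show ?case using * by (simp add: fl_simps(6,8) fl.span_add fl.span_scale)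
  qed
qed (auto intro: fl.span_zero fl.span_add fl.span_scale)

text \<open>\<open>eigen_component\<close> with the zero subspace. A monomial may be zero, like the
  bracket of a generator with itself, and is then an eigenvector for every eigenvalue; hence the
  alternative \<open>m = 0\<close>.\<close>

lemma eigenvector_in_span:
  fixes u :: "'k::field_char_0 free_lie"
  assumes "u \<in> free_lie_on {0, 1}" "fl_subst (\<lambda>x. fl_scale (c x) (fl_gen x)) u = fl_scale d u"
  shows "u \<in> fl.span {m. \<exists>a b. bimon a b m \<and> (c 0 ^ a * c 1 ^ b = d \<or> m = 0)}"
proof -
  let ?T = "fl_subst (\<lambda>x. fl_scale (c x) (fl_gen x))"
  have "\<exists>u' \<in> fl.span {m \<in> {m. \<exists>a b. bimon a b m}. ?T m = fl_scale d m}. u - u' \<in> {0}"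
    by (rule fl.eigen_component) (use assms span_bimon in \<open>auto simp: fl.subspace_def dest: bimon_scaling\<close>)
  then obtain u' where "u' \<in> fl.span {m \<in> {m. \<exists>a b. bimon a b m}. ?T m = fl_scale d m}" "u = u'"
    by auto
  moreover have "{m \<in> {m. \<exists>a b. bimon a b m}. ?T m = fl_scale d m}
      \<subseteq> {m. \<exists>a b. bimon a b m \<and> (c 0 ^ a * c 1 ^ b = d \<or> m = 0)}"
    by (auto simp: bimon_scaling) blast+
  ultimately show ?thesis using fl.span_mono by blast
qed

text \<open>A monomial of total degree n has eigenvalue 2^n, and in characteristic 0 this equals 2
  only for n = 1.\<close>

lemma lie_degree_one:
  fixes u :: "'k::field_char_0 free_lie"
  assumes "u \<in> free_lie_on {0, 1}" "fl_subst (\<lambda>x. fl_scale 2 (fl_gen x)) u = fl_scale 2 u"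
  obtains a b where "u = fl_scale a (fl_gen 0) + fl_scale b (fl_gen 1)"
proof -
  have "m \<in> {fl_gen 0, fl_gen 1, 0}" if "bimon a b m" "(2::'k) ^ a * 2 ^ b = 2 \<or> m = 0" for a b m
  proof (cases "m = 0")
    case False
    then have "(2::'k) ^ (a + b) = of_nat (2 ^ 1)" using that(2) by (simp add: power_add)
    then have "(of_nat (2 ^ (a + b)) :: 'k) = of_nat (2 ^ 1)" by simp
    then have "(2::nat) ^ (a + b) = 2 ^ 1" by (simp only: of_nat_eq_iff)
    then have "a + b = 1" by (subst (asm) power_inject_exp) auto
    then show ?thesis using bimon_linear[OF that(1)] by blast
  qed simp
  then have "{m. \<exists>a b. bimon a b m \<and> ((2::'k) ^ a * 2 ^ b = 2 \<or> m = 0)} \<subseteq> {fl_gen 0, fl_gen 1, 0}"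
    by blast
  then have "u \<in> fl.span {fl_gen 0, fl_gen 1, 0}"
    using eigenvector_in_span[OF assms] fl.span_mono by blast
  then obtain a b where "u - fl_scale a (fl_gen 0) - fl_scale b (fl_gen 1) \<in> fl.span {0}"
    unfolding fl.span_insert[of "fl_gen 0"] fl.span_insert[of "fl_gen 1"] by blast
  moreover have "fl.span {0 :: 'k free_lie} = {0}" by (simp add: fl.span_insert_0)
  ultimately have "u = fl_scale a (fl_gen 0) + fl_scale b (fl_gen 1)"
    by (simp add: algebra_simps)
  then show ?thesis by (rule that)
qed

text \<open>With scaling factors 2 and 3 the eigenvalue \<open>2\<^sup>a 3\<^sup>b\<close> determines the bidegree \<open>(a, b)\<close>.\<close>

lemma lie_degree_one_one:
  fixes u :: "'k::field_char_0 free_lie"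
  assumes "u \<in> free_lie_on {0, 1}"
    "fl_subst (\<lambda>x. fl_scale (if x = 0 then 2 else 3) (fl_gen x)) u = fl_scale 6 u"
  obtains g where "u = fl_scale g (fl_bracket (fl_gen 0) (fl_gen 1))"
proof -
  let ?B = "fl_bracket (fl_gen 0) (fl_gen 1) :: 'k free_lie"
  have "m \<in> fl.span {?B}" if "bimon a b m" "(2::'k) ^ a * 3 ^ b = 6 \<or> m = 0" for a b m
  proof (cases "m = 0")
    case False
    then have "(of_nat (2 ^ a * 3 ^ b) :: 'k) = of_nat 6" using that(2) by simp
    then have *: "(2::nat) ^ a * 3 ^ b = 6" by (simp only: of_nat_eq_iff)
    have "a < 2"
    proof (rule ccontr)
      assume "\<not> a < 2"
      then have "(2::nat) ^ 2 dvd 2 ^ a" by (intro le_imp_power_dvd) simp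
      from dvd_mult2[OF this, of "3 ^ b"] show False unfolding * by simp
    qed
    moreover have "a \<noteq> 0"
    proof
      assume "a = 0"
      then have "even ((3::nat) ^ b)" using * by simp
      then show False by simp
    qed
    ultimately have a: "a = 1" by simp
    then have "(3::nat) ^ b = 3 ^ 1" using * by simp
    then have "b = 1" by (subst (asm) power_inject_exp) auto
    then show ?thesis using bimon_11[OF that(1) a] by simp
  qed (simp add: fl.span_zero)
  then have "{m. \<exists>a b. bimon a b m \<and> ((2::'k) ^ a * 3 ^ b = 6 \<or> m = 0)} \<subseteq> fl.span {?B}"
    by blast
  moreover have "u \<in> fl.span {m. \<exists>a b. bimon a b m \<and> ((2::'k) ^ a * 3 ^ b = 6 \<or> m = 0)}"
    using eigenvector_in_span[OF assms] by simp
  ultimately have "u \<in> fl.span (fl.span {?B})" by (rule subsetD[OF fl.span_mono])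
  then have "u \<in> fl.span {?B}" by (simp only: fl.span_span)
  then have "u \<in> range (\<lambda>k. fl_scale k ?B)" by (simp only: fl.span_singleton)
  then show ?thesis using that by blast
qed

section \<open>Free representations with few generators\<close>

lemma free_lie_on_empty: "u \<in> free_lie_on {} \<Longrightarrow> u = 0"
proof (induction rule: free_lie_on.induct)
  case (lie_on_bracket u w)
  then show ?case by (simp add: fl_simps(10))
qed auto

text \<open>Multiples of one generator commute, so the free Lie algebra of rank one is a line. This
  is why the endomorphisms of a rank one object are scalars.\<close>

lemma free_lie_on_singleton:
  assumes "u \<in> free_lie_on {i}"
  obtains c where "u = fl_scale c (fl_gen i)"
proof -
  have "\<exists>c. u = fl_scale c (fl_gen i)" using assms
  proof induction
    case (lie_on_gen x)
    then show ?case by (intro exI[of _ 1]) simp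
  next
    case lie_on_zero
    show ?case by (intro exI[of _ 0]) simp
  next
    case (lie_on_add u v)
    then show ?case by (auto simp flip: fl_simps(2))
  next
    case (lie_on_scale u c)
    then show ?case by (auto simp flip: fl_simps(3))
  next
    case (lie_on_bracket u v)
    then show ?case by (intro exI[of _ 0]) (auto simp: fl_simps(8,9,10))
  qed
  then show ?thesis using that by blast
qed

text \<open>Nothing in a quotient by generated relations is obviously nonzero; the map to the
  associative algebra detects the generator as the coefficient of a one-letter word.\<close>

lemma fl_gen_nonzero: "fl_gen x \<noteq> (0 :: 'k::field free_lie)"
proof
  assume "fl_gen x = (0 :: 'k free_lie)"
  then have "fl_iota (fl_gen x) = fl_iota (0 :: 'k free_lie)" by simp
  then have "Poly_Mapping.lookup (fa_gen x :: 'k free_assoc) [x] = 0" by (simp add: fl_iota_simps)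
  then show False by (simp add: fa_gen_def)
qed

lemma free_mod_on_empty: "v \<in> free_mod_on X1 {} \<Longrightarrow> v = 0"
  by (simp add: free_mod_on_def)

lemma free_mod_on_two:
  assumes "v \<in> free_mod_on {} {i, j}"
  obtains a b where "v = fm_scale a (fm_gen i) + fm_scale b (fm_gen j)"
proof -
  have "v \<in> fm.span {fm_gen i, fm_gen j}" using assms
    by (induction rule: free_mod_on_induct) (auto intro: fm.span_base fm.span_add fm.span_scale fm.span_zero)
  then obtain a b where "v - fm_scale a (fm_gen i) - fm_scale b (fm_gen j) = 0"
    unfolding fm.span_insert fm.span_empty by blast
  then have "v = fm_scale a (fm_gen i) + fm_scale b (fm_gen j)" by (simp add: algebra_simps)
  then show ?thesis by (rule that)
qed

lemma free_mod_on_singleton: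
  assumes "v \<in> free_mod_on {} {j}"
  obtains c where "v = fm_scale c (fm_gen j)"
proof -
  obtain a b where "v = fm_scale a (fm_gen j) + fm_scale b (fm_gen j)"
    using free_mod_on_two[of v j j] assms by auto
  then have "v = fm_scale (a + b) (fm_gen j)" by (simp add: fm_scale_simps)
  then show ?thesis by (rule that)
qed

lemma fm_subst_zero: "fm_subst \<sigma> (\<lambda>_. 0) v = 0"
  by (simp add: fm_subst_def)

lemma fl_subst_zero: "fl_subst (\<lambda>_. 0) u = 0"
  by (induction u rule: free_lie_induct) (simp_all add: fl_simps(10))

text \<open>Without Lie variables the elements are linear forms in the generators, and the
  substitution that keeps \<open>y\<close> and kills the other generators extracts the component at
  \<open>y\<close>.\<close>

lemma fm_components:
  assumes "finite X2" "v \<in> free_mod_on {} X2"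
  shows "v = (\<Sum>y\<in>X2. fm_subst fl_gen (\<lambda>z. if z = y then fm_gen y else 0) v)"
  using assms(2)
proof (induction rule: free_mod_on_induct)
  case (gen y)
  then show ?case using assms(1) by simp
next
  case (scale c v)
  show ?case unfolding fm_subst_scale fm.scale_sum_right[symmetric]
    by (rule arg_cong[OF scale(2)])
next
  case (add v w)
  show ?case unfolding fm_subst_add sum.distrib by (rule arg_cong2[OF add(3,4)])
qed simp_all

lemma fm_subst_comp: "fm_subst \<sigma> \<tau> (fm_subst \<sigma>' \<tau>' v)
    = fm_subst (\<lambda>x. fl_subst \<sigma> (\<sigma>' x)) (\<lambda>y. fm_subst \<sigma> \<tau> (\<tau>' y)) v"
proof -
  have "v \<in> free_mod_on UNIV UNIV" by simp
  then show ?thesis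
    by (induction rule: free_mod_on_induct) (simp_all add: fm_subst_mult fl_iota_subst)
qed

section \<open>Nonvanishing and homogeneity modulo the identities\<close>

context action_variety
begin

lemma subspace_vec_ideal: "fm.subspace vec_ideal"
  by (simp add: fm.subspace_def vec_ideal_add vec_ideal_scale)

lemma bracket_act_notin: "fm_mult (fl_iota (fl_bracket (fl_gen 0) (fl_gen 1))) (fm_gen 0) \<notin> vec_ideal"
  using nondegenerate by (auto simp: degenerated_def vec_ideal_def)

text \<open>Nonvanishing in the second sort is drawn from nondegeneracy: if a generator, or in
  \<open>act_notin\<close> a product of two generators, vanished identically, a substitution would
  make the action of a bracket vanish.\<close>

lemma fm_gen_notin: "fm_gen y \<notin> vec_ideal"
proof
  assume "fm_gen y \<in> vec_ideal"
  from vec_ideal_subst[OF this, of fl_gen "\<lambda>_. fm_mult (fl_iota (fl_bracket (fl_gen 0) (fl_gen 1))) (fm_gen 0)"]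
  show False using bracket_act_notin by simp
qed

lemma act_notin: "fm_mult (fl_iota (fl_gen 0)) (fm_gen 0) \<notin> vec_ideal"
proof
  assume "fm_mult (fl_iota (fl_gen 0)) (fm_gen 0) \<in> vec_ideal"
  from vec_ideal_subst[OF this, of "\<lambda>_. fl_bracket (fl_gen 0) (fl_gen 1)" fm_gen]
  show False using bracket_act_notin by simp
qed

lemma bracket_nonzero: "fl_bracket (fl_gen 0) (fl_gen 1) \<noteq> (0 :: 'k free_lie)"
  by (metis bracket_act_notin fl_iota_simps(2) fm_mult_0_left vec_ideal_0)

text \<open>With one generator x of sort 1 and y of sort 2, the monomials are x^n y, and doubling x
  multiplies x^n y by 2^n. As only classes are known, \<open>eigen_component\<close> is applied with
  \<open>vec_ideal\<close> as the invariant subspace; in characteristic 0 only n = 1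
  survives.\<close>

lemma vec_degree_one:
  assumes "v \<in> free_mod_on {0} {0}"
    "fm_subst (\<lambda>x. fl_scale 2 (fl_gen x)) fm_gen v - fm_scale 2 v \<in> vec_ideal"
  obtains d where "v - fm_scale d (fm_mult (fl_iota (fl_gen 0)) (fm_gen 0)) \<in> vec_ideal"
proof -
  let ?T = "fm_subst (\<lambda>x. fl_scale 2 (fl_gen x)) fm_gen"
  let ?A = "fm_mult (fl_iota (fl_gen 0)) :: 'k free_mod \<Rightarrow> _"
  let ?m = "\<lambda>n. (?A ^^ n) (fm_gen 0)"
  have T: "?T (?m n) = fm_scale (2 ^ n) (?m n)" for n
    by (induction n) (simp_all add: fm_mult_iota_scale fm_mult_scale)
  have "v \<in> fm.span (range ?m)" using assms(1)
  proof (induction rule: free_mod_on_induct)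
    case (gen y)
    then have "fm_gen y = ?m 0" by simp
    also have "\<dots> \<in> fm.span (range ?m)" by (intro fm.span_base rangeI)
    finally show ?case .
  next
    case (action x v)
    from action(3) have "?A v \<in> fm.span (range ?m)"
    proof (induction rule: fm.span_induct_alt)
      case (step c w v)
      then obtain n where "w = ?m n" by blast
      then have "?A w = ?m (Suc n)" by simp
      also have "\<dots> \<in> fm.span (range ?m)" by (intro fm.span_base rangeI)
      finally have "?A w \<in> fm.span (range ?m)" .
      then show ?case using step by (simp add: fm_mult_simps fm_mult_scale fm.span_add fm.span_scale)
    qed (simp add: fm.span_zero)
    then show ?case using action by (simp add: fl_iota_simps)
  qed (auto intro: fm.span_add fm.span_scale fm.span_zero)
  moreover have "\<exists>a. ?T m = fm_scale a m" if "m \<in> range ?m" for m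
    using that T by blast
  ultimately obtain u' where u': "u' \<in> fm.span {m \<in> range ?m. ?T m = fm_scale 2 m}" "v - u' \<in> vec_ideal"
    using fm.eigen_component[OF subspace_vec_ideal, of ?T "range ?m" v 2] assms(2) vec_ideal_subst by auto
  have "{m \<in> range ?m. ?T m = fm_scale 2 m} \<subseteq> {0, ?m 1}"
  proof
    fix m assume "m \<in> {m \<in> range ?m. ?T m = fm_scale 2 m}"
    then obtain n where m: "m = ?m n" and "?T (?m n) = fm_scale 2 (?m n)" by blast
    then have "fm_scale (2 ^ n) (?m n) = fm_scale 2 (?m n)" by (simp only: T)
    then have "(2::'k) ^ n = 2 \<or> ?m n = 0" by (simp only: fm.scale_cancel_right)
    moreover have "n = 1" if "(2::'k) ^ n = 2"
    proof -
      have "(of_nat (2 ^ n) :: 'k) = of_nat (2 ^ 1)" using that by simp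
      then have "(2::nat) ^ n = 2 ^ 1" by (simp only: of_nat_eq_iff)
      then show ?thesis by (subst (asm) power_inject_exp) auto
    qed
    ultimately show "m \<in> {0, ?m 1}" using m by auto
  qed
  then have "u' \<in> fm.span {0, ?m 1}" using u'(1) fm.span_mono by blast
  then obtain d where "u' = fm_scale d (?m 1)" by (auto simp: fm.span_insert_0 fm.span_singleton)
  then show ?thesis using u'(2) that by simp
qed

text \<open>Maps to a rank one object separate vectors. If each component vanished after its
  generator was renamed to \<open>j\<close>, renaming back would make the component itself vanish
  identically, and with all components their sum \<open>v\<close>.\<close>

lemma vec_separated:
  assumes "finite X2" "v \<in> free_mod_on {} X2" "v \<notin> vec_ideal"
  obtains y where "y \<in> X2" "fm_subst fl_gen (\<lambda>z. if z = y then fm_gen j else 0) v \<notin> vec_ideal"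
proof -
  have "v \<in> vec_ideal" if *: "\<And>y. y \<in> X2 \<Longrightarrow> fm_subst fl_gen (\<lambda>z. if z = y then fm_gen j else 0) v \<in> vec_ideal"
  proof -
    have "fm_subst fl_gen (\<lambda>z. if z = y then fm_gen y else 0) v \<in> vec_ideal" if "y \<in> X2" for y
    proof -
      have "(\<lambda>z. fm_subst fl_gen (\<lambda>_. fm_gen y) (if z = y then fm_gen j else 0))
          = (\<lambda>z. if z = y then fm_gen y else (0 :: 'k free_mod))" by auto
      then show ?thesis
        using vec_ideal_subst[OF *[OF that], of fl_gen "\<lambda>_. fm_gen y"] by (simp add: fm_subst_comp)
    qed
    then have "(\<Sum>y\<in>X2. fm_subst fl_gen (\<lambda>z. if z = y then fm_gen y else 0) v) \<in> vec_ideal"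
      by (intro fm.subspace_sum subspace_vec_ideal)
    then show ?thesis using fm_components[OF assms(1,2)] by simp
  qed
  then show ?thesis using assms(3) that by blast
qed

end

section \<open>Automorphisms of the category preserve the rank one objects\<close>

text \<open>The domain is an explicit argument because a composite has to be extensional on its
  carriers.\<close>

definition hcomp ::
    "('k, 'l, 'v) lie_rep \<Rightarrow> ('m \<Rightarrow> 'n) \<times> ('w \<Rightarrow> 'x) \<Rightarrow> ('l \<Rightarrow> 'm) \<times> ('v \<Rightarrow> 'w) \<Rightarrow> ('l \<Rightarrow> 'n) \<times> ('v \<Rightarrow> 'x)" where
  "hcomp H h' h = (compose (lie_car H) (fst h') (fst h), compose (vec_car H) (snd h') (snd h))"

abbreviation "hid H \<equiv> (restrict id (lie_car H), restrict id (vec_car H))"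

lemma hcomp_simps [simp]:
  "x \<in> lie_car H \<Longrightarrow> fst (hcomp H h' h) x = fst h' (fst h x)"
  "v \<in> vec_car H \<Longrightarrow> snd (hcomp H h' h) v = snd h' (snd h v)"
  by (simp_all add: hcomp_def compose_eq)

lemma rep_hom_hcomp:
  fixes H1 :: "('k::field, 'l, 'v) lie_rep"
  assumes H: "is_lie_rep H1" and h: "h \<in> rep_hom H1 H2" "h' \<in> rep_hom H2 H3"
  shows "hcomp H1 h' h \<in> rep_hom H1 H3"
proof -
  have m: "module (ring_of_type_algebra :: 'k ring) (lie_sort H1)"
    "module (ring_of_type_algebra :: 'k ring) (vec_sort H1)"
    "\<And>x y. x \<in> lie_car H1 \<Longrightarrow> y \<in> lie_car H1 \<Longrightarrow>
       lie_bracket (lie_sort H1) x y \<in> lie_car H1"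
    "\<And>l v. l \<in> lie_car H1 \<Longrightarrow> v \<in> vec_car H1 \<Longrightarrow>
       action H1 l v \<in> vec_car H1"
  proof -
    note H' = H[unfolded is_lie_rep_def Let_def]
    note L' = H'[THEN conjunct1, unfolded is_lie_algebra_def]
    show "module (ring_of_type_algebra :: 'k ring) (lie_sort H1)" by (rule L'[THEN conjunct1])
    show "module (ring_of_type_algebra :: 'k ring) (vec_sort H1)" by (rule H'[THEN conjunct2, THEN conjunct1])
    show "lie_bracket (lie_sort H1) x y \<in> lie_car H1"
      if "x \<in> lie_car H1" "y \<in> lie_car H1" for x y
      using L'[THEN conjunct2, THEN conjunct1] that by blast
    show "action H1 l v \<in> vec_car H1"
      if "l \<in> lie_car H1" "v \<in> vec_car H1" for l v
      using H'[THEN conjunct2, THEN conjunct2, THEN conjunct1] that by blast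
  qed
  have K: "carrier (ring_of_type_algebra :: 'k ring) = UNIV" by (simp add: ring_of_type_algebra_def)
  obtain a b a' b' where *: "h = (a, b)" "h' = (a', b')" by fastforce
  have p: "a \<in> linear_maps (lie_sort H1) (lie_sort H2)" "a' \<in> linear_maps (lie_sort H2) (lie_sort H3)"
    "b \<in> linear_maps (vec_sort H1) (vec_sort H2)" "b' \<in> linear_maps (vec_sort H2) (vec_sort H3)"
    using h * by (simp_all add: rep_hom_def)
  have "compose (lie_car H1) a' a \<in> linear_maps (lie_sort H1) (lie_sort H3)"
    "compose (vec_car H1) b' b \<in> linear_maps (vec_sort H1) (vec_sort H3)"
    by (rule linear_maps_compose[OF p(1,2) m(1) K], rule linear_maps_compose[OF p(3,4) m(2) K])
  moreover have "fst (hcomp H1 h' h) (lie_bracket (lie_sort H1) x y)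
      = lie_bracket (lie_sort H3) (fst (hcomp H1 h' h) x) (fst (hcomp H1 h' h) y)"
    if "x \<in> lie_car H1" "y \<in> lie_car H1" for x y
    using that m(3) hom_simps[OF h(1)] hom_simps[OF h(2)] by simp
  moreover have "snd (hcomp H1 h' h) (action H1 x v) = action H3 (fst (hcomp H1 h' h) x) (snd (hcomp H1 h' h) v)"
    if "x \<in> lie_car H1" "v \<in> vec_car H1" for x v
    using that m(4) hom_simps[OF h(1)] hom_simps[OF h(2)] by simp
  ultimately show ?thesis by (auto simp: * hcomp_def rep_hom_def)
qed

section \<open>Rank one objects and their endomorphisms\<close>

context action_variety
begin

definition obs where "obs = {obj X1 X2 |X1 X2. finite X1 \<and> finite X2}"

lemma obj_in_obs [simp]: "finite X1 \<Longrightarrow> finite X2 \<Longrightarrow> obj X1 X2 \<in> obs"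
  by (auto simp: obs_def)

lemma obs_lie_rep: "A \<in> obs \<Longrightarrow> is_lie_rep A"
  by (auto simp: obs_def is_lie_rep_free_rep)

lemma Theta0_simps:
  "Ob (Theta0 \<Theta>) = obs"
  "(A, h, B) \<in> Arr (Theta0 \<Theta>) \<longleftrightarrow> A \<in> obs \<and> B \<in> obs \<and> h \<in> rep_hom A B"
  "Dom (Theta0 \<Theta>) (A, h, B) = A" "Cod (Theta0 \<Theta>) (A, h, B) = B"
  "Comp (Theta0 \<Theta>) (B, h', C) (A, h, B') = (A, hcomp A h' h, C)"
  by (auto simp: Theta0_def rep_category_def obs_def hcomp_def split: prod.split)

lemma Theta0_arrE:
  assumes "a \<in> Arr (Theta0 \<Theta>)"
  obtains A h B where "a = (A, h, B)" "A \<in> obs" "B \<in> obs" "h \<in> rep_hom A B"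
proof -
  obtain A h B where "a = (A, h, B)" by (rule prod_cases3)
  then show ?thesis using that assms by (simp add: Theta0_simps)
qed

lemma hcomp_in: "A \<in> obs \<Longrightarrow> h \<in> rep_hom A B \<Longrightarrow> h' \<in> rep_hom B C \<Longrightarrow> hcomp A h' h \<in> rep_hom A C"
  by (rule rep_hom_hcomp[OF obs_lie_rep])

text \<open>No zero divisors, with the zero endomorphism \<open>z\<close> characterised by composition alone.\<close>

definition irreducible_obj where
  "irreducible_obj A \<longleftrightarrow> (\<exists>h\<in>rep_hom A A. \<exists>h'\<in>rep_hom A A. h \<noteq> h') \<and>
    (\<forall>z\<in>rep_hom A A. \<forall>e\<in>rep_hom A A. \<forall>g\<in>rep_hom A A.
      (\<forall>a\<in>rep_hom A A. hcomp A a z = z \<and> hcomp A z a = z) \<longrightarrow> hcomp A e g = z \<longrightarrow> e = z \<or> g = z)"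

text \<open>The property speaks of composition of endomorphisms alone, so any bijection that
  respects composition transports it.\<close>

lemma irreducible_obj_iso:
  assumes t: "bij_betw t (rep_hom A A) (rep_hom B B)" and A: "A \<in> obs"
    and c: "\<And>a b. a \<in> rep_hom A A \<Longrightarrow> b \<in> rep_hom A A \<Longrightarrow> t (hcomp A a b) = hcomp B (t a) (t b)"
    and B: "irreducible_obj B"
  shows "irreducible_obj A"
proof -
  let ?A = "rep_hom A A" and ?B = "rep_hom B B"
  have inj: "a = b" if "t a = t b" "a \<in> ?A" "b \<in> ?A" for a b
    using t that by (auto simp: bij_betw_def inj_on_def)
  have surj: "\<exists>a\<in>?A. b = t a" if "b \<in> ?B" for b
    using t that by (auto simp: bij_betw_def)
  have mem: "t a \<in> ?B" if "a \<in> ?A" for a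
    using t that by (auto simp: bij_betw_def)
  show ?thesis unfolding irreducible_obj_def
  proof (intro conjI ballI impI)
    show "\<exists>h\<in>?A. \<exists>h'\<in>?A. h \<noteq> h'"
      using B surj unfolding irreducible_obj_def by metis
    fix z e g assume *: "z \<in> ?A" "e \<in> ?A" "g \<in> ?A" "\<forall>a\<in>?A. hcomp A a z = z \<and> hcomp A z a = z"
      "hcomp A e g = z"
    have "hcomp B b (t z) = t z \<and> hcomp B (t z) b = t z" if "b \<in> ?B" for b
    proof -
      obtain a where "a \<in> ?A" "b = t a" using surj \<open>b \<in> ?B\<close> by blast
      then show ?thesis using *(1,4) by (simp flip: c)
    qed
    moreover have "hcomp B (t e) (t g) = t z" using * by (simp flip: c)
    ultimately have "t e = t z \<or> t g = t z"
      using B mem * unfolding irreducible_obj_def by blast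
    then show "e = z \<or> g = z" using inj * by blast
  qed
qed

lemma singleton_gen_1:
  assumes "u \<in> lie_car (obj {i} X2)"
  obtains c where "u = {fl_scale c (fl_gen i)}"
proof -
  obtain w where w: "w \<in> free_lie_on {i}" "u = {w}" using assms by (auto simp: obj_lie_carrier)
  from w(1) obtain c where "w = fl_scale c (fl_gen i)" by (rule free_lie_on_singleton)
  then show ?thesis using that[of c] w(2) by simp
qed

lemma singleton_gen_2:
  assumes "v \<in> vec_car (obj {} {j})"
  obtains c where "v = vcls {} {j} (fm_scale c (fm_gen j))"
proof -
  obtain w where w: "w \<in> free_mod_on {} {j}" "v = vcls {} {j} w" using assms by (auto simp: obj_vec_carrier)
  from w(1) obtain c where "w = fm_scale c (fm_gen j)" by (rule free_mod_on_singleton)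
  then show ?thesis using that[of c] w(2) by simp
qed

lemma trivial_lie: "x \<in> lie_car (obj {} X2) \<Longrightarrow> x = {0}"
  using free_lie_on_empty by (auto simp: obj_lie_carrier)

lemma trivial_vec: "x \<in> vec_car (obj X1 {}) \<Longrightarrow> x = vcls X1 {} 0"
  using free_mod_on_empty by (auto simp: obj_vec_carrier)

lemma zero_carrier:
  "finite X1 \<Longrightarrow> {0} \<in> lie_car (obj X1 X2)" "vcls X1 X2 0 \<in> vec_car (obj X1 X2)"
  by (auto simp: obj_lie_carrier obj_vec_carrier lie_on_zero free_mod_on_closed)

lemma hom_zero:
  assumes X: "finite X1" "finite Y1" and h: "h \<in> rep_hom (obj X1 X2) (obj Y1 Y2)"
  shows "fst h {0} = {0}" "snd h (vcls X1 X2 0) = vcls Y1 Y2 0"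
proof -
  obtain \<sigma> \<tau> where s: "valid_subst X1 X2 Y1 Y2 \<sigma> \<tau>" "h = subst_hom X1 X2 Y1 Y2 \<sigma> \<tau>"
    using hom_subst_ex[OF X h] .
  show "fst h {0} = {0}" "snd h (vcls X1 X2 0) = vcls Y1 Y2 0"
    using subst_hom_simps[OF s(1)] X by (simp_all add: s lie_on_zero free_mod_on_closed)
qed

lemma lie_gen_neq: "{fl_gen x} \<noteq> {0 :: 'k free_lie}"
  by (simp add: fl_gen_nonzero)

lemma vec_gen_neq: "y \<in> X2 \<Longrightarrow> vcls X1 X2 (fm_gen y) \<noteq> vcls X1 X2 0"
  using fm_gen_notin by (simp add: vcls_eq_iff free_mod_on_gen free_mod_on_closed)

text \<open>This and the next three lemmas count homomorphisms from rank one objects: one or at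
  least two. The counts between rank one objects are symmetric in the two sorts, so they can tell
  whether two such objects have the same sort, but not which sort it is.\<close>

lemma homs_from_lie_distinct:
  assumes "finite Y1" "y \<in> Y1"
  shows "\<exists>h\<in>rep_hom (obj {i} {}) (obj Y1 Y2). \<exists>h'\<in>rep_hom (obj {i} {}) (obj Y1 Y2). h \<noteq> h'"
proof -
  obtain h where h: "h \<in> rep_hom (obj {i} {}) (obj Y1 Y2)" "fst h {fl_gen i} = {fl_gen y}"
    by (rule hom_ex[of "{i}" Y1 "\<lambda>_. {fl_gen y}" Y2 "{}"]) (use assms gen_carrier in auto)
  obtain h' where h': "h' \<in> rep_hom (obj {i} {}) (obj Y1 Y2)" "fst h' {fl_gen i} = {0}"
    by (rule hom_ex[of "{i}" Y1 "\<lambda>_. {0}" Y2 "{}"]) (use assms zero_carrier in auto)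
  have "h \<noteq> h'" using h(2) h'(2) lie_gen_neq by metis
  then show ?thesis using h(1) h'(1) by blast
qed

lemma homs_from_vec_distinct:
  assumes "finite Y1" "y \<in> Y2"
  shows "\<exists>h\<in>rep_hom (obj {} {j}) (obj Y1 Y2). \<exists>h'\<in>rep_hom (obj {} {j}) (obj Y1 Y2). h \<noteq> h'"
proof -
  obtain h where h: "h \<in> rep_hom (obj {} {j}) (obj Y1 Y2)"
    "snd h (vcls {} {j} (fm_gen j)) = vcls Y1 Y2 (fm_gen y)"
    by (rule hom_ex[of "{}" Y1 "\<lambda>_. {0}" Y2 "{j}" "\<lambda>_. vcls Y1 Y2 (fm_gen y)"]) (use assms gen_carrier in auto)
  obtain h' where h': "h' \<in> rep_hom (obj {} {j}) (obj Y1 Y2)"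
    "snd h' (vcls {} {j} (fm_gen j)) = vcls Y1 Y2 0"
    by (rule hom_ex[of "{}" Y1 "\<lambda>_. {0}" Y2 "{j}" "\<lambda>_. vcls Y1 Y2 0"]) (use assms zero_carrier in auto)
  have "h \<noteq> h'" using h(2) h'(2) vec_gen_neq[OF assms(2)] by metis
  then show ?thesis using h(1) h'(1) by blast
qed

lemma homs_lie_to_vec:
  assumes "h \<in> rep_hom (obj {i} {}) (obj {} Y2)" "h' \<in> rep_hom (obj {i} {}) (obj {} Y2)"
  shows "h = h'"
proof (rule hom_eqI[OF _ _ assms])
  show "fst h {fl_gen x} = fst h' {fl_gen x}" if "x \<in> {i}" for x
    using trivial_lie hom_simps(1)[OF assms(1) gen_carrier(1)] hom_simps(1)[OF assms(2) gen_carrier(1)] that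
    by (metis finite.emptyI finite_insert)
qed auto

lemma homs_vec_to_lie:
  assumes "finite Y1" "h \<in> rep_hom (obj {} {j}) (obj Y1 {})" "h' \<in> rep_hom (obj {} {j}) (obj Y1 {})"
  shows "h = h'"
proof (rule hom_eqI[OF _ _ assms(2,3)])
  show "snd h (vcls {} {j} (fm_gen y)) = snd h' (vcls {} {j} (fm_gen y))" if "y \<in> {j}" for y
    using trivial_vec hom_simps(2)[OF assms(2) gen_carrier(2)[OF that]]
      hom_simps(2)[OF assms(3) gen_carrier(2)[OF that]] by metis
qed (use assms in auto)

text \<open>The endomorphisms are the scalars, and they compose by multiplication in the field
  k.\<close>

lemma irreducible_lie: "irreducible_obj (obj {i} {})"
  unfolding irreducible_obj_def
proof (intro conjI ballI impI)
  let ?A = "obj {i} {}" and ?x = "{fl_gen i} :: 'k free_lie set"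
  show "\<exists>h\<in>rep_hom ?A ?A. \<exists>h'\<in>rep_hom ?A ?A. h \<noteq> h'"
    by (rule homs_from_lie_distinct) auto
  fix z e g assume h: "z \<in> rep_hom ?A ?A" "e \<in> rep_hom ?A ?A" "g \<in> rep_hom ?A ?A"
    and *: "\<forall>a\<in>rep_hom ?A ?A. hcomp ?A a z = z \<and> hcomp ?A z a = z" and eg: "hcomp ?A e g = z"
  have x: "?x \<in> lie_car ?A" by (rule gen_carrier) auto
  have eq: "h = h'" if "h \<in> rep_hom ?A ?A" "h' \<in> rep_hom ?A ?A" "fst h ?x = fst h' ?x" for h h'
    by (rule hom_eqI[OF _ _ that(1,2)]) (use that(3) in auto)
  \<comment> \<open>The condition on \<open>z\<close>, tested against the zero map, forces
    \<open>z\<close> itself to be the zero map.\<close>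
  obtain a where a: "a \<in> rep_hom ?A ?A" "fst a ?x = {0}"
    by (rule hom_ex[of "{i}" "{i}" "\<lambda>_. {0}" "{}" "{}"]) (use zero_carrier in auto)
  have "fst (hcomp ?A z a) ?x = {0}" using x a hom_zero(1)[OF _ _ h(1)] by simp
  then have z: "fst z ?x = {0}" using * a by metis
  have s: "fl_scale c (fl_gen i) \<in> free_lie_on {i}" for c :: 'k by (intro lie_on_scale lie_on_gen) auto
  obtain c where c: "fst e ?x = {fl_scale c (fl_gen i)}" using singleton_gen_1 hom_simps(1)[OF h(2) x] by blast
  obtain d where d: "fst g ?x = {fl_scale d (fl_gen i)}" using singleton_gen_1 hom_simps(1)[OF h(3) x] by blast
  have "fst e {fl_scale d (fl_gen i)} = {fl_scale d (fl_scale c (fl_gen i))}"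
    using hom_simps(4)[OF h(2) x, of d] s[of 1] s by (simp add: obj_lie_simps c)
  then have "{fl_scale d (fl_scale c (fl_gen i))} = {0}"
    using eg z x d by (metis hcomp_simps(1))
  then have "c = 0 \<or> d = 0" by (auto simp: fl_gen_nonzero)
  then show "e = z \<or> g = z" using eq[OF h(2,1)] eq[OF h(3,1)] c d z by auto
qed

lemma irreducible_vec: "irreducible_obj (obj {} {j})"
  unfolding irreducible_obj_def
proof (intro conjI ballI impI)
  let ?A = "obj {} {j}" and ?y = "vcls {} {j} (fm_gen j)"
  show "\<exists>h\<in>rep_hom ?A ?A. \<exists>h'\<in>rep_hom ?A ?A. h \<noteq> h'"
    by (rule homs_from_vec_distinct) auto
  fix z e g assume h: "z \<in> rep_hom ?A ?A" "e \<in> rep_hom ?A ?A" "g \<in> rep_hom ?A ?A"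
    and *: "\<forall>a\<in>rep_hom ?A ?A. hcomp ?A a z = z \<and> hcomp ?A z a = z" and eg: "hcomp ?A e g = z"
  have y: "?y \<in> vec_car ?A" by (rule gen_carrier) auto
  have eq: "h = h'" if "h \<in> rep_hom ?A ?A" "h' \<in> rep_hom ?A ?A" "snd h ?y = snd h' ?y" for h h'
    by (rule hom_eqI[OF _ _ that(1,2)]) (use that(3) in auto)
  obtain a where a: "a \<in> rep_hom ?A ?A" "snd a ?y = vcls {} {j} 0"
    by (rule hom_ex[of "{}" "{}" "\<lambda>_. {0}" "{j}" "{j}" "\<lambda>_. vcls {} {j} 0"]) (use zero_carrier in auto)
  have "snd (hcomp ?A z a) ?y = vcls {} {j} 0" using y a hom_zero(2)[OF _ _ h(1)] by simp
  then have z: "snd z ?y = vcls {} {j} 0" using * a by metis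
  have s: "fm_scale c (fm_gen j) \<in> free_mod_on {} {j}" for c :: 'k by (intro free_mod_on_scale free_mod_on_gen) auto
  obtain c where c: "snd e ?y = vcls {} {j} (fm_scale c (fm_gen j))"
    using singleton_gen_2 hom_simps(2)[OF h(2) y] by blast
  obtain d where d: "snd g ?y = vcls {} {j} (fm_scale d (fm_gen j))"
    using singleton_gen_2 hom_simps(2)[OF h(3) y] by blast
  have "snd e (vcls {} {j} (fm_scale d (fm_gen j))) = vcls {} {j} (fm_scale d (fm_scale c (fm_gen j)))"
    using hom_simps(7)[OF h(2) y, of d] s[of 1] s by (simp only: obj_vec_simps c fm_scale_simps(4))
  then have "vcls {} {j} (fm_scale d (fm_scale c (fm_gen j))) = vcls {} {j} 0"
    using eg z y d by (metis hcomp_simps(2))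
  then have "fm_scale d (fm_scale c (fm_gen j)) \<in> vec_ideal"
    using s free_mod_on_closed(1) by (subst (asm) vcls_eq_iff) (auto simp: free_mod_on_scale)
  then have "c = 0 \<or> d = 0" using vec_ideal_scale_iff fm_gen_notin by metis
  then show "e = z \<or> g = z" using eq[OF h(2,1)] eq[OF h(3,1)] c d z by auto
qed

text \<open>\<open>\<rho> S1 S2\<close> keeps the generators in \<open>S1\<close> and
  \<open>S2\<close> and kills the others. Two such projections with disjoint supports compose to
  zero, so splitting off one of several generators produces zero divisors. An object without
  generators has only one endomorphism.\<close>

lemma irreducible_rank_one:
  assumes X: "finite X1" "finite X2" and irr: "irreducible_obj (obj X1 X2)"
  obtains i where "X1 = {i}" "X2 = {}" | j where "X1 = {}" "X2 = {j}"
proof -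
  let ?A = "obj X1 X2"
  define \<rho> where "\<rho> S1 S2 = subst_hom X1 X2 X1 X2 (\<lambda>x. if x \<in> S1 then fl_gen x else 0)
    (\<lambda>y. if y \<in> S2 then fm_gen y else 0)" for S1 S2
  have v: "valid_subst X1 X2 X1 X2 (\<lambda>x. if x \<in> S1 then fl_gen x else 0) (\<lambda>y. if y \<in> S2 then fm_gen y else 0)"
    for S1 S2
    by (auto simp: valid_subst_def lie_on_gen lie_on_zero free_mod_on_gen free_mod_on_closed)
  have \<rho>: "\<rho> S1 S2 \<in> rep_hom ?A ?A" for S1 S2
    unfolding \<rho>_def using X v by (intro subst_hom_in_hom)
  have g1: "fst (\<rho> S1 S2) {fl_gen x} = {if x \<in> S1 then fl_gen x else 0}" if "x \<in> X1" for S1 S2 x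
    unfolding \<rho>_def using that X by (simp add: subst_hom_simps[OF v] lie_on_gen)
  have g2: "snd (\<rho> S1 S2) (vcls X1 X2 (fm_gen y)) = vcls X1 X2 (if y \<in> S2 then fm_gen y else 0)"
    if "y \<in> X2" for S1 S2 y
    unfolding \<rho>_def using that by (simp add: subst_hom_simps[OF v] free_mod_on_gen)
  note c1 = gen_carrier(1)[OF X(1)] and c2 = gen_carrier(2)
  note h0 = hom_zero[OF X(1) X(1)]
  have v0: "valid_subst X1 X2 X1 X2 (\<lambda>_. 0) (\<lambda>_. 0)"
    by (auto simp: valid_subst_def lie_on_zero free_mod_on_closed)
  have \<rho>0: "\<rho> {} {} = subst_hom X1 X2 X1 X2 (\<lambda>_. 0) (\<lambda>_. 0)" by (simp add: \<rho>_def)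
  have zero: "hcomp ?A a (\<rho> {} {}) = \<rho> {} {} \<and> hcomp ?A (\<rho> {} {}) a = \<rho> {} {}" if a: "a \<in> rep_hom ?A ?A" for a
  proof
    show "hcomp ?A a (\<rho> {} {}) = \<rho> {} {}"
      by (rule hom_eqI[OF X(1) X(1) hcomp_in[OF _ \<rho> a] \<rho>]) (use X c1 c2 a h0[OF a] in \<open>simp_all add: g1 g2\<close>)
    show "hcomp ?A (\<rho> {} {}) a = \<rho> {} {}"
    proof (rule hom_eqI[OF X(1) X(1) hcomp_in[OF _ a \<rho>] \<rho>])
      fix x assume x: "x \<in> X1"
      obtain u where "u \<in> free_lie_on X1" "fst a {fl_gen x} = {u}"
        using hom_simps(1)[OF a c1[OF x]] X by (auto simp: obj_lie_carrier)
      then have "fst (\<rho> {} {}) (fst a {fl_gen x}) = {0}"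
        using X by (simp add: \<rho>0 subst_hom_simps[OF v0] fl_subst_zero)
      then show "fst (hcomp ?A (\<rho> {} {}) a) {fl_gen x} = fst (\<rho> {} {}) {fl_gen x}"
        using x c1 by (simp add: g1)
    next
      fix y assume y: "y \<in> X2"
      obtain u where "u \<in> free_mod_on X1 X2" "snd a (vcls X1 X2 (fm_gen y)) = vcls X1 X2 u"
        using hom_simps(2)[OF a c2[OF y]] by (auto simp: obj_vec_carrier)
      then have "snd (\<rho> {} {}) (snd a (vcls X1 X2 (fm_gen y))) = vcls X1 X2 0"
        using X by (simp add: \<rho>0 subst_hom_simps[OF v0] fm_subst_zero)
      then show "snd (hcomp ?A (\<rho> {} {}) a) (vcls X1 X2 (fm_gen y)) = snd (\<rho> {} {}) (vcls X1 X2 (fm_gen y))"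
        using y c2[OF y] by (simp add: g2)
    qed (use X in auto)
  qed
  have disj: "hcomp ?A (\<rho> S1 S2) (\<rho> T1 T2) = \<rho> {} {}" if "S1 \<inter> T1 = {}" "S2 \<inter> T2 = {}" for S1 S2 T1 T2
  proof (rule hom_eqI[OF X(1) X(1) hcomp_in[OF _ \<rho> \<rho>] \<rho>])
    show "fst (hcomp ?A (\<rho> S1 S2) (\<rho> T1 T2)) {fl_gen x} = fst (\<rho> {} {}) {fl_gen x}" if "x \<in> X1" for x
      using that c1 h0(1)[OF \<rho>] \<open>S1 \<inter> T1 = {}\<close> by (auto simp: g1)
    show "snd (hcomp ?A (\<rho> S1 S2) (\<rho> T1 T2)) (vcls X1 X2 (fm_gen y)) = snd (\<rho> {} {}) (vcls X1 X2 (fm_gen y))"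
      if "y \<in> X2" for y
      using that c2[OF that] h0(2)[OF \<rho>] \<open>S2 \<inter> T2 = {}\<close> by (cases "y \<in> T2") (auto simp: g2)
  qed (use X in auto)
  have nz: "S1 \<inter> X1 = {}" "S2 \<inter> X2 = {}" if "\<rho> S1 S2 = \<rho> {} {}" for S1 S2
  proof -
    show "S1 \<inter> X1 = {}"
    proof (rule ccontr)
      assume "S1 \<inter> X1 \<noteq> {}"
      then obtain x where "x \<in> S1" "x \<in> X1" by auto
      then show False using g1[of x S1 S2] g1[of x "{}" "{}"] that by (simp add: fl_gen_nonzero)
    qed
    show "S2 \<inter> X2 = {}"
    proof (rule ccontr)
      assume "S2 \<inter> X2 \<noteq> {}"
      then obtain y where "y \<in> S2" "y \<in> X2" by auto
      then show False using g2[of y S1 S2] g2[of y "{}" "{}"] that vec_gen_neq[of y X2 X1]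
        by (simp)
    qed
  qed
  have split: "S1 \<inter> X1 = {} \<and> S2 \<inter> X2 = {} \<or> T1 \<inter> X1 = {} \<and> T2 \<inter> X2 = {}"
    if "S1 \<inter> T1 = {}" "S2 \<inter> T2 = {}" for S1 S2 T1 T2
    using irr disj[OF that] zero \<rho> nz[of S1 S2] nz[of T1 T2] unfolding irreducible_obj_def by blast
  show ?thesis
  proof (cases "X1 = {}")
    case False
    then obtain i where i: "i \<in> X1" by auto
    have "(X1 - {i}) \<inter> X1 = {} \<and> X2 \<inter> X2 = {}"
      using split[of "{i}" "X1 - {i}" "{}" X2] i by auto
    then have "X1 = {i} \<and> X2 = {}" using i by auto
    then show ?thesis using that(1) by blast
  next
    case True
    show ?thesis
    proof (cases "X2 = {}")
      case False
      then obtain j where j: "j \<in> X2" by auto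
      have "(X2 - {j}) \<inter> X2 = {}"
        using split[of "{}" "{}" "{j}" "X2 - {j}"] j by auto
      then have "X2 = {j}" using j by auto
      then show ?thesis using that(2) True by blast
    next
      case False': True
      have "h = h'" if "h \<in> rep_hom ?A ?A" "h' \<in> rep_hom ?A ?A" for h h'
        by (rule hom_eqI[OF X(1) X(1) that]) (use True False' in auto)
      then show ?thesis using irr unfolding irreducible_obj_def by blast
    qed
  qed
qed

lemma irreducible_obs:
  assumes "irreducible_obj A" "A \<in> obs"
  obtains i where "A = obj {i} {}" | j where "A = obj {} {j}"
proof -
  obtain X1 X2 where A: "finite X1" "finite X2" "A = obj X1 X2" using assms(2) by (auto simp: obs_def)
  show ?thesis
    by (rule irreducible_rank_one[OF A(1,2) assms(1)[unfolded A(3)]]) (use A(3) that in auto)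
qed

end

section \<open>The effect of an automorphism on objects and arrows\<close>

locale theta_automorphism = action_variety \<Theta>
  for \<Theta> :: "('k::field_char_0, 'l, 'v) lie_rep set" +
  fixes F and f
  assumes aut: "(F, f) \<in> cat_automorphisms (Theta0 \<Theta>)"
begin

text \<open>Arrows carry their domain and codomain; this is the effect on the homomorphism
  alone.\<close>

definition fmap where "fmap A B h = fst (snd (f (A, h, B)))"

lemma F_bij: "bij_betw F obs obs"
  using aut by (auto simp: cat_automorphisms_def Theta0_simps Bij_def)

lemma F_obs [simp]: "A \<in> obs \<Longrightarrow> F A \<in> obs"
  using F_bij by (auto simp: bij_betw_def)

lemma F_surj:
  assumes "B \<in> obs"
  obtains A where "A \<in> obs" "B = F A"
  using F_bij assms that by (auto simp: bij_betw_def)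

lemma f_eq:
  assumes "A \<in> obs" "B \<in> obs" "h \<in> rep_hom A B"
  shows "f (A, h, B) = (F A, fmap A B h, F B)" "fmap A B h \<in> rep_hom (F A) (F B)"
proof -
  have a: "(A, h, B) \<in> Arr (Theta0 \<Theta>)" using assms by (simp add: Theta0_simps)
  obtain A' h' B' where *: "f (A, h, B) = (A', h', B')" by (cases "f (A, h, B)") auto
  have "f (A, h, B) \<in> Arr (Theta0 \<Theta>)" "Dom (Theta0 \<Theta>) (f (A, h, B)) = F A" "Cod (Theta0 \<Theta>) (f (A, h, B)) = F B"
    using aut a by (auto simp: cat_automorphisms_def Bij_def bij_betw_def Theta0_simps)
  then show "f (A, h, B) = (F A, fmap A B h, F B)" "fmap A B h \<in> rep_hom (F A) (F B)"
    by (auto simp: * Theta0_simps fmap_def)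
qed

lemma fmap_bij:
  assumes A: "A \<in> obs" and B: "B \<in> obs"
  shows "bij_betw (fmap A B) (rep_hom A B) (rep_hom (F A) (F B))"
  unfolding bij_betw_def
proof
  have fb: "bij_betw f (Arr (Theta0 \<Theta>)) (Arr (Theta0 \<Theta>))"
    using aut by (auto simp: cat_automorphisms_def Bij_def)
  show "inj_on (fmap A B) (rep_hom A B)"
  proof (rule inj_onI)
    fix h h' assume h: "h \<in> rep_hom A B" "h' \<in> rep_hom A B" "fmap A B h = fmap A B h'"
    then have "f (A, h, B) = f (A, h', B)" using f_eq[OF A B] by simp
    then have "(A, h, B) = (A, h', B)"
      by (rule inj_onD[OF bij_betw_imp_inj_on[OF fb]]) (use h A B in \<open>simp_all add: Theta0_simps\<close>)
    then show "h = h'" by simp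
  qed
  show "fmap A B ` rep_hom A B = rep_hom (F A) (F B)"
  proof
    show "fmap A B ` rep_hom A B \<subseteq> rep_hom (F A) (F B)" using f_eq[OF A B] by auto
    show "rep_hom (F A) (F B) \<subseteq> fmap A B ` rep_hom A B"
    proof
      fix k assume "k \<in> rep_hom (F A) (F B)"
      then have "(F A, k, F B) \<in> f ` Arr (Theta0 \<Theta>)" using A B fb by (auto simp: bij_betw_def Theta0_simps)
      then obtain A' h B' where a: "(A', h, B') \<in> Arr (Theta0 \<Theta>)" "(F A, k, F B) = f (A', h, B')" by auto
      then have *: "A' \<in> obs" "B' \<in> obs" "h \<in> rep_hom A' B'" by (auto simp: Theta0_simps)
      then have "F A = F A'" "F B = F B'" "k = fmap A' B' h" using a(2) f_eq[OF *] by auto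
      moreover then have "A = A'" "B = B'" using A B * F_bij by (auto simp: bij_betw_def inj_on_def)
      ultimately show "k \<in> fmap A B ` rep_hom A B" using * by auto
    qed
  qed
qed

lemma fmap_surj:
  assumes "A \<in> obs" "B \<in> obs" "k \<in> rep_hom (F A) (F B)"
  obtains h where "h \<in> rep_hom A B" "k = fmap A B h"
  using fmap_bij[OF assms(1,2)] assms(3) that unfolding bij_betw_def by blast

lemma fmap_comp:
  assumes "A \<in> obs" "B \<in> obs" "C \<in> obs" "h \<in> rep_hom A B" "h' \<in> rep_hom B C"
  shows "fmap A C (hcomp A h' h) = hcomp (F A) (fmap B C h') (fmap A B h)"
proof -
  have "f (Comp (Theta0 \<Theta>) (B, h', C) (A, h, B)) = Comp (Theta0 \<Theta>) (f (B, h', C)) (f (A, h, B))"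
    using aut assms unfolding cat_automorphisms_def mem_Collect_eq prod.case
    by (elim conjE) (rotate_tac -1, drule bspec[of _ _ "(A, h, B)"], simp add: Theta0_simps,
      drule bspec[of _ _ "(B, h', C)"], simp_all add: Theta0_simps)
  then show ?thesis
    using f_eq(1)[OF assms(1,3) hcomp_in[OF assms(1,4,5)]] f_eq(1)[OF assms(1,2,4)] f_eq(1)[OF assms(2,3,5)]
    by (simp add: Theta0_simps)
qed

lemma fmap_distinct:
  assumes "A \<in> obs" "B \<in> obs" "h \<in> rep_hom A B" "h' \<in> rep_hom A B" "h \<noteq> h'"
  shows "fmap A B h \<noteq> fmap A B h'"
  using fmap_bij[OF assms(1,2)] assms by (auto simp: bij_betw_def inj_on_def)

lemma irreducible_obj_F:
  assumes A: "A \<in> obs"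
  shows "irreducible_obj (F A) \<longleftrightarrow> irreducible_obj A"
proof
  note b = fmap_bij[OF A A]
  let ?t = "inv_into (rep_hom A A) (fmap A A)"
  show "irreducible_obj (F A) \<Longrightarrow> irreducible_obj A"
    by (rule irreducible_obj_iso[OF b A]) (auto simp: fmap_comp[OF A A A])
  have "?t (hcomp (F A) a b) = hcomp A (?t a) (?t b)"
    if ab: "a \<in> rep_hom (F A) (F A)" "b \<in> rep_hom (F A) (F A)" for a b
  proof -
    obtain a' where a': "a' \<in> rep_hom A A" "a = fmap A A a'" using fmap_surj[OF A A ab(1)] .
    obtain b' where b': "b' \<in> rep_hom A A" "b = fmap A A b'" using fmap_surj[OF A A ab(2)] .
    note * = a' b'
    then have "hcomp (F A) a b = fmap A A (hcomp A a' b')" by (simp add: fmap_comp[OF A A A])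
    moreover have "inj_on (fmap A A) (rep_hom A A)" using b by (simp add: bij_betw_def)
    ultimately show ?thesis using * A by (simp add: inv_into_f_f hcomp_in)
  qed
  then show "irreducible_obj A \<Longrightarrow> irreducible_obj (F A)"
    by (intro irreducible_obj_iso[OF bij_betw_inv_into[OF b] F_obs[OF A]])
qed

lemma F_irreducible:
  assumes A: "A \<in> obs" "irreducible_obj A"
  obtains i where "F A = obj {i} {}" | j where "F A = obj {} {j}"
proof -
  have "irreducible_obj (F A)" "F A \<in> obs" using A by (simp_all add: irreducible_obj_F)
  then show ?thesis by (rule irreducible_obs) (rule that, assumption)+
qed

text \<open>The bracket breaks the symmetry between the sorts. The two maps \<open>a\<close> and
  \<open>a'\<close> send the generator to the bracket of two generators and to 0; they differ, but
  agree after any map back to the rank one Lie object. If the image of this object had sort 2, the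
  images of \<open>a\<close> and \<open>a'\<close> would be two vectors that no map to a rank one
  object of sort 2 separates.\<close>

lemma F_lie: obtains i where "F (obj {0} {}) = obj {i} {}"
proof -
  let ?L = "obj {0} {}" and ?H = "obj {0, 1} {}"
  let ?b = "fl_bracket (fl_gen 0) (fl_gen 1) :: 'k free_lie"
  have "False" if j: "F ?L = obj {} {j}" for j
  proof -
    have bm: "?b \<in> free_lie_on {0, 1}" by (intro lie_on_bracket lie_on_gen) auto
    obtain a where a: "a \<in> rep_hom ?L ?H" "fst a {fl_gen 0} = {?b}"
      by (rule hom_ex[of "{0}" "{0,1}" "\<lambda>_. {?b}" "{}" "{}"]) (use bm in \<open>auto simp: obj_lie_carrier\<close>)
    obtain a' where a': "a' \<in> rep_hom ?L ?H" "fst a' {fl_gen 0} = {0}"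
      by (rule hom_ex[of "{0}" "{0,1}" "\<lambda>_. {0}" "{}" "{}"]) (use zero_carrier in auto)
    have ne: "a \<noteq> a'" using a a' bracket_nonzero by auto
    have kill: "hcomp ?L g a = hcomp ?L g a'" if g: "g \<in> rep_hom ?H ?L" for g
    proof (rule hom_eqI[OF _ _ hcomp_in[OF _ a(1) g] hcomp_in[OF _ a'(1) g]])
      have c: "{fl_gen 0} \<in> lie_car ?H" "{fl_gen 1} \<in> lie_car ?H"
        by (rule gen_carrier; simp)+
      obtain c d where cd: "fst g {fl_gen 0} = {fl_scale c (fl_gen 0)}" "fst g {fl_gen 1} = {fl_scale d (fl_gen 0)}"
        using singleton_gen_1 hom_simps(1)[OF g c(1)] hom_simps(1)[OF g c(2)] by metis
      have s: "fl_scale c (fl_gen 0) \<in> free_lie_on {0}" for c :: 'k by (intro lie_on_scale lie_on_gen) auto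
      have "lie_bracket (lie_sort ?H) {fl_gen 0} {fl_gen 1} = {?b}"
        by (subst obj_lie_simps) (auto intro: lie_on_gen)
      moreover have "lie_bracket (lie_sort ?L) {fl_scale c (fl_gen 0)} {fl_scale d (fl_gen 0)} = {0}"
        by (subst obj_lie_simps) (auto simp: s fl_simps(8,9,10))
      ultimately have "fst g {?b} = {0}" using hom_simps(5)[OF g c] cd by simp
      then show "fst (hcomp ?L g a) {fl_gen x} = fst (hcomp ?L g a') {fl_gen x}" if "x \<in> {0}" for x
        using that a a' gen_carrier(1)[of "{0}" 0 "{}"] hom_zero(1)[OF _ _ g] by simp
    qed auto
    obtain Y1 Y2 where Y: "finite Y1" "finite Y2" "F ?H = obj Y1 Y2"
      using F_obs[of ?H] by (auto simp: obs_def)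
    let ?a = "fmap ?L ?H a" and ?a' = "fmap ?L ?H a'" and ?y = "vcls {} {j} (fm_gen j)"
    have A: "?a \<in> rep_hom (obj {} {j}) (obj Y1 Y2)" "?a' \<in> rep_hom (obj {} {j}) (obj Y1 Y2)" "?a \<noteq> ?a'"
      using f_eq(2)[of ?L ?H] a(1) a'(1) j Y ne fmap_distinct[of ?L ?H a a'] by auto
    have kill': "hcomp (obj {} {j}) g ?a = hcomp (obj {} {j}) g ?a'"
      if g: "g \<in> rep_hom (obj Y1 Y2) (obj {} {j})" for g
    proof -
      obtain g' where g': "g' \<in> rep_hom ?H ?L" "g = fmap ?H ?L g'"
        using fmap_surj[of ?H ?L g] g j Y by auto
      then show ?thesis using fmap_comp[of ?L ?H ?L a g'] fmap_comp[of ?L ?H ?L a' g'] a a' kill j by simp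
    qed
    \<comment> \<open>An object without Lie generators is a vector space, where
      \<open>vec_separated\<close> yields a map that tells the images of \<open>a\<close> and
      \<open>a'\<close> apart.\<close>
    have "Y1 \<noteq> {}"
    proof
      assume Y1: "Y1 = {}"
      have y: "?y \<in> vec_car (obj {} {j})" by (rule gen_carrier) simp
      obtain v where v: "v \<in> free_mod_on {} Y2" "snd ?a ?y = vcls {} Y2 v"
        using hom_simps(2)[OF A(1) y] Y1 by (auto simp: obj_vec_carrier)
      obtain v' where v': "v' \<in> free_mod_on {} Y2" "snd ?a' ?y = vcls {} Y2 v'"
        using hom_simps(2)[OF A(2) y] Y1 by (auto simp: obj_vec_carrier)
      have "snd ?a ?y \<noteq> snd ?a' ?y"
        using hom_eqI[OF _ _ A(1,2)] A(3) Y by fastforce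
      then have "v - v' \<notin> vec_ideal" using v v' vcls_eq_iff[of v "{}" Y2 v'] by simp
      then obtain y where "y \<in> Y2" and n: "fm_subst fl_gen (\<lambda>z. if z = y then fm_gen j else 0) (v - v') \<notin> vec_ideal"
        using vec_separated[OF Y(2), of "v - v'" j] v v' free_mod_on_diff by blast
      let ?\<tau> = "\<lambda>z. if z = y then fm_gen j else (0 :: 'k free_mod)"
      have val: "valid_subst {} Y2 {} {j} fl_gen ?\<tau>"
        by (auto simp: valid_subst_def free_mod_on_gen free_mod_on_closed)
      let ?g = "subst_hom {} Y2 {} {j} fl_gen ?\<tau>"
      have g: "?g \<in> rep_hom (obj Y1 Y2) (obj {} {j})" unfolding Y1 by (rule subst_hom_in_hom[OF _ _ val]) auto
      have "snd ?g (vcls {} Y2 v) = snd ?g (vcls {} Y2 v')"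
        using arg_cong[OF kill'[OF g], of "\<lambda>h. snd h ?y"] v v' by (simp add: hcomp_simps(2)[OF y])
      then have "vcls {} {j} (fm_subst fl_gen ?\<tau> v) = vcls {} {j} (fm_subst fl_gen ?\<tau> v')"
        using subst_hom_simps(2)[OF val] v v' by simp
      then have "fm_subst fl_gen ?\<tau> v - fm_subst fl_gen ?\<tau> v' \<in> vec_ideal"
        using valid_substD(2)[OF val] v v' by (subst (asm) vcls_eq_iff) auto
      moreover have "fm_subst fl_gen ?\<tau> (v - v') = fm_subst fl_gen ?\<tau> v - fm_subst fl_gen ?\<tau> v'"
        using fm_subst_add[of fl_gen ?\<tau> "v - v'" v'] by (simp del: fm_subst_add)
      ultimately show False using n by simp
    qed
    then obtain y where "y \<in> Y1" by auto
    then obtain h h' where h: "h \<in> rep_hom (obj {0} {}) (obj Y1 Y2)" "h' \<in> rep_hom (obj {0} {}) (obj Y1 Y2)" "h \<noteq> h'"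
      using homs_from_lie_distinct[OF Y(1)] by blast
    \<comment> \<open>\<open>B\<close> is the preimage of the rank one Lie object and has rank one
      itself. If it is of sort 1, two maps from \<open>B\<close> to \<open>?L\<close> would have
      distinct images in a set of homomorphisms with one element. If it is of sort 2, the distinct
      maps \<open>h\<close> and \<open>h'\<close> would come from the only map from \<open>B\<close>
      to \<open>?H\<close>.\<close>
    obtain B where B: "B \<in> obs" "obj {0} {} = F B" using F_surj[of "obj {0} {}"] by auto
    have "irreducible_obj B" using irreducible_obj_F[OF B(1)] irreducible_lie[of 0] B(2) by simp
    then consider i' where "B = obj {i'} {}" | j' where "B = obj {} {j'}"
      by (rule irreducible_obs[OF _ B(1)])
    then show False
    proof cases
      case 1
      obtain r r' where r: "r \<in> rep_hom B ?L" "r' \<in> rep_hom B ?L" "r \<noteq> r'"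
        unfolding 1 using homs_from_lie_distinct[of "{0}" 0 i' "{}"] by blast
      have "fmap B ?L r \<in> rep_hom (F B) (F ?L)" "fmap B ?L r' \<in> rep_hom (F B) (F ?L)"
        using f_eq(2)[OF B(1), of ?L] r by auto
      then have "fmap B ?L r = fmap B ?L r'" unfolding j B(2)[symmetric] by (rule homs_lie_to_vec)
      then show False using fmap_distinct[OF B(1), of ?L r r'] r by simp
    next
      case 2
      obtain k k' where k: "k \<in> rep_hom B ?H" "k' \<in> rep_hom B ?H" "h = fmap B ?H k" "h' = fmap B ?H k'"
        using fmap_surj[OF B(1), of ?H h] fmap_surj[OF B(1), of ?H h'] h B(2) Y(3)
        by (metis finite.emptyI finite_insert obj_in_obs)
      then have "k = k'" unfolding 2 by (intro homs_vec_to_lie[of "{0,1}"]) auto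
      then show False using k h(3) by simp
    qed
  qed
  then show ?thesis using F_irreducible[of ?L] irreducible_lie that by auto
qed

text \<open>Once the Lie object is located, counting suffices: there is one map from the Lie object
  to the object of sort 2, but there would be several between their images if both were of sort
  1.\<close>

lemma F_vec: obtains j where "F (obj {} {0}) = obj {} {j}"
proof -
  let ?L = "obj {0} {}" and ?V = "obj {} {0}"
  have "False" if i: "F ?V = obj {i} {}" for i
  proof -
    obtain l where l: "F ?L = obj {l} {}" by (rule F_lie)
    obtain h h' where h: "h \<in> rep_hom (F ?L) (F ?V)" "h' \<in> rep_hom (F ?L) (F ?V)" "h \<noteq> h'"
      unfolding l i using homs_from_lie_distinct[of "{i}" i l "{}"] by blast
    obtain k k' where k: "k \<in> rep_hom ?L ?V" "k' \<in> rep_hom ?L ?V" "h = fmap ?L ?V k" "h' = fmap ?L ?V k'"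
      using fmap_surj[of ?L ?V h] fmap_surj[of ?L ?V h'] h by (metis finite.emptyI finite_insert obj_in_obs)
    then show False using homs_lie_to_vec[of k 0 "{0}" k'] h(3) by simp
  qed
  then show ?thesis using F_irreducible[of ?V] irreducible_vec that by auto
qed

end

section \<open>The semilinear isomorphisms attached to an automorphism\<close>

context action_variety
begin

lemma obs_lie_rules:
  assumes "A \<in> obs" "a \<in> lie_car A" "b \<in> lie_car A"
  shows "a \<oplus>\<^bsub>lie_sort A\<^esub> b \<in> lie_car A" "c \<odot>\<^bsub>lie_sort A\<^esub> a \<in> lie_car A"
    "lie_bracket (lie_sort A) a b \<in> lie_car A"
    "c \<odot>\<^bsub>lie_sort A\<^esub> (a \<oplus>\<^bsub>lie_sort A\<^esub> b) = c \<odot>\<^bsub>lie_sort A\<^esub> a \<oplus>\<^bsub>lie_sort A\<^esub> c \<odot>\<^bsub>lie_sort A\<^esub> b"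
    "(c + d) \<odot>\<^bsub>lie_sort A\<^esub> a = c \<odot>\<^bsub>lie_sort A\<^esub> a \<oplus>\<^bsub>lie_sort A\<^esub> d \<odot>\<^bsub>lie_sort A\<^esub> a"
    "c \<odot>\<^bsub>lie_sort A\<^esub> (d \<odot>\<^bsub>lie_sort A\<^esub> a) = (c * d) \<odot>\<^bsub>lie_sort A\<^esub> a"
    "1 \<odot>\<^bsub>lie_sort A\<^esub> a = a" "0 \<odot>\<^bsub>lie_sort A\<^esub> a = {0}" "{0} \<oplus>\<^bsub>lie_sort A\<^esub> a = a" "a \<oplus>\<^bsub>lie_sort A\<^esub> {0} = a"
    "lie_bracket (lie_sort A) (c \<odot>\<^bsub>lie_sort A\<^esub> a) b = c \<odot>\<^bsub>lie_sort A\<^esub> lie_bracket (lie_sort A) a b"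
    "lie_bracket (lie_sort A) a (c \<odot>\<^bsub>lie_sort A\<^esub> b) = c \<odot>\<^bsub>lie_sort A\<^esub> lie_bracket (lie_sort A) a b"
  using assms by (auto simp: obs_def obj_lie_carrier obj_lie_simps free_lie_on.intros fl_simps(1,2,8,9))

text \<open>The zero class depends on the generators of the object, so zero is written as
  \<open>0\<close> times a vector.\<close>

lemma obs_vec_rules:
  assumes "A \<in> obs" "v \<in> vec_car A" "w \<in> vec_car A"
  shows "v \<oplus>\<^bsub>vec_sort A\<^esub> w \<in> vec_car A" "c \<odot>\<^bsub>vec_sort A\<^esub> v \<in> vec_car A"
    "c \<odot>\<^bsub>vec_sort A\<^esub> (v \<oplus>\<^bsub>vec_sort A\<^esub> w) = c \<odot>\<^bsub>vec_sort A\<^esub> v \<oplus>\<^bsub>vec_sort A\<^esub> c \<odot>\<^bsub>vec_sort A\<^esub> w"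
    "(c + d) \<odot>\<^bsub>vec_sort A\<^esub> v = c \<odot>\<^bsub>vec_sort A\<^esub> v \<oplus>\<^bsub>vec_sort A\<^esub> d \<odot>\<^bsub>vec_sort A\<^esub> v"
    "c \<odot>\<^bsub>vec_sort A\<^esub> (d \<odot>\<^bsub>vec_sort A\<^esub> v) = (c * d) \<odot>\<^bsub>vec_sort A\<^esub> v"
    "1 \<odot>\<^bsub>vec_sort A\<^esub> v = v" "0 \<odot>\<^bsub>vec_sort A\<^esub> v \<oplus>\<^bsub>vec_sort A\<^esub> w = w" "w \<oplus>\<^bsub>vec_sort A\<^esub> 0 \<odot>\<^bsub>vec_sort A\<^esub> v = w"
  using assms
  by (auto simp: obs_def obj_vec_carrier obj_vec_simps free_mod_on_closed(1,2) free_mod_on_scale fm_scale_simps)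

lemma obs_action_rules:
  assumes "A \<in> obs" "l \<in> lie_car A" "m \<in> lie_car A" "v \<in> vec_car A"
  shows "action A l v \<in> vec_car A"
    "action A (c \<odot>\<^bsub>lie_sort A\<^esub> l) v = c \<odot>\<^bsub>vec_sort A\<^esub> action A l v"
    "action A l (c \<odot>\<^bsub>vec_sort A\<^esub> v) = c \<odot>\<^bsub>vec_sort A\<^esub> action A l v"
    "action A (lie_bracket (lie_sort A) l m) v \<oplus>\<^bsub>vec_sort A\<^esub> action A m (action A l v) = action A l (action A m v)"
proof -
  obtain X1 X2 where A: "finite X1" "A = obj X1 X2" using assms(1) by (auto simp: obs_def)
  obtain u where u: "u \<in> free_lie_on X1" "l = {u}" using assms A by (auto simp: obj_lie_carrier)
  obtain w where w: "w \<in> free_lie_on X1" "m = {w}" using assms A by (auto simp: obj_lie_carrier)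
  obtain v' where v: "v' \<in> free_mod_on X1 X2" "v = vcls X1 X2 v'" using assms A by (auto simp: obj_vec_carrier)
  note [simp] = A u v w obj_vec_carrier obj_vec_simps free_mod_on_closed(1,2) free_mod_on_scale obj_lie_simps
    free_lie_on.intros obj_action free_mod_on_action
  show "action A l v \<in> vec_car A"
    "action A (c \<odot>\<^bsub>lie_sort A\<^esub> l) v = c \<odot>\<^bsub>vec_sort A\<^esub> action A l v"
    "action A l (c \<odot>\<^bsub>vec_sort A\<^esub> v) = c \<odot>\<^bsub>vec_sort A\<^esub> action A l v"
    by (simp_all add: fm_mult_iota_scale fm_mult_scale)
  have "fm_mult (fl_iota (fl_bracket u w)) v' + fm_mult (fl_iota w) (fm_mult (fl_iota u) v')
      = fm_mult (fl_iota u) (fm_mult (fl_iota w) v')"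
    unfolding fl_iota_simps fm_mult_simps(3,5) by simp
  then show "action A (lie_bracket (lie_sort A) l m) v \<oplus>\<^bsub>vec_sort A\<^esub> action A m (action A l v) = action A l (action A m v)"
    by simp
qed

text \<open>A natural family of bijections from \<open>A\<close> to \<open>F A\<close> that respects
  bracket and action and is semilinear over \<open>\<alpha>\<close>. For
  \<open>\<alpha> = id\<close> its members are linear, so it amounts to a natural isomorphism from
  the identity functor to \<open>(F, f)\<close>.\<close>

definition semilinear_family where
  "semilinear_family \<alpha> F f t1 t2 \<longleftrightarrow>
    (\<forall>A\<in>obs. bij_betw (t1 A) (lie_car A) (lie_car (F A)) \<and>
      bij_betw (t2 A) (vec_car A) (vec_car (F A)) \<and>
      (\<forall>a\<in>lie_car A. \<forall>b\<in>lie_car A.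
        t1 A (a \<oplus>\<^bsub>lie_sort A\<^esub> b) = t1 A a \<oplus>\<^bsub>lie_sort (F A)\<^esub> t1 A b \<and>
        t1 A (lie_bracket (lie_sort A) a b) = lie_bracket (lie_sort (F A)) (t1 A a) (t1 A b)) \<and>
      (\<forall>v\<in>vec_car A. \<forall>w\<in>vec_car A.
        t2 A (v \<oplus>\<^bsub>vec_sort A\<^esub> w) = t2 A v \<oplus>\<^bsub>vec_sort (F A)\<^esub> t2 A w) \<and>
      (\<forall>c. \<forall>a\<in>lie_car A. t1 A (c \<odot>\<^bsub>lie_sort A\<^esub> a) = \<alpha> c \<odot>\<^bsub>lie_sort (F A)\<^esub> t1 A a) \<and>
      (\<forall>c. \<forall>v\<in>vec_car A. t2 A (c \<odot>\<^bsub>vec_sort A\<^esub> v) = \<alpha> c \<odot>\<^bsub>vec_sort (F A)\<^esub> t2 A v) \<and>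
      (\<forall>a\<in>lie_car A. \<forall>v\<in>vec_car A.
        t2 A (action A a v) = action (F A) (t1 A a) (t2 A v))) \<and>
    (\<forall>A\<in>obs. \<forall>B\<in>obs. \<forall>h\<in>rep_hom A B.
      (\<forall>a\<in>lie_car A. t1 B (fst h a) = fst (fst (snd (f (A, h, B)))) (t1 A a)) \<and>
      (\<forall>v\<in>vec_car A. t2 B (snd h v) = snd (fst (snd (f (A, h, B)))) (t2 A v)))"

abbreviation "lieL \<equiv> obj {0} {}"
abbreviation "vecL \<equiv> obj {} {0}"
abbreviation "g0 \<equiv> {fl_gen 0} :: 'k free_lie set"
abbreviation "y0 \<equiv> vcls {} {0} (fm_gen 0)"

text \<open>The rank one Lie object represents the functor that takes an object to the underlying
  set of its Lie sort; \<open>point_vec_ex\<close> is the same for the second sort.\<close>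

lemma point_lie_ex:
  assumes "A \<in> obs" "a \<in> lie_car A"
  shows "\<exists>!h. h \<in> rep_hom lieL A \<and> fst h g0 = a"
proof -
  obtain X1 X2 where A: "finite X1" "A = obj X1 X2" using assms(1) by (auto simp: obs_def)
  obtain h where h: "h \<in> rep_hom lieL A" "fst h g0 = a"
    unfolding A by (rule hom_ex[of "{0}" X1 "\<lambda>_. a" X2 "{}"]) (use assms A in auto)
  have "h' = h" if "h' \<in> rep_hom lieL A" "fst h' g0 = a" for h'
    by (rule hom_eqI[OF _ A(1) that(1)[unfolded A(2)] h(1)[unfolded A(2)]]) (use that h in auto)
  then show ?thesis using h by blast
qed

lemma point_vec_ex:
  assumes "A \<in> obs" "v \<in> vec_car A"
  shows "\<exists>!h. h \<in> rep_hom vecL A \<and> snd h y0 = v"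
proof -
  obtain X1 X2 where A: "finite X1" "A = obj X1 X2" using assms(1) by (auto simp: obs_def)
  obtain h where h: "h \<in> rep_hom vecL A" "snd h y0 = v"
    unfolding A by (rule hom_ex[of "{}" X1 "\<lambda>_. {0}" X2 "{0}" "\<lambda>_. v"]) (use assms A in auto)
  have "h' = h" if "h' \<in> rep_hom vecL A" "snd h' y0 = v" for h'
    by (rule hom_eqI[OF _ A(1) that(1)[unfolded A(2)] h(1)[unfolded A(2)]]) (use that h in auto)
  then show ?thesis using h by blast
qed

definition point_lie where "point_lie A a = (THE h. h \<in> rep_hom lieL A \<and> fst h g0 = a)"
definition point_vec where "point_vec A v = (THE h. h \<in> rep_hom vecL A \<and> snd h y0 = v)"

lemma point_lie:
  assumes "A \<in> obs" "a \<in> lie_car A"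
  shows "point_lie A a \<in> rep_hom lieL A" "fst (point_lie A a) g0 = a"
    "h \<in> rep_hom lieL A \<Longrightarrow> fst h g0 = a \<Longrightarrow> point_lie A a = h"
proof -
  note t = theI'[OF point_lie_ex[OF assms], folded point_lie_def]
  show "point_lie A a \<in> rep_hom lieL A" "fst (point_lie A a) g0 = a"
    by (rule t[THEN conjunct1], rule t[THEN conjunct2])
  assume "h \<in> rep_hom lieL A" "fst h g0 = a"
  then show "point_lie A a = h"
    unfolding point_lie_def by (intro the1_equality[OF point_lie_ex[OF assms]] conjI)
qed

lemma point_vec:
  assumes "A \<in> obs" "v \<in> vec_car A"
  shows "point_vec A v \<in> rep_hom vecL A" "snd (point_vec A v) y0 = v"
    "h \<in> rep_hom vecL A \<Longrightarrow> snd h y0 = v \<Longrightarrow> point_vec A v = h"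
proof -
  note t = theI'[OF point_vec_ex[OF assms], folded point_vec_def]
  show "point_vec A v \<in> rep_hom vecL A" "snd (point_vec A v) y0 = v"
    by (rule t[THEN conjunct1], rule t[THEN conjunct2])
  assume "h \<in> rep_hom vecL A" "snd h y0 = v"
  then show "point_vec A v = h"
    unfolding point_vec_def by (intro the1_equality[OF point_vec_ex[OF assms]] conjI)
qed

lemma g0_carrier: "g0 \<in> lie_car lieL" and y0_carrier: "y0 \<in> vec_car vecL"
  by (auto intro: gen_carrier)

end

section \<open>The natural bijections and the induced maps of scalars\<close>

context theta_automorphism
begin

definition "i0 = (SOME i. F lieL = obj {i} {})"
definition "j0 = (SOME j. F vecL = obj {} {j})"

lemma F_lieL: "F lieL = obj {i0} {}"
proof -
  obtain i where "F lieL = obj {i} {}" by (rule F_lie)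
  then show ?thesis unfolding i0_def by (rule someI)
qed

lemma F_vecL: "F vecL = obj {} {j0}"
proof -
  obtain j where "F vecL = obj {} {j}" by (rule F_vec)
  then show ?thesis unfolding j0_def by (rule someI)
qed

text \<open>An element is a map from the representing object. The automorphism turns it into a map
  from \<open>F lieL\<close>, which is read off at the generator \<open>i0\<close> of that
  object.\<close>

definition "s1 A a = fst (fmap lieL A (point_lie A a)) {fl_gen i0}"
definition "s2 A v = snd (fmap vecL A (point_vec A v)) (vcls {} {j0} (fm_gen j0))"

lemma target_carrier:
  "{fl_gen i0} \<in> lie_car (F lieL)" "vcls {} {j0} (fm_gen j0) \<in> vec_car (F vecL)"
  unfolding F_lieL F_vecL by (auto intro: gen_carrier)

lemma s1_in: "A \<in> obs \<Longrightarrow> a \<in> lie_car A \<Longrightarrow> s1 A a \<in> lie_car (F A)"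
  unfolding s1_def by (rule hom_simps(1)[OF f_eq(2)[OF _ _ point_lie(1)] target_carrier(1)]) simp_all

lemma s2_in: "A \<in> obs \<Longrightarrow> v \<in> vec_car A \<Longrightarrow> s2 A v \<in> vec_car (F A)"
  unfolding s2_def by (rule hom_simps(2)[OF f_eq(2)[OF _ _ point_vec(1)] target_carrier(2)]) simp_all

lemma s1_nat:
  assumes "A \<in> obs" "B \<in> obs" "h \<in> rep_hom A B" "a \<in> lie_car A"
  shows "s1 B (fst h a) = fst (fmap A B h) (s1 A a)"
proof -
  have p: "point_lie A a \<in> rep_hom lieL A" using assms point_lie by simp
  have "point_lie B (fst h a) = hcomp lieL h (point_lie A a)"
    by (rule point_lie(3)[OF assms(2) hom_simps(1)[OF assms(3,4)] hcomp_in[OF _ p assms(3)]])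
      (simp_all add: g0_carrier point_lie(2)[OF assms(1,4)])
  then show ?thesis
    using fmap_comp[OF _ assms(1,2) p assms(3)] by (simp add: s1_def target_carrier)
qed

lemma s2_nat:
  assumes "A \<in> obs" "B \<in> obs" "h \<in> rep_hom A B" "v \<in> vec_car A"
  shows "s2 B (snd h v) = snd (fmap A B h) (s2 A v)"
proof -
  have p: "point_vec A v \<in> rep_hom vecL A" using assms point_vec by simp
  have "point_vec B (snd h v) = hcomp vecL h (point_vec A v)"
    by (rule point_vec(3)[OF assms(2) hom_simps(2)[OF assms(3,4)] hcomp_in[OF _ p assms(3)]])
      (simp_all add: y0_carrier point_vec(2)[OF assms(1,4)])
  then show ?thesis
    using fmap_comp[OF _ assms(1,2) p assms(3)] by (simp add: s2_def target_carrier)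
qed

text \<open>The automorphism is bijective on homomorphisms, and \<open>F lieL\<close> is again free
  on one Lie generator, so the maps from it to \<open>F A\<close> are again elements of
  \<open>F A\<close>.\<close>

lemma s1_bij:
  assumes A: "A \<in> obs"
  shows "bij_betw (s1 A) (lie_car A) (lie_car (F A))"
  unfolding bij_betw_def
proof
  obtain Y1 Y2 where Y: "finite Y1" "F A = obj Y1 Y2" using F_obs[OF A] by (auto simp: obs_def)
  have L: "lieL \<in> obs" by simp
  show "inj_on (s1 A) (lie_car A)"
  proof (rule inj_onI)
    fix a b assume ab: "a \<in> lie_car A" "b \<in> lie_car A" "s1 A a = s1 A b"
    note p = point_lie[OF A ab(1)] point_lie[OF A ab(2)]
    have "fmap lieL A (point_lie A a) = fmap lieL A (point_lie A b)"
      by (rule hom_eqI[OF _ Y(1) f_eq(2)[OF L A p(1), unfolded F_lieL Y(2)]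
            f_eq(2)[OF L A p(4), unfolded F_lieL Y(2)]])
        (use ab(3) in \<open>simp_all add: s1_def\<close>)
    then have "point_lie A a = point_lie A b" using fmap_distinct[OF L A p(1) p(4)] by blast
    then show "a = b" using p by metis
  qed
  show "s1 A ` lie_car A = lie_car (F A)"
  proof
    show "s1 A ` lie_car A \<subseteq> lie_car (F A)" using s1_in[OF A] by auto
    show "lie_car (F A) \<subseteq> s1 A ` lie_car A"
    proof
      fix x assume x: "x \<in> lie_car (F A)"
      obtain k where k: "k \<in> rep_hom (F lieL) (F A)" "fst k {fl_gen i0} = x"
        unfolding F_lieL Y(2) by (rule hom_ex[of "{i0}" Y1 "\<lambda>_. x" Y2 "{}"]) (use x Y in auto)
      obtain h where h: "h \<in> rep_hom lieL A" "k = fmap lieL A h" using fmap_surj[OF L A k(1)] .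
      have c: "fst h g0 \<in> lie_car A" using hom_simps(1)[OF h(1) g0_carrier] .
      have "s1 A (fst h g0) = x" using point_lie(3)[OF A c h(1) refl] h(2) k(2) by (simp add: s1_def)
      then show "x \<in> s1 A ` lie_car A" using c by blast
    qed
  qed
qed

lemma s2_bij:
  assumes A: "A \<in> obs"
  shows "bij_betw (s2 A) (vec_car A) (vec_car (F A))"
  unfolding bij_betw_def
proof
  obtain Y1 Y2 where Y: "finite Y1" "F A = obj Y1 Y2" using F_obs[OF A] by (auto simp: obs_def)
  have L: "vecL \<in> obs" by simp
  show "inj_on (s2 A) (vec_car A)"
  proof (rule inj_onI)
    fix a b assume ab: "a \<in> vec_car A" "b \<in> vec_car A" "s2 A a = s2 A b"
    note p = point_vec[OF A ab(1)] point_vec[OF A ab(2)]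
    have "fmap vecL A (point_vec A a) = fmap vecL A (point_vec A b)"
      by (rule hom_eqI[OF _ Y(1) f_eq(2)[OF L A p(1), unfolded F_vecL Y(2)]
            f_eq(2)[OF L A p(4), unfolded F_vecL Y(2)]])
        (use ab(3) in \<open>simp_all add: s2_def\<close>)
    then have "point_vec A a = point_vec A b" using fmap_distinct[OF L A p(1) p(4)] by blast
    then show "a = b" using p by metis
  qed
  show "s2 A ` vec_car A = vec_car (F A)"
  proof
    show "s2 A ` vec_car A \<subseteq> vec_car (F A)" using s2_in[OF A] by auto
    show "vec_car (F A) \<subseteq> s2 A ` vec_car A"
    proof
      fix x assume x: "x \<in> vec_car (F A)"
      obtain k where k: "k \<in> rep_hom (F vecL) (F A)" "snd k (vcls {} {j0} (fm_gen j0)) = x"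
        unfolding F_vecL Y(2) by (rule hom_ex[of "{}" Y1 "\<lambda>_. {0}" Y2 "{j0}" "\<lambda>_. x"]) (use x Y in auto)
      obtain h where h: "h \<in> rep_hom vecL A" "k = fmap vecL A h" using fmap_surj[OF L A k(1)] .
      have c: "snd h y0 \<in> vec_car A" using hom_simps(2)[OF h(1) y0_carrier] .
      have "s2 A (snd h y0) = x" using point_vec(3)[OF A c h(1) refl] h(2) k(2) by (simp add: s2_def)
      then show "x \<in> s2 A ` vec_car A" using c by blast
    qed
  qed
qed

lemma s1_eqD: "s1 A a = s1 A b \<Longrightarrow> A \<in> obs \<Longrightarrow> a \<in> lie_car A \<Longrightarrow> b \<in> lie_car A \<Longrightarrow> a = b"
  by (rule inj_onD[OF bij_betw_imp_inj_on[OF s1_bij]])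

lemma s2_eqD: "s2 A a = s2 A b \<Longrightarrow> A \<in> obs \<Longrightarrow> a \<in> vec_car A \<Longrightarrow> b \<in> vec_car A \<Longrightarrow> a = b"
  by (rule inj_onD[OF bij_betw_imp_inj_on[OF s2_bij]])

lemma s1_surj:
  assumes "A \<in> obs" "x \<in> lie_car (F A)"
  obtains a where "a \<in> lie_car A" "x = s1 A a"
  using s1_bij[OF assms(1)] assms(2) that unfolding bij_betw_def by blast

lemma s2_surj:
  assumes "A \<in> obs" "x \<in> vec_car (F A)"
  obtains a where "a \<in> vec_car A" "x = s2 A a"
  using s2_bij[OF assms(1)] assms(2) that unfolding bij_betw_def by blast

text \<open>A scalar is an endomorphism of a rank one object, so the automorphism induces a map of
  scalars for each sort. Multiplicativity reflects composition; additivity has to wait for the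
  sums.\<close>

definition "\<phi>1 c = (SOME d. s1 lieL {fl_scale c (fl_gen 0)} = {fl_scale d (fl_gen i0)})"
definition "\<phi>2 c = (SOME d. s2 vecL (vcls {} {0} (fm_scale c (fm_gen 0))) = vcls {} {j0} (fm_scale d (fm_gen j0)))"

lemma lieL_carrier: "{fl_scale c (fl_gen i)} \<in> lie_car (obj {i} {})"
  by (simp add: obj_lie_carrier lie_on_scale lie_on_gen)

lemma vecL_carrier: "vcls {} {j} (fm_scale c (fm_gen j)) \<in> vec_car (obj {} {j})"
  by (simp add: obj_vec_carrier free_mod_on_scale free_mod_on_gen)

lemma s1_lieL: "s1 lieL {fl_scale c (fl_gen 0)} = {fl_scale (\<phi>1 c) (fl_gen i0)}"
proof -
  have "s1 lieL {fl_scale c (fl_gen 0)} \<in> lie_car (obj {i0} {})"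
    using s1_in[OF _ lieL_carrier, of 0 c] by (simp add: F_lieL)
  then obtain d where "s1 lieL {fl_scale c (fl_gen 0)} = {fl_scale d (fl_gen i0)}" by (rule singleton_gen_1)
  then show ?thesis unfolding \<phi>1_def by (rule someI)
qed

lemma s2_vecL: "s2 vecL (vcls {} {0} (fm_scale c (fm_gen 0))) = vcls {} {j0} (fm_scale (\<phi>2 c) (fm_gen j0))"
proof -
  have "s2 vecL (vcls {} {0} (fm_scale c (fm_gen 0))) \<in> vec_car (obj {} {j0})"
    using s2_in[OF _ vecL_carrier, of 0 c] by (simp add: F_vecL)
  then obtain d where "s2 vecL (vcls {} {0} (fm_scale c (fm_gen 0))) = vcls {} {j0} (fm_scale d (fm_gen j0))"
    by (rule singleton_gen_2)
  then show ?thesis unfolding \<phi>2_def by (rule someI)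
qed

text \<open>The multiple of \<open>a\<close> by \<open>c\<close> is the image of the multiple of the
  generator under the point of \<open>a\<close>, so naturality carries the rank one case to every
  object.\<close>

lemma s1_scale:
  assumes A: "A \<in> obs" and a: "a \<in> lie_car A"
  shows "s1 A (c \<odot>\<^bsub>lie_sort A\<^esub> a) = \<phi>1 c \<odot>\<^bsub>lie_sort (F A)\<^esub> s1 A a"
proof -
  have L: "lieL \<in> obs" by simp
  note p = point_lie[OF A a]
  have e: "c \<odot>\<^bsub>lie_sort (obj {i} {})\<^esub> {fl_gen i} = {fl_scale c (fl_gen i)}" for c :: 'k and i
    by (subst obj_lie_simps) (auto intro: lie_on_gen)
  have "fst (point_lie A a) {fl_scale c (fl_gen 0)} = c \<odot>\<^bsub>lie_sort A\<^esub> a"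
    using hom_simps(4)[OF p(1) g0_carrier, of c] p(2) by (simp add: e)
  then have "s1 A (c \<odot>\<^bsub>lie_sort A\<^esub> a) = fst (fmap lieL A (point_lie A a)) {fl_scale (\<phi>1 c) (fl_gen i0)}"
    using s1_nat[OF L A p(1) lieL_carrier, of c] by (simp add: s1_lieL)
  also have "\<dots> = \<phi>1 c \<odot>\<^bsub>lie_sort (F A)\<^esub> s1 A a"
    using hom_simps(4)[OF f_eq(2)[OF L A p(1)] target_carrier(1), of "\<phi>1 c"] by (simp add: e F_lieL s1_def)
  finally show ?thesis .
qed

lemma s2_scale:
  assumes A: "A \<in> obs" and a: "a \<in> vec_car A"
  shows "s2 A (c \<odot>\<^bsub>vec_sort A\<^esub> a) = \<phi>2 c \<odot>\<^bsub>vec_sort (F A)\<^esub> s2 A a"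
proof -
  have L: "vecL \<in> obs" by simp
  note p = point_vec[OF A a]
  have e: "c \<odot>\<^bsub>vec_sort (obj {} {i})\<^esub> vcls {} {i} (fm_gen i) = vcls {} {i} (fm_scale c (fm_gen i))" for c :: 'k and i
    by (subst obj_vec_simps) (auto intro: free_mod_on_gen)
  have "snd (point_vec A a) (vcls {} {0} (fm_scale c (fm_gen 0))) = c \<odot>\<^bsub>vec_sort A\<^esub> a"
    using hom_simps(7)[OF p(1) y0_carrier, of c] p(2) by (simp add: e)
  then have "s2 A (c \<odot>\<^bsub>vec_sort A\<^esub> a) = snd (fmap vecL A (point_vec A a)) (vcls {} {j0} (fm_scale (\<phi>2 c) (fm_gen j0)))"
    using s2_nat[OF L A p(1) vecL_carrier, of c] by (simp add: s2_vecL)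
  also have "\<dots> = \<phi>2 c \<odot>\<^bsub>vec_sort (F A)\<^esub> s2 A a"
    using hom_simps(7)[OF f_eq(2)[OF L A p(1)] target_carrier(2), of "\<phi>2 c"] by (simp add: e F_vecL s2_def)
  finally show ?thesis .
qed

lemma \<phi>1_inj_surj: "inj \<phi>1" "surj \<phi>1"
proof -
  show "inj \<phi>1"
  proof (rule injI)
    fix c d assume "\<phi>1 c = \<phi>1 d"
    then have "s1 lieL {fl_scale c (fl_gen 0)} = s1 lieL {fl_scale d (fl_gen 0)}" by (simp add: s1_lieL)
    then have "{fl_scale c (fl_gen 0)} = {fl_scale d (fl_gen 0) :: 'k free_lie}"
      by (rule s1_eqD) (auto intro: lieL_carrier)
    then show "c = d" by (simp add: fl_gen_nonzero)
  qed
  have "\<exists>c. \<phi>1 c = d" for d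
  proof -
    have "{fl_scale d (fl_gen i0)} \<in> lie_car (F lieL)" unfolding F_lieL by (rule lieL_carrier)
    then obtain a where a: "a \<in> lie_car lieL" "{fl_scale d (fl_gen i0)} = s1 lieL a"
      using s1_surj[of lieL] by auto
    obtain c where "a = {fl_scale c (fl_gen 0)}" using a(1) by (rule singleton_gen_1)
    then show ?thesis using a(2) by (auto simp: s1_lieL fl_gen_nonzero)
  qed
  then show "surj \<phi>1" by (metis surjI)
qed

lemma vcls_gen_scale_eq:
  "vcls {} {j} (fm_scale c (fm_gen j)) = vcls {} {j} (fm_scale d (fm_gen j)) \<longleftrightarrow> c = d"
proof -
  have "vcls {} {j} (fm_scale c (fm_gen j)) = vcls {} {j} (fm_scale d (fm_gen j))
      \<longleftrightarrow> fm_scale (c - d) (fm_gen j) \<in> vec_ideal"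
    by (simp add: vcls_eq_iff free_mod_on_scale free_mod_on_gen fm.scale_left_diff_distrib)
  also have "\<dots> \<longleftrightarrow> c = d"
    using vec_ideal_scale_iff[of "c - d" "fm_gen j"] fm_gen_notin[of j] by (cases "c = d") auto
  finally show ?thesis .
qed

lemma \<phi>2_inj_surj: "inj \<phi>2" "surj \<phi>2"
proof -
  show "inj \<phi>2"
  proof (rule injI)
    fix c d assume "\<phi>2 c = \<phi>2 d"
    then have "s2 vecL (vcls {} {0} (fm_scale c (fm_gen 0))) = s2 vecL (vcls {} {0} (fm_scale d (fm_gen 0)))"
      by (simp add: s2_vecL)
    then have "vcls {} {0} (fm_scale c (fm_gen 0)) = vcls {} {0} (fm_scale d (fm_gen 0))"
      by (rule s2_eqD) (auto intro: vecL_carrier)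
    then show "c = d" by (simp add: vcls_gen_scale_eq)
  qed
  have "\<exists>c. \<phi>2 c = d" for d
  proof -
    have "vcls {} {j0} (fm_scale d (fm_gen j0)) \<in> vec_car (F vecL)" unfolding F_vecL by (rule vecL_carrier)
    then obtain a where a: "a \<in> vec_car vecL" "vcls {} {j0} (fm_scale d (fm_gen j0)) = s2 vecL a"
      using s2_surj[of vecL] by auto
    obtain c where "a = vcls {} {0} (fm_scale c (fm_gen 0))" using a(1) by (rule singleton_gen_2)
    then show ?thesis using a(2) by (auto simp: s2_vecL vcls_gen_scale_eq)
  qed
  then show "surj \<phi>2" by (metis surjI)
qed

lemma \<phi>1_mult: "\<phi>1 (c * d) = \<phi>1 c * \<phi>1 d"
proof -
  have "s1 lieL (c \<odot>\<^bsub>lie_sort lieL\<^esub> {fl_scale d (fl_gen 0)}) = \<phi>1 c \<odot>\<^bsub>lie_sort (F lieL)\<^esub> s1 lieL {fl_scale d (fl_gen 0)}"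
    by (rule s1_scale) (auto intro: lieL_carrier)
  moreover have "c \<odot>\<^bsub>lie_sort lieL\<^esub> {fl_scale d (fl_gen 0)} = {fl_scale (c * d) (fl_gen 0)}"
    by (subst obj_lie_simps) (auto intro: lie_on_scale lie_on_gen)
  moreover have "\<phi>1 c \<odot>\<^bsub>lie_sort (obj {i0} {})\<^esub> {fl_scale (\<phi>1 d) (fl_gen i0)} = {fl_scale (\<phi>1 c * \<phi>1 d) (fl_gen i0)}"
    by (subst obj_lie_simps) (auto intro: lie_on_scale lie_on_gen)
  ultimately show ?thesis by (simp add: s1_lieL F_lieL fl_gen_nonzero)
qed

lemma \<phi>2_mult: "\<phi>2 (c * d) = \<phi>2 c * \<phi>2 d"
proof -
  have "s2 vecL (c \<odot>\<^bsub>vec_sort vecL\<^esub> vcls {} {0} (fm_scale d (fm_gen 0)))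
      = \<phi>2 c \<odot>\<^bsub>vec_sort (F vecL)\<^esub> s2 vecL (vcls {} {0} (fm_scale d (fm_gen 0)))"
    by (rule s2_scale) (auto intro: vecL_carrier)
  moreover have "c \<odot>\<^bsub>vec_sort vecL\<^esub> vcls {} {0} (fm_scale d (fm_gen 0)) = vcls {} {0} (fm_scale (c * d) (fm_gen 0))"
    by (subst obj_vec_simps) (auto intro: free_mod_on_scale free_mod_on_gen)
  moreover have "\<phi>2 c \<odot>\<^bsub>vec_sort (obj {} {j0})\<^esub> vcls {} {j0} (fm_scale (\<phi>2 d) (fm_gen j0))
      = vcls {} {j0} (fm_scale (\<phi>2 c * \<phi>2 d) (fm_gen j0))"
    by (subst obj_vec_simps) (auto intro: free_mod_on_scale free_mod_on_gen)
  ultimately show ?thesis by (simp add: s2_vecL F_vecL vcls_gen_scale_eq)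
qed

text \<open>Multiplicativity and bijectivity already pin down 0 and 1. Thus \<open>s1\<close> is
  known to preserve zero at a stage where nothing is known about sums.\<close>

lemma mult_bij_01:
  fixes \<phi> :: "'k \<Rightarrow> 'k"
  assumes "inj \<phi>" "surj \<phi>" "\<And>c d. \<phi> (c * d) = \<phi> c * \<phi> d"
  shows "\<phi> 0 = 0" "\<phi> 1 = 1"
proof -
  obtain c where "\<phi> c = 0" using assms(2) by (metis surjD)
  then show 0: "\<phi> 0 = 0" using assms(3)[of 0 c] by simp
  have "\<phi> 1 \<noteq> 0" using 0 assms(1) by (metis injD zero_neq_one)
  then show "\<phi> 1 = 1" using assms(3)[of 1 1] by simp
qed

lemmas \<phi>1_01 = mult_bij_01[OF \<phi>1_inj_surj \<phi>1_mult]
lemmas \<phi>2_01 = mult_bij_01[OF \<phi>2_inj_surj \<phi>2_mult]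

lemma s1_zero: "A \<in> obs \<Longrightarrow> s1 A {0} = {0}"
proof -
  assume A: "A \<in> obs"
  then have z: "{0} \<in> lie_car A" by (auto simp: obs_def zero_carrier)
  have "s1 A (0 \<odot>\<^bsub>lie_sort A\<^esub> {0}) = 0 \<odot>\<^bsub>lie_sort (F A)\<^esub> s1 A {0}"
    using s1_scale[OF A z, of 0] by (simp add: \<phi>1_01)
  then show ?thesis using obs_lie_rules(8)[OF A z z] obs_lie_rules(8)[OF F_obs[OF A] s1_in[OF A z] s1_in[OF A z]] by simp
qed

text \<open>A formula that expresses an operation of \<open>F A\<close> through \<open>s1\<close>
  travels along homomorphisms. So it suffices to find it at the generators of a free object, where
  it is a single word.\<close>

lemma s1_push:
  assumes A: "A \<in> obs" and B: "B \<in> obs" and h: "h \<in> rep_hom A B"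
    and a: "a \<in> lie_car A" and b: "b \<in> lie_car A" and p: "p \<in> lie_car A"
  shows "s1 A p = s1 A a \<oplus>\<^bsub>lie_sort (F A)\<^esub> s1 A b \<Longrightarrow>
      s1 B (fst h p) = s1 B (fst h a) \<oplus>\<^bsub>lie_sort (F B)\<^esub> s1 B (fst h b)"
    "s1 A p = lie_bracket (lie_sort (F A)) (s1 A a) (s1 A b) \<Longrightarrow>
      s1 B (fst h p) = lie_bracket (lie_sort (F B)) (s1 B (fst h a)) (s1 B (fst h b))"
  using hom_simps(3,5)[OF f_eq(2)[OF A B h] s1_in[OF A a] s1_in[OF A b]]
  by (simp_all add: s1_nat[OF A B h] a b p)

lemma s2_push:
  assumes A: "A \<in> obs" and B: "B \<in> obs" and h: "h \<in> rep_hom A B"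
    and l: "l \<in> lie_car A"
    and a: "a \<in> vec_car A" and b: "b \<in> vec_car A" and p: "p \<in> vec_car A"
  shows "s2 A p = s2 A a \<oplus>\<^bsub>vec_sort (F A)\<^esub> s2 A b \<Longrightarrow>
      s2 B (snd h p) = s2 B (snd h a) \<oplus>\<^bsub>vec_sort (F B)\<^esub> s2 B (snd h b)"
    "s2 A p = action (F A) (s1 A l) (s2 A a) \<Longrightarrow>
      s2 B (snd h p) = action (F B) (s1 B (fst h l)) (s2 B (snd h a))"
  using hom_simps(6)[OF f_eq(2)[OF A B h] s2_in[OF A a] s2_in[OF A b]]
    hom_simps(8)[OF f_eq(2)[OF A B h] s1_in[OF A l] s2_in[OF A a]]
  by (simp_all add: s1_nat[OF A B h] s2_nat[OF A B h] a b p l)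

section \<open>Addition in the Lie sort\<close>

abbreviation "lieP \<equiv> obj {0, 1} {}"

lemma lieP_facts: "lieP \<in> obs" "{fl_gen 0} \<in> lie_car lieP" "{fl_gen 1} \<in> lie_car lieP"
  by (auto intro: gen_carrier)

lemma lieP_endo:
  assumes "\<sigma> 0 \<in> free_lie_on {0, 1}" "\<sigma> 1 \<in> free_lie_on {0, 1}"
  obtains h where "h \<in> rep_hom lieP lieP" "\<And>u. u \<in> free_lie_on {0, 1} \<Longrightarrow> fst h {u} = {fl_subst \<sigma> u}"
proof -
  have v: "valid_subst {0, 1} {} {0, 1} {} \<sigma> (\<lambda>_. 0)" using assms by (simp add: valid_subst_def)
  show ?thesis by (rule that[OF subst_hom_in_hom[OF _ _ v]]) (simp_all add: subst_hom_simps[OF v] del: One_nat_def)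
qed

lemma lieP_gens: "fl_gen 0 \<in> free_lie_on {0, 1}" "fl_gen 1 \<in> free_lie_on {0, 1}"
  by (auto intro: lie_on_gen)

lemma lieP_smult: "u \<in> free_lie_on {0, 1} \<Longrightarrow> c \<odot>\<^bsub>lie_sort lieP\<^esub> {u} = {fl_scale c u}"
  by (subst obj_lie_simps) auto

text \<open>Let \<open>p\<close> be the word whose image is the sum of the images of the generators.
  Doubling both generators takes the common factor \<open>\<phi>1 2\<close> out of the sum, and
  going back through \<open>s1\<close> shows that \<open>p\<close> is doubled, so it is linear.
  Killing either generator then shows that the coefficient of the other one is 1.\<close>

lemma s1_add_gens: "s1 lieP {fl_gen 0 + fl_gen 1} = s1 lieP {fl_gen 0} \<oplus>\<^bsub>lie_sort (F lieP)\<^esub> s1 lieP {fl_gen 1}"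
proof -
  note P = lieP_facts
  note FP = F_obs[OF P(1)] s1_in[OF P(1,2)] s1_in[OF P(1,3)]
  obtain p where p: "p \<in> lie_car lieP"
    "s1 lieP {fl_gen 0} \<oplus>\<^bsub>lie_sort (F lieP)\<^esub> s1 lieP {fl_gen 1} = s1 lieP p"
    using s1_surj[OF P(1) obs_lie_rules(1)[OF FP]] .
  obtain u where u: "u \<in> free_lie_on {0, 1}" "p = {u}" using p(1) by (auto simp: obj_lie_carrier)
  note push = s1_push(1)[OF P(1) P(1) _ P(2,3) p(1) p(2)[symmetric]]
  obtain T where T: "T \<in> rep_hom lieP lieP"
    "\<And>u. u \<in> free_lie_on {0, 1} \<Longrightarrow> fst T {u} = {fl_subst (\<lambda>x. fl_scale 2 (fl_gen x)) u}"
    by (rule lieP_endo[of "\<lambda>x. fl_scale 2 (fl_gen x)"]) (auto intro: lie_on_scale lie_on_gen)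
  have "s1 lieP (fst T p) = s1 lieP (2 \<odot>\<^bsub>lie_sort lieP\<^esub> {fl_gen 0})
      \<oplus>\<^bsub>lie_sort (F lieP)\<^esub> s1 lieP (2 \<odot>\<^bsub>lie_sort lieP\<^esub> {fl_gen 1})"
    using push[OF T(1)] by (simp only: T(2)[OF lieP_gens(1)] T(2)[OF lieP_gens(2)] fl_subst_simps lieP_smult lieP_gens)
  also have "\<dots> = \<phi>1 2 \<odot>\<^bsub>lie_sort (F lieP)\<^esub> s1 lieP p"
    using obs_lie_rules(4)[OF FP, of "\<phi>1 2"] by (simp only: s1_scale[OF P(1,2)] s1_scale[OF P(1,3)] p(2))
  also have "\<dots> = s1 lieP (2 \<odot>\<^bsub>lie_sort lieP\<^esub> p)" using s1_scale[OF P(1) p(1)] by simp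
  finally have "fst T p = 2 \<odot>\<^bsub>lie_sort lieP\<^esub> p"
    by (rule s1_eqD[OF _ P(1) hom_simps(1)[OF T(1) p(1)] obs_lie_rules(2)[OF P(1) p(1) p(1)]])
  then have "fl_subst (\<lambda>x. fl_scale 2 (fl_gen x)) u = fl_scale 2 u"
    by (simp only: u(2) T(2)[OF u(1)] lieP_smult[OF u(1)] singleton_inject)
  then obtain a b where ab: "u = fl_scale a (fl_gen 0) + fl_scale b (fl_gen 1)"
    by (rule lie_degree_one[OF u(1)])
  have z: "{0} \<in> lie_car lieP" by (simp add: zero_carrier)
  obtain h where h: "h \<in> rep_hom lieP lieP"
    "\<And>u. u \<in> free_lie_on {0, 1} \<Longrightarrow> fst h {u} = {fl_subst (\<lambda>x. if x = 0 then fl_gen x else 0) u}"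
    by (rule lieP_endo[of "\<lambda>x. if x = 0 then fl_gen x else 0"]) (auto intro: lie_on_zero lie_on_gen)
  have "s1 lieP (fst h p) = s1 lieP {fl_gen 0}"
    using push[OF h(1)] obs_lie_rules(10)[OF FP(1,2,2)] by (simp add: h(2) lieP_gens s1_zero P(1) lie_on_gen)
  then have "fst h p = {fl_gen 0}" by (rule s1_eqD[OF _ P(1) hom_simps(1)[OF h(1) p(1)] P(2)])
  then have "fl_subst (\<lambda>x. if x = 0 then fl_gen x else 0) u = fl_gen 0"
    by (simp only: u(2) h(2)[OF u(1)] singleton_inject)
  then have "fl_scale a (fl_gen 0) = fl_gen 0" by (simp add: ab)
  then have "fl_scale (a - 1) (fl_gen 0) = (0 :: 'k free_lie)" by (simp add: fl.scale_left_diff_distrib)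
  then have a: "a = 1" by (simp add: fl_gen_nonzero)
  obtain h' where h': "h' \<in> rep_hom lieP lieP"
    "\<And>u. u \<in> free_lie_on {0, 1} \<Longrightarrow> fst h' {u} = {fl_subst (\<lambda>x. if x = 0 then 0 else fl_gen x) u}"
    by (rule lieP_endo[of "\<lambda>x. if x = 0 then 0 else fl_gen x"]) (auto intro: lie_on_zero lie_on_gen)
  have "s1 lieP (fst h' p) = s1 lieP {fl_gen 1}"
    using push[OF h'(1)] obs_lie_rules(9)[OF FP(1,3,3)] by (simp add: h'(2) lieP_gens s1_zero P(1) lie_on_gen)
  then have "fst h' p = {fl_gen 1}" by (rule s1_eqD[OF _ P(1) hom_simps(1)[OF h'(1) p(1)] P(3)])
  then have "fl_subst (\<lambda>x. if x = 0 then 0 else fl_gen x) u = fl_gen 1"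
    by (simp only: u(2) h'(2)[OF u(1)] singleton_inject)
  then have "fl_scale b (fl_gen 1) = fl_gen 1" by (simp add: ab)
  then have "fl_scale (b - 1) (fl_gen 1) = (0 :: 'k free_lie)" by (simp add: fl.scale_left_diff_distrib)
  then have b: "b = 1" by (simp add: fl_gen_nonzero)
  show ?thesis using p(2) u(2) ab a b by simp
qed

lemma lieP_hom_ex:
  assumes A: "A \<in> obs" and a: "a \<in> lie_car A" and b: "b \<in> lie_car A"
  obtains h where "h \<in> rep_hom lieP A" "fst h {fl_gen 0} = a" "fst h {fl_gen 1} = b"
proof -
  obtain X1 X2 where X: "finite X1" "A = obj X1 X2" using A by (auto simp: obs_def)
  obtain h where h: "h \<in> rep_hom (obj {0, 1} {}) (obj X1 X2)"
      "\<And>x. x \<in> {0, 1} \<Longrightarrow> fst h {fl_gen x} = (if x = 0 then a else b)"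
    by (rule hom_ex[of "{0, 1}" X1 "\<lambda>x. if x = 0 then a else b" X2 "{}"]) (use a b X in auto)
  show ?thesis by (rule that[OF h(1)[folded X(2)]]) (use h(2)[of 0] h(2)[of 1] in simp_all)
qed

lemma s1_add:
  assumes A: "A \<in> obs" and a: "a \<in> lie_car A" and b: "b \<in> lie_car A"
  shows "s1 A (a \<oplus>\<^bsub>lie_sort A\<^esub> b) = s1 A a \<oplus>\<^bsub>lie_sort (F A)\<^esub> s1 A b"
proof -
  note P = lieP_facts
  obtain h where h: "h \<in> rep_hom lieP A" "fst h {fl_gen 0} = a" "fst h {fl_gen 1} = b"
    using lieP_hom_ex[OF A a b] .
  have e: "{fl_gen 0} \<oplus>\<^bsub>lie_sort lieP\<^esub> {fl_gen 1} = {fl_gen 0 + fl_gen 1}"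
    by (subst obj_lie_simps) (use lieP_gens in auto)
  have c: "{fl_gen 0 + fl_gen 1} \<in> lie_car lieP" using obs_lie_rules(1)[OF P] by (simp only: e)
  show ?thesis
    using s1_push(1)[OF P(1) A h(1) P(2,3) c s1_add_gens] hom_simps(3)[OF h(1) P(2,3)] by (simp only: e h(2,3))
qed

lemma \<phi>1_add: "\<phi>1 (c + d) = \<phi>1 c + \<phi>1 d"
proof -
  have L: "lieL \<in> obs" by simp
  have add: "{fl_scale c (fl_gen i)} \<oplus>\<^bsub>lie_sort (obj {i} {})\<^esub> {fl_scale d (fl_gen i)} = {fl_scale (c + d) (fl_gen i)}"
    for c d :: 'k and i
    by (simp add: obj_lie_simps lie_on_gen lie_on_scale fl.scale_left_distrib)
  have "{fl_scale (\<phi>1 (c + d)) (fl_gen i0)} = {fl_scale (\<phi>1 c + \<phi>1 d) (fl_gen i0) :: 'k free_lie}"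
    using s1_add[OF L lieL_carrier lieL_carrier, of c d] by (simp only: add s1_lieL F_lieL)
  then show ?thesis by (simp add: fl_gen_nonzero)
qed

section \<open>Addition in the second sort\<close>

abbreviation "vecP \<equiv> obj {} {0, 1}"

lemma vecP_facts: "vecP \<in> obs" "vcls {} {0, 1} (fm_gen 0) \<in> vec_car vecP"
  "vcls {} {0, 1} (fm_gen 1) \<in> vec_car vecP" "{0} \<in> lie_car vecP"
  by (auto intro: gen_carrier zero_carrier)

lemma vecP_endo:
  assumes "\<tau> 0 \<in> free_mod_on {} {0, 1}" "\<tau> 1 \<in> free_mod_on {} {0, 1}"
  obtains h where "h \<in> rep_hom vecP vecP"
    "\<And>u. u \<in> free_mod_on {} {0, 1} \<Longrightarrow> snd h (vcls {} {0, 1} u) = vcls {} {0, 1} (fm_subst fl_gen \<tau> u)"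
proof -
  have v: "valid_subst {} {0, 1} {} {0, 1} fl_gen \<tau>" using assms by (simp add: valid_subst_def)
  show ?thesis by (rule that[OF subst_hom_in_hom[OF _ _ v]]) (simp_all add: subst_hom_simps[OF v] del: One_nat_def)
qed

lemma vcls_scale_gen_eq:
  assumes "y \<in> X2" "vcls X1 X2 (fm_scale c (fm_gen y)) = vcls X1 X2 (fm_gen y)"
  shows "c = 1"
proof -
  have "fm_scale (c - 1) (fm_gen y) \<in> vec_ideal"
    using assms by (simp add: vcls_eq_iff free_mod_on_scale free_mod_on_gen fm.scale_left_diff_distrib)
  then show ?thesis using vec_ideal_scale_iff[of "c - 1" "fm_gen y"] fm_gen_notin[of y] by auto
qed

lemma s2_zero: "A \<in> obs \<Longrightarrow> v \<in> vec_car A \<Longrightarrow> s2 A (0 \<odot>\<^bsub>vec_sort A\<^esub> v) = 0 \<odot>\<^bsub>vec_sort (F A)\<^esub> s2 A v"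
  by (simp add: s2_scale \<phi>2_01)

text \<open>Without Lie variables the word is linear by itself, and only its two coefficients have
  to be found, again by killing one generator at a time.\<close>

lemma s2_add_gens: "s2 vecP (vcls {} {0, 1} (fm_gen 0 + fm_gen 1))
  = s2 vecP (vcls {} {0, 1} (fm_gen 0)) \<oplus>\<^bsub>vec_sort (F vecP)\<^esub> s2 vecP (vcls {} {0, 1} (fm_gen 1))"
proof -
  note P = vecP_facts
  note FP = F_obs[OF P(1)] s2_in[OF P(1,2)] s2_in[OF P(1,3)]
  obtain p where p: "p \<in> vec_car vecP"
    "s2 vecP (vcls {} {0, 1} (fm_gen 0)) \<oplus>\<^bsub>vec_sort (F vecP)\<^esub> s2 vecP (vcls {} {0, 1} (fm_gen 1)) = s2 vecP p"
    using s2_surj[OF P(1) obs_vec_rules(1)[OF FP]] .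
  obtain u where u: "u \<in> free_mod_on {} {0, 1}" "p = vcls {} {0, 1} u" using p(1) by (auto simp: obj_vec_carrier)
  note push = s2_push(1)[OF P(1) P(1) _ P(4) P(2,3) p(1) p(2)[symmetric]]
  obtain a b where ab: "u = fm_scale a (fm_gen 0) + fm_scale b (fm_gen 1)" using free_mod_on_two[OF u(1)] .
  have g: "fm_gen 0 \<in> free_mod_on {} {0, 1}" "fm_gen 1 \<in> free_mod_on {} {0, 1}"
    "(0 :: 'k free_mod) \<in> free_mod_on {} {0, 1}"
    by (auto intro: free_mod_on_gen free_mod_on_closed)
  have z: "vcls {} {0, 1} 0 = 0 \<odot>\<^bsub>vec_sort vecP\<^esub> vcls {} {0, 1} (fm_gen y)" if "y \<in> {0, 1}" for y
    using that by (simp add: obj_vec_simps free_mod_on_gen)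
  obtain h where h: "h \<in> rep_hom vecP vecP" "\<And>u. u \<in> free_mod_on {} {0, 1} \<Longrightarrow>
      snd h (vcls {} {0, 1} u) = vcls {} {0, 1} (fm_subst fl_gen (\<lambda>y. if y = 0 then fm_gen y else 0) u)"
    by (rule vecP_endo[of "\<lambda>y. if y = 0 then fm_gen y else 0"]) (use g in auto)
  have "snd h (vcls {} {0, 1} (fm_gen 0)) = vcls {} {0, 1} (fm_gen 0)"
      "snd h (vcls {} {0, 1} (fm_gen 1)) = 0 \<odot>\<^bsub>vec_sort vecP\<^esub> vcls {} {0, 1} (fm_gen 1)"
    using z[of 1] by (simp_all add: h(2)[OF g(1)] h(2)[OF g(2)] del: One_nat_def)
  then have "s2 vecP (snd h p) = s2 vecP (vcls {} {0, 1} (fm_gen 0))"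
    using push[OF h(1)] obs_vec_rules(8)[OF FP(1,3,2)] by (simp only: s2_zero[OF P(1,3)])
  then have "snd h p = vcls {} {0, 1} (fm_gen 0)" by (rule s2_eqD[OF _ P(1) hom_simps(2)[OF h(1) p(1)] P(2)])
  then have "vcls {} {0, 1} (fm_subst fl_gen (\<lambda>y. if y = 0 then fm_gen y else 0) u) = vcls {} {0, 1} (fm_gen 0)"
    by (simp only: u(2) h(2)[OF u(1)])
  then have "vcls {} {0, 1} (fm_scale a (fm_gen 0)) = vcls {} {0, 1} (fm_gen 0)" by (simp add: ab)
  then have a: "a = 1" by (rule vcls_scale_gen_eq[rotated]) simp
  obtain h' where h': "h' \<in> rep_hom vecP vecP" "\<And>u. u \<in> free_mod_on {} {0, 1} \<Longrightarrow>
      snd h' (vcls {} {0, 1} u) = vcls {} {0, 1} (fm_subst fl_gen (\<lambda>y. if y = 0 then 0 else fm_gen y) u)"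
    by (rule vecP_endo[of "\<lambda>y. if y = 0 then 0 else fm_gen y"]) (use g in auto)
  have "snd h' (vcls {} {0, 1} (fm_gen 1)) = vcls {} {0, 1} (fm_gen 1)"
      "snd h' (vcls {} {0, 1} (fm_gen 0)) = 0 \<odot>\<^bsub>vec_sort vecP\<^esub> vcls {} {0, 1} (fm_gen 0)"
    using z[of 0] by (simp_all add: h'(2)[OF g(1)] h'(2)[OF g(2)] del: One_nat_def)
  then have "s2 vecP (snd h' p) = s2 vecP (vcls {} {0, 1} (fm_gen 1))"
    using push[OF h'(1)] obs_vec_rules(7)[OF FP(1,2,3)] by (simp only: s2_zero[OF P(1,2)])
  then have "snd h' p = vcls {} {0, 1} (fm_gen 1)" by (rule s2_eqD[OF _ P(1) hom_simps(2)[OF h'(1) p(1)] P(3)])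
  then have "vcls {} {0, 1} (fm_subst fl_gen (\<lambda>y. if y = 0 then 0 else fm_gen y) u) = vcls {} {0, 1} (fm_gen 1)"
    by (simp only: u(2) h'(2)[OF u(1)])
  then have "vcls {} {0, 1} (fm_scale b (fm_gen 1)) = vcls {} {0, 1} (fm_gen 1)" by (simp add: ab)
  then have b: "b = 1" by (rule vcls_scale_gen_eq[rotated]) simp
  show ?thesis using p(2) u(2) ab a b by simp
qed

lemma vecP_hom_ex:
  assumes A: "A \<in> obs" and a: "a \<in> vec_car A" and b: "b \<in> vec_car A"
  obtains h where "h \<in> rep_hom vecP A" "snd h (vcls {} {0, 1} (fm_gen 0)) = a" "snd h (vcls {} {0, 1} (fm_gen 1)) = b"
proof -
  obtain X1 X2 where X: "finite X1" "A = obj X1 X2" using A by (auto simp: obs_def)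
  obtain h where h: "h \<in> rep_hom (obj {} {0, 1}) (obj X1 X2)"
      "\<And>y. y \<in> {0, 1} \<Longrightarrow> snd h (vcls {} {0, 1} (fm_gen y)) = (if y = 0 then a else b)"
    by (rule hom_ex[of "{}" X1 "\<lambda>_. {0}" X2 "{0, 1}" "\<lambda>y. if y = 0 then a else b"]) (use a b X in auto)
  show ?thesis by (rule that[OF h(1)[folded X(2)]]) (use h(2)[of 0] h(2)[of 1] in simp_all)
qed

lemma s2_add:
  assumes A: "A \<in> obs" and a: "a \<in> vec_car A" and b: "b \<in> vec_car A"
  shows "s2 A (a \<oplus>\<^bsub>vec_sort A\<^esub> b) = s2 A a \<oplus>\<^bsub>vec_sort (F A)\<^esub> s2 A b"
proof -
  note P = vecP_facts
  obtain h where h: "h \<in> rep_hom vecP A" "snd h (vcls {} {0, 1} (fm_gen 0)) = a" "snd h (vcls {} {0, 1} (fm_gen 1)) = b"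
    using vecP_hom_ex[OF A a b] .
  have e: "vcls {} {0, 1} (fm_gen 0) \<oplus>\<^bsub>vec_sort vecP\<^esub> vcls {} {0, 1} (fm_gen 1) = vcls {} {0, 1} (fm_gen 0 + fm_gen 1)"
    by (subst obj_vec_simps) (auto intro: free_mod_on_gen)
  have c: "vcls {} {0, 1} (fm_gen 0 + fm_gen 1) \<in> vec_car vecP"
    using obs_vec_rules(1)[OF P(1-3)] by (simp only: e)
  show ?thesis
    using s2_push(1)[OF P(1) A h(1) P(4) P(2,3) c s2_add_gens] hom_simps(6)[OF h(1) P(2,3)] by (simp only: e h(2,3))
qed

lemma \<phi>2_add: "\<phi>2 (c + d) = \<phi>2 c + \<phi>2 d"
proof -
  have L: "vecL \<in> obs" by simp
  have add: "vcls {} {i} (fm_scale c (fm_gen i)) \<oplus>\<^bsub>vec_sort (obj {} {i})\<^esub> vcls {} {i} (fm_scale d (fm_gen i))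
      = vcls {} {i} (fm_scale (c + d) (fm_gen i))" for c d :: 'k and i
    by (simp add: obj_vec_simps free_mod_on_gen free_mod_on_scale fm.scale_left_distrib)
  have "vcls {} {j0} (fm_scale (\<phi>2 (c + d)) (fm_gen j0)) = vcls {} {j0} (fm_scale (\<phi>2 c + \<phi>2 d) (fm_gen j0))"
    using s2_add[OF L vecL_carrier vecL_carrier, of c d] by (simp only: add s2_vecL F_vecL)
  then show ?thesis by (simp add: vcls_gen_scale_eq)
qed

section \<open>The bracket and its constant\<close>

lemma \<phi>_numeral: "\<phi>1 2 = 2" "\<phi>2 2 = 2" "\<phi>1 2 * \<phi>1 3 = \<phi>1 6"
  using \<phi>1_add[of 1 1] \<phi>2_add[of 1 1] \<phi>1_mult[of 2 3] by (simp_all add: \<phi>1_01 \<phi>2_01)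

text \<open>The pulled back bracket of the generators is a word \<open>p\<close>. Scaling the
  generators by 2 and 3 scales \<open>p\<close> by 6, because the bracket of \<open>F lieP\<close>
  is bilinear and \<open>\<phi>1\<close> is multiplicative. So \<open>p\<close> has bidegree (1, 1),
  where the bracket of the generators spans everything.\<close>

lemma s1_bracket_ex:
  "\<exists>\<gamma>. \<forall>A\<in>obs. \<forall>a\<in>lie_car A. \<forall>b\<in>lie_car A.
    lie_bracket (lie_sort (F A)) (s1 A a) (s1 A b) = s1 A (\<gamma> \<odot>\<^bsub>lie_sort A\<^esub> lie_bracket (lie_sort A) a b)"
proof -
  note P = lieP_facts
  note FP = F_obs[OF P(1)] s1_in[OF P(1,2)] s1_in[OF P(1,3)]
  obtain p where p: "p \<in> lie_car lieP"
    "lie_bracket (lie_sort (F lieP)) (s1 lieP {fl_gen 0}) (s1 lieP {fl_gen 1}) = s1 lieP p"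
    using s1_surj[OF P(1) obs_lie_rules(3)[OF FP]] .
  obtain u where u: "u \<in> free_lie_on {0, 1}" "p = {u}" using p(1) by (auto simp: obj_lie_carrier)
  note push = s1_push(2)[OF P(1) _ _ P(2,3) p(1) p(2)[symmetric]]
  obtain T where T: "T \<in> rep_hom lieP lieP"
    "\<And>u. u \<in> free_lie_on {0, 1} \<Longrightarrow> fst T {u} = {fl_subst (\<lambda>x. fl_scale (if x = 0 then 2 else 3) (fl_gen x)) u}"
    by (rule lieP_endo[of "\<lambda>x. fl_scale (if x = 0 then 2 else 3) (fl_gen x)"]) (auto intro: lie_on_scale lie_on_gen)
  have T0: "fst T {fl_gen 0} = 2 \<odot>\<^bsub>lie_sort lieP\<^esub> {fl_gen 0}" "fst T {fl_gen 1} = 3 \<odot>\<^bsub>lie_sort lieP\<^esub> {fl_gen 1}"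
    by (simp_all only: T(2)[OF lieP_gens(1)] T(2)[OF lieP_gens(2)] fl_subst_simps lieP_smult[OF lieP_gens(1)]
        lieP_smult[OF lieP_gens(2)] if_True if_False one_neq_zero simp_thms)
  have "s1 lieP (fst T p) = lie_bracket (lie_sort (F lieP)) (\<phi>1 2 \<odot>\<^bsub>lie_sort (F lieP)\<^esub> s1 lieP {fl_gen 0})
      (\<phi>1 3 \<odot>\<^bsub>lie_sort (F lieP)\<^esub> s1 lieP {fl_gen 1})"
    using push[OF P(1) T(1)] by (simp only: T0 s1_scale[OF P(1,2)] s1_scale[OF P(1,3)])
  also have "\<dots> = \<phi>1 2 \<odot>\<^bsub>lie_sort (F lieP)\<^esub> (\<phi>1 3 \<odot>\<^bsub>lie_sort (F lieP)\<^esub> s1 lieP p)"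
    using obs_lie_rules(11)[OF FP(1,2) obs_lie_rules(2)[OF FP(1,3,3), of "\<phi>1 3"], of "\<phi>1 2"]
      obs_lie_rules(12)[OF FP, of "\<phi>1 3"] by (simp only: p(2))
  also have "\<dots> = \<phi>1 6 \<odot>\<^bsub>lie_sort (F lieP)\<^esub> s1 lieP p"
    using obs_lie_rules(6)[OF FP(1) s1_in[OF P(1) p(1)] s1_in[OF P(1) p(1)], of "\<phi>1 2" "\<phi>1 3"]
    by (simp only: \<phi>_numeral(3))
  also have "\<dots> = s1 lieP (6 \<odot>\<^bsub>lie_sort lieP\<^esub> p)" using s1_scale[OF P(1) p(1)] by simp
  finally have "fst T p = 6 \<odot>\<^bsub>lie_sort lieP\<^esub> p"
    by (rule s1_eqD[OF _ P(1) hom_simps(1)[OF T(1) p(1)] obs_lie_rules(2)[OF P(1) p(1) p(1)]])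
  then have "fl_subst (\<lambda>x. fl_scale (if x = 0 then 2 else 3) (fl_gen x)) u = fl_scale 6 u"
    by (simp only: u(2) T(2)[OF u(1)] lieP_smult[OF u(1)] singleton_inject)
  then obtain g where g: "u = fl_scale g (fl_bracket (fl_gen 0) (fl_gen 1))"
    by (rule lie_degree_one_one[OF u(1)])
  have "lie_bracket (lie_sort lieP) {fl_gen 0} {fl_gen 1} = {fl_bracket (fl_gen 0) (fl_gen 1)}"
    by (subst obj_lie_simps) (use lieP_gens in auto)
  then have pe: "p = g \<odot>\<^bsub>lie_sort lieP\<^esub> lie_bracket (lie_sort lieP) {fl_gen 0} {fl_gen 1}"
    by (simp only: u(2) g lieP_smult[OF lie_on_bracket[OF lieP_gens]])
  have "lie_bracket (lie_sort (F A)) (s1 A a) (s1 A b) = s1 A (g \<odot>\<^bsub>lie_sort A\<^esub> lie_bracket (lie_sort A) a b)"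
    if A: "A \<in> obs" and a: "a \<in> lie_car A" and b: "b \<in> lie_car A" for A a b
  proof -
    obtain h where h: "h \<in> rep_hom lieP A" "fst h {fl_gen 0} = a" "fst h {fl_gen 1} = b"
      using lieP_hom_ex[OF A a b] .
    have "fst h p = g \<odot>\<^bsub>lie_sort A\<^esub> lie_bracket (lie_sort A) a b"
      unfolding pe using hom_simps(4)[OF h(1) obs_lie_rules(3)[OF P]] hom_simps(5)[OF h(1) P(2,3)]
      by (simp only: h(2,3))
    then show ?thesis using push[OF A h(1)] by (simp only: h(2,3))
  qed
  then show ?thesis by blast
qed

section \<open>The action and its constant\<close>

abbreviation "actQ \<equiv> obj {0} {0}"

lemma actQ_facts: "actQ \<in> obs" "{fl_gen 0} \<in> lie_car actQ" "vcls {0} {0} (fm_gen 0) \<in> vec_car actQ"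
  by (auto intro: gen_carrier)

text \<open>The pulled back action of x on y is a word in one generator of each sort. Words are
  linear in y anyway, so the test scales x alone: doubling x doubles the word, which makes it a
  multiple of the action of x on y modulo the identities.\<close>

lemma s2_action_ex:
  "\<exists>\<delta>. \<forall>A\<in>obs. \<forall>a\<in>lie_car A. \<forall>v\<in>vec_car A.
    action (F A) (s1 A a) (s2 A v) = s2 A (\<delta> \<odot>\<^bsub>vec_sort A\<^esub> action A a v)"
proof -
  note Q = actQ_facts
  note FQ = F_obs[OF Q(1)] s1_in[OF Q(1,2)] s2_in[OF Q(1,3)]
  let ?y = "vcls {0} {0} (fm_gen 0)"
  obtain p where p: "p \<in> vec_car actQ"
    "action (F actQ) (s1 actQ {fl_gen 0}) (s2 actQ ?y) = s2 actQ p"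
    using s2_surj[OF Q(1) obs_action_rules(1)[OF FQ(1,2,2,3)]] .
  obtain u where u: "u \<in> free_mod_on {0} {0}" "p = vcls {0} {0} u" using p(1) by (auto simp: obj_vec_carrier)
  note push = s2_push(2)[OF Q(1) _ _ Q(2,3,3) p(1) p(2)[symmetric]]
  have val: "valid_subst {0} {0} {0} {0} (\<lambda>x. fl_scale 2 (fl_gen x)) fm_gen"
    by (simp add: valid_subst_def lie_on_scale lie_on_gen free_mod_on_gen)
  let ?T = "subst_hom {0} {0} {0} {0} (\<lambda>x. fl_scale 2 (fl_gen x)) fm_gen"
  have T: "?T \<in> rep_hom actQ actQ" by (rule subst_hom_in_hom[OF _ _ val]) auto
  have T0: "fst ?T {fl_gen 0} = 2 \<odot>\<^bsub>lie_sort actQ\<^esub> {fl_gen 0}" "snd ?T ?y = ?y"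
    by (simp_all add: subst_hom_simps[OF val] lie_on_gen free_mod_on_gen obj_lie_simps)
  \<comment> \<open>A scalar leaves the Lie sort through \<open>\<phi>1\<close> and returns through
    \<open>\<phi>2\<close>. The two are not yet known to agree, but by additivity both fix
    2.\<close>
  have "s2 actQ (snd ?T p) = action (F actQ) (2 \<odot>\<^bsub>lie_sort (F actQ)\<^esub> s1 actQ {fl_gen 0}) (s2 actQ ?y)"
    using push[OF Q(1) T] by (simp only: T0 s1_scale[OF Q(1,2)] \<phi>_numeral)
  also have "\<dots> = \<phi>2 2 \<odot>\<^bsub>vec_sort (F actQ)\<^esub> s2 actQ p"
    using obs_action_rules(2)[OF FQ(1,2,2,3), of 2] by (simp only: p(2) \<phi>_numeral)
  also have "\<dots> = s2 actQ (2 \<odot>\<^bsub>vec_sort actQ\<^esub> p)" using s2_scale[OF Q(1) p(1)] by simp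
  finally have "snd ?T p = 2 \<odot>\<^bsub>vec_sort actQ\<^esub> p"
    by (rule s2_eqD[OF _ Q(1) hom_simps(2)[OF T p(1)] obs_vec_rules(2)[OF Q(1) p(1) p(1)]])
  then have "vcls {0} {0} (fm_subst (\<lambda>x. fl_scale 2 (fl_gen x)) fm_gen u) = vcls {0} {0} (fm_scale 2 u)"
    by (simp add: u subst_hom_simps[OF val] obj_vec_simps)
  then have "fm_subst (\<lambda>x. fl_scale 2 (fl_gen x)) fm_gen u - fm_scale 2 u \<in> vec_ideal"
    by (subst (asm) vcls_eq_iff) (use valid_substD(2)[OF val u(1)] u in \<open>simp_all add: free_mod_on_scale\<close>)
  then obtain d where d: "u - fm_scale d (fm_mult (fl_iota (fl_gen 0)) (fm_gen 0)) \<in> vec_ideal"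
    by (rule vec_degree_one[OF u(1)])
  have "action actQ {fl_gen 0} ?y = vcls {0} {0} (fm_mult (fl_iota (fl_gen 0)) (fm_gen 0))"
    by (simp add: obj_action lie_on_gen free_mod_on_gen)
  then have "d \<odot>\<^bsub>vec_sort actQ\<^esub> action actQ {fl_gen 0} ?y = vcls {0} {0} (fm_scale d (fm_mult (fl_iota (fl_gen 0)) (fm_gen 0)))"
    by (simp add: obj_vec_simps lie_on_gen free_mod_on_gen free_mod_on_action)
  also have "\<dots> = p" unfolding u(2) using d u(1)
    by (subst vcls_eq_iff) (auto simp: free_mod_on_scale lie_on_gen free_mod_on_gen free_mod_on_action dest: vec_ideal_uminus)
  finally have pe: "p = d \<odot>\<^bsub>vec_sort actQ\<^esub> action actQ {fl_gen 0} ?y" by simp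
  have "action (F A) (s1 A a) (s2 A v) = s2 A (d \<odot>\<^bsub>vec_sort A\<^esub> action A a v)"
    if A: "A \<in> obs" and a: "a \<in> lie_car A" and v: "v \<in> vec_car A" for A a v
  proof -
    obtain X1 X2 where X: "finite X1" "A = obj X1 X2" using A by (auto simp: obs_def)
    obtain h where h: "h \<in> rep_hom actQ A" "\<And>x. x \<in> {0} \<Longrightarrow> fst h {fl_gen x} = a"
        "\<And>y. y \<in> {0} \<Longrightarrow> snd h (vcls {0} {0} (fm_gen y)) = v"
      unfolding X by (rule hom_ex[of "{0}" X1 "\<lambda>_. a" X2 "{0}" "\<lambda>_. v"]) (use a v X in auto)
    have h': "fst h {fl_gen 0} = a" "snd h ?y = v" using h(2,3) by simp_all
    have "snd h p = d \<odot>\<^bsub>vec_sort A\<^esub> action A a v"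
      unfolding pe using hom_simps(7)[OF h(1) obs_action_rules(1)[OF Q(1,2,2,3)]] hom_simps(8)[OF h(1) Q(2,3)]
      by (simp only: h')
    then show ?thesis using push[OF A h(1)] by (simp only: h')
  qed
  then show ?thesis by blast
qed

end

context action_variety
begin

lemma vcls_scale_cancel:
  assumes "v \<in> free_mod_on X1 X2" "v \<notin> vec_ideal" "vcls X1 X2 (fm_scale c v) = vcls X1 X2 (fm_scale d v)"
  shows "c = d"
proof -
  have "fm_scale (c - d) v \<in> vec_ideal"
    using assms by (simp add: vcls_eq_iff free_mod_on_scale fm.scale_left_diff_distrib)
  then show ?thesis using vec_ideal_scale_iff[of "c - d" v] assms(2) by auto
qed

end

section \<open>Comparison of the constants and of the maps of scalars\<close>

context theta_automorphism
begin

lemma actQ_action: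
  "action actQ {fl_gen 0} (vcls {0} {0} (fm_gen 0)) = vcls {0} {0} (fm_mult (fl_iota (fl_gen 0)) (fm_gen 0))"
  by (simp add: obj_action lie_on_gen free_mod_on_gen)

text \<open>If \<delta> were 0, the action would vanish on every object in the image of the functor.
  As every object occurs there, it would vanish on the free object with one generator of each sort,
  contrary to nondegeneracy.\<close>

lemma action_constant_nonzero:
  assumes "\<And>A a v. A \<in> obs \<Longrightarrow> a \<in> lie_car A \<Longrightarrow> v \<in> vec_car A \<Longrightarrow>
      action (F A) (s1 A a) (s2 A v) = s2 A (\<delta> \<odot>\<^bsub>vec_sort A\<^esub> action A a v)"
  shows "\<delta> \<noteq> 0"
proof
  assume \<delta>: "\<delta> = 0"
  note Q = actQ_facts
  obtain A where A: "A \<in> obs" "actQ = F A" using F_surj[OF Q(1)] .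
  obtain l where l: "l \<in> lie_car A" "{fl_gen 0} = s1 A l"
    using s1_surj[OF A(1) Q(2)[unfolded A(2)]] .
  obtain v where v: "v \<in> vec_car A" "vcls {0} {0} (fm_gen 0) = s2 A v"
    using s2_surj[OF A(1) Q(3)[unfolded A(2)]] .
  note c = obs_action_rules(1)[OF A(1) l(1) l(1) v(1)]
  have "action actQ {fl_gen 0} (vcls {0} {0} (fm_gen 0)) = 0 \<odot>\<^bsub>vec_sort actQ\<^esub> s2 A (action A l v)"
    unfolding l(2) v(2) A(2) using assms[OF A(1) l(1) v(1)] s2_zero[OF A(1) c] by (simp only: \<delta>)
  moreover have "s2 A (action A l v) \<in> vec_car actQ" unfolding A(2) by (rule s2_in[OF A(1) c])
  then obtain w where "w \<in> free_mod_on {0} {0}" "s2 A (action A l v) = vcls {0} {0} w"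
    by (auto simp: obj_vec_carrier)
  ultimately have "vcls {0} {0} (fm_mult (fl_iota (fl_gen 0)) (fm_gen 0)) = vcls {0} {0} 0"
    by (simp add: actQ_action obj_vec_simps)
  then show False
    using act_notin by (simp add: vcls_eq_iff free_mod_on_action lie_on_gen free_mod_on_gen free_mod_on_closed)
qed

text \<open>A scalar can be moved through the action from the Lie sort to the second sort. With
  \<open>c'\<close> chosen so that \<open>\<phi>2 c' = \<phi>1 c\<close>, this compares \<delta>c
  with c'\<delta> on a product that does not vanish.\<close>

lemma \<phi>1_eq_\<phi>2:
  assumes d: "\<And>A a v. A \<in> obs \<Longrightarrow> a \<in> lie_car A \<Longrightarrow> v \<in> vec_car A \<Longrightarrow>
      action (F A) (s1 A a) (s2 A v) = s2 A (\<delta> \<odot>\<^bsub>vec_sort A\<^esub> action A a v)"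
  shows "\<phi>1 c = \<phi>2 c"
proof -
  note Q = actQ_facts
  note FQ = F_obs[OF Q(1)] s1_in[OF Q(1,2)] s2_in[OF Q(1,3)]
  have \<delta>: "\<delta> \<noteq> 0" by (rule action_constant_nonzero) (rule d)
  let ?y = "vcls {0} {0} (fm_gen 0)" and ?x = "{fl_gen 0}"
  let ?xy = "fm_mult (fl_iota (fl_gen 0)) (fm_gen 0) :: 'k free_mod"
  have xy: "?xy \<in> free_mod_on {0} {0}" by (simp add: free_mod_on_action lie_on_gen free_mod_on_gen)
  obtain c' where c': "\<phi>2 c' = \<phi>1 c" using \<phi>2_inj_surj(2) by (metis surjD)
  note cw = obs_action_rules(1)[OF Q(1,2,2,3)]
  note cx = obs_lie_rules(2)[OF Q(1,2,2), of c]
  have "s2 actQ (\<delta> \<odot>\<^bsub>vec_sort actQ\<^esub> action actQ (c \<odot>\<^bsub>lie_sort actQ\<^esub> ?x) ?y)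
      = action (F actQ) (\<phi>1 c \<odot>\<^bsub>lie_sort (F actQ)\<^esub> s1 actQ ?x) (s2 actQ ?y)"
    using d[OF Q(1) cx Q(3)] by (simp only: s1_scale[OF Q(1,2)])
  also have "\<dots> = \<phi>2 c' \<odot>\<^bsub>vec_sort (F actQ)\<^esub> s2 actQ (\<delta> \<odot>\<^bsub>vec_sort actQ\<^esub> action actQ ?x ?y)"
    using obs_action_rules(2)[OF FQ(1,2,2,3)] by (simp only: d[OF Q] c')
  also have "\<dots> = s2 actQ (c' \<odot>\<^bsub>vec_sort actQ\<^esub> (\<delta> \<odot>\<^bsub>vec_sort actQ\<^esub> action actQ ?x ?y))"
    using s2_scale[OF Q(1) obs_vec_rules(2)[OF Q(1) cw cw]] by simp
  finally have "\<delta> \<odot>\<^bsub>vec_sort actQ\<^esub> action actQ (c \<odot>\<^bsub>lie_sort actQ\<^esub> ?x) ?y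
      = c' \<odot>\<^bsub>vec_sort actQ\<^esub> (\<delta> \<odot>\<^bsub>vec_sort actQ\<^esub> action actQ ?x ?y)"
    by (rule s2_eqD[OF _ Q(1) obs_vec_rules(2)[OF Q(1) obs_action_rules(1)[OF Q(1) cx cx Q(3)]
          obs_action_rules(1)[OF Q(1) cx cx Q(3)]]])
      (rule obs_vec_rules(2)[OF Q(1) obs_vec_rules(2)[OF Q(1) cw cw] obs_vec_rules(2)[OF Q(1) cw cw]])
  then have "vcls {0} {0} (fm_scale (\<delta> * c) ?xy) = vcls {0} {0} (fm_scale (c' * \<delta>) ?xy)"
    using xy by (simp add: obs_action_rules(2)[OF Q(1,2,2,3)] actQ_action obj_vec_simps free_mod_on_scale)
  then have "\<delta> * c = c' * \<delta>" by (rule vcls_scale_cancel[OF xy act_notin])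
  then show ?thesis using c' \<delta> by simp
qed

text \<open>Write b for the bracket of the generators x0 and x1. The law of a Lie action in
  \<open>F ?R\<close>, pulled back, says that \<delta>\<gamma> b y = \<delta>\<delta> (x0 x1 y - x1
  x0 y) modulo the identities. The right side is \<delta>\<delta> b y, and b y does not vanish by
  nondegeneracy.\<close>

lemma bracket_constant_eq:
  assumes d: "\<And>A a v. A \<in> obs \<Longrightarrow> a \<in> lie_car A \<Longrightarrow> v \<in> vec_car A \<Longrightarrow>
      action (F A) (s1 A a) (s2 A v) = s2 A (\<delta> \<odot>\<^bsub>vec_sort A\<^esub> action A a v)"
    and g: "\<And>A a b. A \<in> obs \<Longrightarrow> a \<in> lie_car A \<Longrightarrow> b \<in> lie_car A \<Longrightarrow>
      lie_bracket (lie_sort (F A)) (s1 A a) (s1 A b) = s1 A (\<gamma> \<odot>\<^bsub>lie_sort A\<^esub> lie_bracket (lie_sort A) a b)"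
  shows "\<gamma> = \<delta>"
proof -
  have \<delta>: "\<delta> \<noteq> 0" by (rule action_constant_nonzero) (rule d)
  let ?R = "obj {0, 1} {0}"
  let ?x0 = "{fl_gen 0} :: 'k free_lie set" and ?x1 = "{fl_gen 1} :: 'k free_lie set" and ?y = "vcls {0, 1} {0} (fm_gen 0)"
  have R: "?R \<in> obs" "?x0 \<in> lie_car ?R" "?x1 \<in> lie_car ?R" "?y \<in> vec_car ?R"
    by (auto intro: gen_carrier)
  note FR = F_obs[OF R(1)] s1_in[OF R(1,2)] s1_in[OF R(1,3)] s2_in[OF R(1,4)]
  note br = obs_lie_rules(3)[OF R(1-3)]
  note gbr = obs_lie_rules(2)[OF R(1) br br, of \<gamma>]
  note a0 = obs_action_rules(1)[OF R(1,2,2,4)] and a1 = obs_action_rules(1)[OF R(1,3,3,4)]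
  note d0 = obs_vec_rules(2)[OF R(1) a0 a0, of \<delta>] and d1 = obs_vec_rules(2)[OF R(1) a1 a1, of \<delta>]
  note e0 = obs_action_rules(1)[OF R(1,3,3) d0] and e1 = obs_action_rules(1)[OF R(1,2,2) d1]
  note ab = obs_action_rules(1)[OF R(1) gbr gbr R(4)]
  note dab = obs_vec_rules(2)[OF R(1) ab ab, of \<delta>] and de0 = obs_vec_rules(2)[OF R(1) e0 e0, of \<delta>]
    and de1 = obs_vec_rules(2)[OF R(1) e1 e1, of \<delta>]
  let ?A = "\<delta> \<odot>\<^bsub>vec_sort ?R\<^esub> action ?R (\<gamma> \<odot>\<^bsub>lie_sort ?R\<^esub> lie_bracket (lie_sort ?R) ?x0 ?x1) ?y"
  let ?B = "\<delta> \<odot>\<^bsub>vec_sort ?R\<^esub> action ?R ?x1 (\<delta> \<odot>\<^bsub>vec_sort ?R\<^esub> action ?R ?x0 ?y)"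
  let ?C = "\<delta> \<odot>\<^bsub>vec_sort ?R\<^esub> action ?R ?x0 (\<delta> \<odot>\<^bsub>vec_sort ?R\<^esub> action ?R ?x1 ?y)"
  have "s2 ?R (?A \<oplus>\<^bsub>vec_sort ?R\<^esub> ?B) = s2 ?R ?C"
    using obs_action_rules(4)[OF FR]
    by (simp only: g[OF R(1-3)] d[OF R(1) gbr R(4)] d[OF R(1,2,4)] d[OF R(1,3,4)] d[OF R(1,3) d0] d[OF R(1,2) d1]
        s2_add[OF R(1) dab de0])
  then have eq: "?A \<oplus>\<^bsub>vec_sort ?R\<^esub> ?B = ?C"
    by (rule s2_eqD[OF _ R(1) obs_vec_rules(1)[OF R(1) dab de0] de1])
  let ?v = "fm_gen 0 :: 'k free_mod"
  let ?m0 = "fm_mult (fl_iota (fl_gen 0)) :: 'k free_mod \<Rightarrow> _" and ?m1 = "fm_mult (fl_iota (fl_gen 1)) :: 'k free_mod \<Rightarrow> _"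
  have c: "fl_gen 0 \<in> free_lie_on {0, 1}" "fl_gen 1 \<in> free_lie_on {0, 1}" "?v \<in> free_mod_on {0, 1} {0}"
    by (auto intro: lie_on_gen free_mod_on_gen)
  define b where "b = (fl_bracket (fl_gen 0) (fl_gen 1) :: 'k free_lie)"
  have bc: "b \<in> free_lie_on {0, 1}" unfolding b_def by (intro lie_on_bracket c)
  note cl = c bc free_mod_on_action free_mod_on_scale lie_on_scale
  have A: "?A = vcls {0, 1} {0} (fm_scale (\<delta> * \<gamma>) (fm_mult (fl_iota b) ?v))"
    by (simp add: obj_action obj_lie_simps obj_vec_simps cl fm_mult_iota_scale flip: b_def del: One_nat_def)
  have B: "?B = vcls {0, 1} {0} (fm_scale (\<delta> * \<delta>) (?m1 (?m0 ?v)))"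
    by (simp add: obj_action obj_lie_simps obj_vec_simps cl fm_mult_scale del: One_nat_def)
  have C: "?C = vcls {0, 1} {0} (fm_scale (\<delta> * \<delta>) (?m0 (?m1 ?v)))"
    by (simp add: obj_action obj_lie_simps obj_vec_simps cl fm_mult_scale del: One_nat_def)
  have "vcls {0, 1} {0} (fm_scale (\<delta> * \<gamma>) (fm_mult (fl_iota b) ?v) + fm_scale (\<delta> * \<delta>) (?m1 (?m0 ?v)))
      = vcls {0, 1} {0} (fm_scale (\<delta> * \<delta>) (?m0 (?m1 ?v)))"
    using eq unfolding A B C by (simp add: obj_vec_simps cl del: One_nat_def)
  then have "fm_scale (\<delta> * \<gamma>) (fm_mult (fl_iota b) ?v) + fm_scale (\<delta> * \<delta>) (?m1 (?m0 ?v))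
      - fm_scale (\<delta> * \<delta>) (?m0 (?m1 ?v)) \<in> vec_ideal"
    by (subst (asm) vcls_eq_iff) (simp_all add: cl free_mod_on_closed(2) del: One_nat_def)
  moreover have "fm_mult (fl_iota b) ?v = ?m0 (?m1 ?v) - ?m1 (?m0 ?v)"
    unfolding b_def fl_iota_simps fm_mult_simps(3,5) by simp
  moreover have "fm_scale c (x - y) + fm_scale d y - fm_scale d x = fm_scale (c - d) (x - y)"
    for c d :: 'k and x y :: "'k free_mod"
    by (simp add: fm.scale_left_diff_distrib fm.scale_right_diff_distrib algebra_simps)
  ultimately have "fm_scale (\<delta> * \<gamma> - \<delta> * \<delta>) (fm_mult (fl_iota b) ?v) \<in> vec_ideal"
    by simp
  then have "\<delta> * \<gamma> - \<delta> * \<delta> = 0"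
    using vec_ideal_scale_iff[of "\<delta> * \<gamma> - \<delta> * \<delta>" "fm_mult (fl_iota b) ?v"] bracket_act_notin unfolding b_def by blast
  then show ?thesis using \<delta> by (simp add: algebra_simps)
qed

lemma semilinear_family_exists:
  "\<exists>\<alpha> t1 t2. bij \<alpha> \<and> (\<forall>c d. \<alpha> (c + d) = \<alpha> c + \<alpha> d) \<and> (\<forall>c d. \<alpha> (c * d) = \<alpha> c * \<alpha> d) \<and>
    semilinear_family \<alpha> F f t1 t2"
proof -
  obtain \<delta> where d: "\<And>A a v. A \<in> obs \<Longrightarrow> a \<in> lie_car A \<Longrightarrow> v \<in> vec_car A \<Longrightarrow>
      action (F A) (s1 A a) (s2 A v) = s2 A (\<delta> \<odot>\<^bsub>vec_sort A\<^esub> action A a v)"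
    using s2_action_ex by blast
  obtain \<gamma> where g: "\<And>A a b. A \<in> obs \<Longrightarrow> a \<in> lie_car A \<Longrightarrow> b \<in> lie_car A \<Longrightarrow>
      lie_bracket (lie_sort (F A)) (s1 A a) (s1 A b) = s1 A (\<gamma> \<odot>\<^bsub>lie_sort A\<^esub> lie_bracket (lie_sort A) a b)"
    using s1_bracket_ex by blast
  have \<delta>: "\<delta> \<noteq> 0" by (rule action_constant_nonzero) (rule d)
  have \<gamma>: "\<gamma> = \<delta>" by (rule bracket_constant_eq) (rule d g; assumption)+
  have \<phi>: "\<phi>2 = \<phi>1" using \<phi>1_eq_\<phi>2[OF d] by auto
  \<comment> \<open>With \<open>t1\<close> the map \<open>s1\<close> after multiplication by
    \<open>e\<close>, the bracket acquires the factor \<delta>ee = e, which is just the factor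
    inside \<open>t1\<close>, and the action acquires \<delta>e = 1. The second sort is left as it
    is.\<close>
  define e where "e = inverse \<delta>"
  have e: "e \<noteq> 0" "\<delta> * e = 1" "e * \<delta> = 1" using \<delta> by (simp_all add: e_def)
  define t1 where "t1 A a = s1 A (e \<odot>\<^bsub>lie_sort A\<^esub> a)" for A a
  have "semilinear_family \<phi>1 F f t1 s2"
    unfolding semilinear_family_def
  proof (intro conjI ballI allI)
    fix A assume A: "A \<in> obs"
    have sc: "c \<odot>\<^bsub>lie_sort A\<^esub> a \<in> lie_car A" if "a \<in> lie_car A" for c a
      by (rule obs_lie_rules(2)[OF A that that])
    have scsc: "c \<odot>\<^bsub>lie_sort A\<^esub> (d \<odot>\<^bsub>lie_sort A\<^esub> a) = (c * d) \<odot>\<^bsub>lie_sort A\<^esub> a"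
      if "a \<in> lie_car A" for c d a
      by (rule obs_lie_rules(6)[OF A that that])
    have sc1: "1 \<odot>\<^bsub>lie_sort A\<^esub> a = a" if "a \<in> lie_car A" for a
      by (rule obs_lie_rules(7)[OF A that that])
    have "bij_betw (\<lambda>a. e \<odot>\<^bsub>lie_sort A\<^esub> a) (lie_car A) (lie_car A)"
      by (rule bij_betw_byWitness[where f' = "\<lambda>a. \<delta> \<odot>\<^bsub>lie_sort A\<^esub> a"]) (auto simp: sc scsc sc1 e)
    from bij_betw_trans[OF this s1_bij[OF A]]
    show "bij_betw (t1 A) (lie_car A) (lie_car (F A))"
      by (simp add: t1_def[abs_def] comp_def)
    show "bij_betw (s2 A) (vec_car A) (vec_car (F A))" by (rule s2_bij[OF A])
    show "t1 A (a \<oplus>\<^bsub>lie_sort A\<^esub> b) = t1 A a \<oplus>\<^bsub>lie_sort (F A)\<^esub> t1 A b"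
      if ab: "a \<in> lie_car A" "b \<in> lie_car A" for a b
      unfolding t1_def using s1_add[OF A sc[OF ab(1)] sc[OF ab(2)]] by (simp only: obs_lie_rules(4)[OF A ab])
    show "t1 A (lie_bracket (lie_sort A) a b) = lie_bracket (lie_sort (F A)) (t1 A a) (t1 A b)"
      if ab: "a \<in> lie_car A" "b \<in> lie_car A" for a b
    proof -
      have "\<delta> \<odot>\<^bsub>lie_sort A\<^esub> lie_bracket (lie_sort A) (e \<odot>\<^bsub>lie_sort A\<^esub> a) (e \<odot>\<^bsub>lie_sort A\<^esub> b)
          = (\<delta> * (e * e)) \<odot>\<^bsub>lie_sort A\<^esub> lie_bracket (lie_sort A) a b"
        by (simp only: obs_lie_rules(11)[OF A ab(1) sc[OF ab(2)]] obs_lie_rules(12)[OF A ab]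
          scsc obs_lie_rules(3)[OF A ab] mult.assoc)
      moreover have "\<delta> * (e * e) = e" using e(2) by (simp flip: mult.assoc)
      ultimately show ?thesis unfolding t1_def g[OF A sc[OF ab(1)] sc[OF ab(2)]] \<gamma> by simp
    qed
    show "s2 A (v \<oplus>\<^bsub>vec_sort A\<^esub> w) = s2 A v \<oplus>\<^bsub>vec_sort (F A)\<^esub> s2 A w"
      if "v \<in> vec_car A" "w \<in> vec_car A" for v w
      by (rule s2_add[OF A that])
    show "t1 A (c \<odot>\<^bsub>lie_sort A\<^esub> a) = \<phi>1 c \<odot>\<^bsub>lie_sort (F A)\<^esub> t1 A a" if "a \<in> lie_car A" for c a
      unfolding t1_def using s1_scale[OF A sc[OF that], of c e] that by (simp add: scsc mult.commute)
    show "s2 A (c \<odot>\<^bsub>vec_sort A\<^esub> v) = \<phi>1 c \<odot>\<^bsub>vec_sort (F A)\<^esub> s2 A v" if "v \<in> vec_car A" for c v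
      using s2_scale[OF A that] by (simp only: \<phi>)
    show "s2 A (action A a v) = action (F A) (t1 A a) (s2 A v)"
      if a: "a \<in> lie_car A" and v: "v \<in> vec_car A" for a v
    proof -
      note w = obs_action_rules(1)[OF A a a v]
      show ?thesis unfolding t1_def d[OF A sc[OF a] v] obs_action_rules(2)[OF A a a v]
        obs_vec_rules(5)[OF A w w] e(2) obs_vec_rules(6)[OF A w w] ..
    qed
    fix B h assume B: "B \<in> obs" and h: "h \<in> rep_hom A B"
    show "t1 B (fst h a) = fst (fst (snd (f (A, h, B)))) (t1 A a)" if a: "a \<in> lie_car A" for a
      unfolding t1_def using s1_nat[OF A B h sc[OF a], of e] hom_simps(4)[OF h a, of e] by (simp add: fmap_def)
    show "s2 B (snd h v) = snd (fst (snd (f (A, h, B)))) (s2 A v)" if v: "v \<in> vec_car A" for v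
      using s2_nat[OF A B h v] by (simp add: fmap_def)
  qed
  moreover have "bij \<phi>1" using \<phi>1_inj_surj by (simp add: bij_def)
  ultimately show ?thesis using \<phi>1_add \<phi>1_mult by blast
qed

end

section \<open>Field automorphisms acting on coefficients\<close>

lemma lookup_map_zero: "h 0 = 0 \<Longrightarrow> Poly_Mapping.lookup (Poly_Mapping.map h p) k = h (Poly_Mapping.lookup p k)"
  by transfer (simp add: when_def)

locale field_automorphism =
  fixes \<alpha> :: "'k::field_char_0 \<Rightarrow> 'k"
  assumes bij: "bij \<alpha>" and add: "\<alpha> (c + d) = \<alpha> c + \<alpha> d" and mult: "\<alpha> (c * d) = \<alpha> c * \<alpha> d"
begin

lemma zero [simp]: "\<alpha> 0 = 0"
  using add[of 0 0] by simp

lemma one [simp]: "\<alpha> 1 = 1"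
proof -
  have "\<alpha> 1 \<noteq> 0" using bij zero by (metis bij_pointE zero_neq_one)
  then show ?thesis using mult[of 1 1] by simp
qed

lemma uminus: "\<alpha> (- c) = - \<alpha> c"
  using add[of c "- c"] by (simp add: eq_neg_iff_add_eq_0 add.commute)

lemma of_nat: "\<alpha> (of_nat n) = of_nat n"
  by (induction n) (simp_all add: add)

lemma of_int: "\<alpha> (of_int n) = of_int n"
  by (cases n) (simp_all add: of_nat uminus add del: of_nat_Suc)

text \<open>Each axiom with scalars is carried to an instance of the same axiom, since
  \<open>\<alpha>\<close> respects sums and products and fixes 1 and -1.\<close>

lemma lie_eq_map: "lie_eq s t \<Longrightarrow> lie_eq (map_lie_term \<alpha> s) (map_lie_term \<alpha> t)"
proof (induction rule: lie_eq.induct)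
  case (lie_sym s t)
  from lie_sym.IH show ?case by (rule lie_eq.lie_sym)
next
  case (lie_trans s t u)
  from lie_trans.IH show ?case by (rule lie_eq.lie_trans)
qed (simp_all add: add mult uminus lie_refl lie_cong_add lie_cong_scale lie_cong_bracket lie_add_assoc
    lie_add_commute lie_add_zero lie_add_minus lie_scale_add_right lie_scale_add_left lie_scale_scale
    lie_scale_one lie_bracket_add_left lie_bracket_add_right lie_bracket_scale_left
    lie_bracket_scale_right lie_bracket_self lie_jacobi)

definition fl_map :: "'k free_lie \<Rightarrow> 'k free_lie" where
  "fl_map u = abs_free_lie (map_lie_term \<alpha> (rep_free_lie u))"

lemma fl_map_abs: "fl_map (abs_free_lie t) = abs_free_lie (map_lie_term \<alpha> t)"
proof -
  have "lie_eq (rep_free_lie (abs_free_lie t)) t"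
    unfolding free_lie.abs_eq_iff[symmetric] by (rule Quotient3_abs_rep[OF Quotient3_free_lie])
  then show ?thesis unfolding fl_map_def free_lie.abs_eq_iff by (rule lie_eq_map)
qed

lemma fl_map_simps [simp]:
  "fl_map (fl_gen x) = fl_gen x"
  "fl_map 0 = 0"
  "fl_map (u + w) = fl_map u + fl_map w"
  "fl_map (fl_scale c u) = fl_scale (\<alpha> c) (fl_map u)"
  "fl_map (fl_bracket u w) = fl_bracket (fl_map u) (fl_map w)"
proof -
  obtain s t where st: "u = abs_free_lie s" "w = abs_free_lie t"
    by (metis Quotient3_abs_rep Quotient3_free_lie)
  show "fl_map (fl_gen x) = fl_gen x" by (simp add: fl_gen.abs_eq fl_map_abs)
  show "fl_map 0 = 0" by (simp add: zero_free_lie.abs_eq fl_map_abs)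
  show "fl_map (u + w) = fl_map u + fl_map w" by (simp add: st plus_free_lie.abs_eq fl_map_abs)
  show "fl_map (fl_scale c u) = fl_scale (\<alpha> c) (fl_map u)" by (simp add: st fl_scale.abs_eq fl_map_abs)
  show "fl_map (fl_bracket u w) = fl_bracket (fl_map u) (fl_map w)"
    by (simp add: st fl_bracket.abs_eq fl_map_abs)
qed

definition fa_map :: "'k free_assoc \<Rightarrow> 'k free_assoc" where "fa_map = Poly_Mapping.map \<alpha>"

lemma lookup_fa_map [simp]: "Poly_Mapping.lookup (fa_map a) w = \<alpha> (Poly_Mapping.lookup a w)"
  by (simp add: fa_map_def lookup_map_zero)

lemma fa_map_simps [simp]:
  "fa_map 0 = 0" "fa_map (a + b) = fa_map a + fa_map b" "fa_map (Poly_Mapping.single w c) = Poly_Mapping.single w (\<alpha> c)"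
  by (auto intro!: poly_mapping_eqI simp: lookup_add add lookup_single when_def)

lemma fa_map_minus [simp]: "fa_map (a - b) = fa_map a - fa_map b"
  using fa_map_simps(2)[of "a - b" b] by (simp del: fa_map_simps(2))

lemma fa_map_mult [simp]: "fa_map (a * b) = fa_map a * fa_map b"
proof (induction a rule: pm_induct)
  case (add w c a)
  have "fa_map (Poly_Mapping.single w c * b) = fa_map (Poly_Mapping.single w c) * fa_map b"
  proof (induction b rule: pm_induct)
    case (add w' c' b)
    then show ?case by (simp add: distrib_left mult_single mult)
  qed simp
  then show ?case using add by (simp add: distrib_right)
qed simp

lemma fl_iota_map: "fl_iota (fl_map u) = fa_map (fl_iota u)"
  by (induction u rule: free_lie_induct) (simp_all add: fl_iota_simps fa_gen_def)

definition fm_map :: "'k free_mod \<Rightarrow> 'k free_mod" where "fm_map = Poly_Mapping.map fa_map"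

lemma lookup_fm_map [simp]: "Poly_Mapping.lookup (fm_map v) y = fa_map (Poly_Mapping.lookup v y)"
  by (simp add: fm_map_def lookup_map_zero)

lemma fm_map_simps [simp]:
  "fm_map 0 = 0" "fm_map (v + w) = fm_map v + fm_map w" "fm_map (fm_gen y) = fm_gen y"
  "fm_map (fm_mult a v) = fm_mult (fa_map a) (fm_map v)" "fm_map (fm_scale c v) = fm_scale (\<alpha> c) (fm_map v)"
proof -
  have one: "fa_map 1 = 1" using fa_map_simps(3)[of 0 1] by (simp del: fa_map_simps(3))
  show m: "fm_map (fm_mult a v) = fm_mult (fa_map a) (fm_map v)" for a v by (rule poly_mapping_eqI) simp
  show "fm_map 0 = 0" by (rule poly_mapping_eqI) simp
  show "fm_map (v + w) = fm_map v + fm_map w" by (rule poly_mapping_eqI) (simp add: lookup_add)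
  show "fm_map (fm_gen y) = fm_gen y"
    by (rule poly_mapping_eqI) (simp add: fm_gen_def lookup_single when_def one)
  show "fm_map (fm_scale c v) = fm_scale (\<alpha> c) (fm_map v)" by (simp add: fm_scale_def m)
qed

lemma fm_map_minus: "fm_map (v - w) = fm_map v - fm_map w"
  using fm_map_simps(2)[of "v - w" w] by (simp del: fm_map_simps(2))

lemma fl_map_closed: "u \<in> free_lie_on X1 \<Longrightarrow> fl_map u \<in> free_lie_on X1"
  by (induction rule: free_lie_on.induct) (simp_all add: free_lie_on.intros)

lemma fm_map_closed: "v \<in> free_mod_on X1 X2 \<Longrightarrow> fm_map v \<in> free_mod_on X1 X2"
proof (induction rule: free_mod_on_induct)
  case (action x v)
  have "fa_map (fa_gen x) = fl_iota (fl_gen x)" by (simp add: fa_gen_def fl_iota_simps)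
  then show ?case using action by (simp add: free_mod_on_action lie_on_gen)
qed (simp_all add: free_mod_on_closed free_mod_on_gen free_mod_on_scale)

text \<open>A field automorphism fixes the integers, so identities with integer coefficients are
  fixed points of its action on coefficients.\<close>

lemma fl_map_int: "u \<in> int_free_lie \<Longrightarrow> fl_map u = u"
proof -
  have m: "fl_map m = m" if "m \<in> lie_monomials" for m
    using that by induction simp_all
  assume "u \<in> int_free_lie"
  then obtain S and c :: "'k free_lie \<Rightarrow> int" where S: "finite S" "S \<subseteq> lie_monomials"
    "u = (\<Sum>m\<in>S. fl_scale (of_int (c m)) m)" by (auto simp: int_free_lie_def)
  have "fl_map (\<Sum>m\<in>S. fl_scale (of_int (c m)) m) = (\<Sum>m\<in>S. fl_scale (of_int (c m)) m)"
    using S(1,2) by (induction S rule: finite_induct) (simp_all add: m of_int)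
  then show ?thesis using S(3) by simp
qed

lemma fm_map_int: "u \<in> int_free_mod \<Longrightarrow> fm_map u = u"
proof (intro poly_mapping_eqI)
  fix y w assume "u \<in> int_free_mod"
  then have "Poly_Mapping.lookup (Poly_Mapping.lookup u y) w \<in> \<int>" by (simp add: int_free_mod_def)
  then obtain n where "Poly_Mapping.lookup (Poly_Mapping.lookup u y) w = of_int n" by (rule Ints_cases)
  then show "Poly_Mapping.lookup (Poly_Mapping.lookup (fm_map u) y) w = Poly_Mapping.lookup (Poly_Mapping.lookup u y) w"
    by (simp add: of_int)
qed

end

lemma field_automorphism_inv:
  assumes "field_automorphism \<alpha>"
  shows "field_automorphism (inv_into UNIV \<alpha>)"
proof -
  interpret field_automorphism \<alpha> by fact
  have i: "inv_into UNIV \<alpha> (\<alpha> c) = c" "\<alpha> (inv_into UNIV \<alpha> c) = c" for c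
    using bij by (simp_all add: bij_is_inj bij_is_surj surj_f_inv_f)
  show ?thesis
  proof
    show "bij (inv_into UNIV \<alpha>)" by (rule bij_imp_bij_inv[OF bij])
    show "inv_into UNIV \<alpha> (c + d) = inv_into UNIV \<alpha> c + inv_into UNIV \<alpha> d" for c d
      using i add[of "inv_into UNIV \<alpha> c" "inv_into UNIV \<alpha> d"] by metis
    show "inv_into UNIV \<alpha> (c * d) = inv_into UNIV \<alpha> c * inv_into UNIV \<alpha> d" for c d
      using i mult[of "inv_into UNIV \<alpha> c" "inv_into UNIV \<alpha> d"] by metis
  qed
qed

lemma fl_map_inverse:
  assumes "field_automorphism \<alpha>" "field_automorphism \<beta>" "\<And>c. \<beta> (\<alpha> c) = c"
  shows "field_automorphism.fl_map \<beta> (field_automorphism.fl_map \<alpha> u) = u"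
    "field_automorphism.fm_map \<beta> (field_automorphism.fm_map \<alpha> v) = v"
proof -
  interpret a: field_automorphism \<alpha> by fact
  interpret b: field_automorphism \<beta> by fact
  show "b.fl_map (a.fl_map u) = u"
    by (induction u rule: free_lie_induct) (simp_all add: assms(3))
  show "b.fm_map (a.fm_map v) = v"
    by (intro poly_mapping_eqI) (simp add: assms(3))
qed

section \<open>Twisting the scalars of a representation\<close>

text \<open>Restriction of scalars along \<open>\<alpha>\<close>: the same sets, sums, bracket and
  action, with the scalar \<open>c\<close> operating as \<open>\<alpha> c\<close>.\<close>

definition twist :: "('k \<Rightarrow> 'k) \<Rightarrow> ('k, 'l, 'v) lie_rep \<Rightarrow> ('k, 'l, 'v) lie_rep" where
  "twist \<alpha> H = H\<lparr>lie_sort := (lie_sort H)\<lparr>module.smult := \<lambda>c. module.smult (lie_sort H) (\<alpha> c)\<rparr>,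
    vec_sort := (vec_sort H)\<lparr>module.smult := \<lambda>c. module.smult (vec_sort H) (\<alpha> c)\<rparr>\<rparr>"

lemma twist_simps [simp]:
  "lie_car (twist \<alpha> H) = lie_car H" "vec_car (twist \<alpha> H) = vec_car H"
  "x \<oplus>\<^bsub>lie_sort (twist \<alpha> H)\<^esub> y = x \<oplus>\<^bsub>lie_sort H\<^esub> y" "v \<oplus>\<^bsub>vec_sort (twist \<alpha> H)\<^esub> w = v \<oplus>\<^bsub>vec_sort H\<^esub> w"
  "\<zero>\<^bsub>lie_sort (twist \<alpha> H)\<^esub> = \<zero>\<^bsub>lie_sort H\<^esub>" "\<zero>\<^bsub>vec_sort (twist \<alpha> H)\<^esub> = \<zero>\<^bsub>vec_sort H\<^esub>"
  "c \<odot>\<^bsub>lie_sort (twist \<alpha> H)\<^esub> x = \<alpha> c \<odot>\<^bsub>lie_sort H\<^esub> x" "c \<odot>\<^bsub>vec_sort (twist \<alpha> H)\<^esub> v = \<alpha> c \<odot>\<^bsub>vec_sort H\<^esub> v"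
  "lie_bracket (lie_sort (twist \<alpha> H)) = lie_bracket (lie_sort H)" "action (twist \<alpha> H) = action H"
  by (simp_all add: twist_def)

lemma twist_minus: "v \<ominus>\<^bsub>vec_sort (twist \<alpha> H)\<^esub> w = v \<ominus>\<^bsub>vec_sort H\<^esub> w"
  by (simp add: a_minus_def a_inv_def m_inv_def twist_def)

lemma abelian_group_cong:
  assumes "abelian_group V" "carrier W = carrier V" "add W = add V" "\<zero>\<^bsub>W\<^esub> = \<zero>\<^bsub>V\<^esub>"
  shows "abelian_group W"
proof -
  interpret abelian_group V by fact
  show ?thesis
  proof (rule abelian_groupI)
    fix x assume "x \<in> carrier W"
    then show "\<exists>y\<in>carrier W. y \<oplus>\<^bsub>W\<^esub> x = \<zero>\<^bsub>W\<^esub>"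
      by (intro bexI[of _ "\<ominus>\<^bsub>V\<^esub> x"]) (simp_all add: assms(2-4) l_neg)
  qed (simp_all add: assms(2-4) a_ac)
qed

context field_automorphism
begin

lemma twist_module:
  assumes "module (ring_of_type_algebra :: 'k ring) V" "abelian_group W"
    "carrier W = carrier V" "add W = add V"
    "\<And>c x. c \<odot>\<^bsub>W\<^esub> x = \<alpha> c \<odot>\<^bsub>V\<^esub> x"
  shows "module (ring_of_type_algebra :: 'k ring) W"
proof -
  interpret module "ring_of_type_algebra :: 'k ring" V by fact
  have K: "carrier (ring_of_type_algebra :: 'k ring) = UNIV" by (simp add: ring_of_type_algebra_def)
  have ops: "c \<oplus>\<^bsub>ring_of_type_algebra\<^esub> d = c + d" "c \<otimes>\<^bsub>ring_of_type_algebra\<^esub> d = c * d"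
    "\<one>\<^bsub>ring_of_type_algebra\<^esub> = (1::'k)" for c d :: 'k
    by (simp_all add: ring_of_type_algebra_def)
  show ?thesis
  proof (rule moduleI)
    fix a b :: 'k and x y assume xy: "x \<in> carrier W" "y \<in> carrier W"
    show "(a \<oplus>\<^bsub>ring_of_type_algebra\<^esub> b) \<odot>\<^bsub>W\<^esub> x = a \<odot>\<^bsub>W\<^esub> x \<oplus>\<^bsub>W\<^esub> b \<odot>\<^bsub>W\<^esub> x"
      using xy smult_l_distr[of "\<alpha> a" "\<alpha> b" x] by (simp add: assms(3-5) K ops add)
    show "a \<odot>\<^bsub>W\<^esub> (x \<oplus>\<^bsub>W\<^esub> y) = a \<odot>\<^bsub>W\<^esub> x \<oplus>\<^bsub>W\<^esub> a \<odot>\<^bsub>W\<^esub> y"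
      using xy smult_r_distr[of "\<alpha> a" x y] by (simp add: assms(3-5) K)
    show "(a \<otimes>\<^bsub>ring_of_type_algebra\<^esub> b) \<odot>\<^bsub>W\<^esub> x = a \<odot>\<^bsub>W\<^esub> (b \<odot>\<^bsub>W\<^esub> x)"
      using xy smult_assoc1[of "\<alpha> a" "\<alpha> b" x] by (simp add: assms(3-5) K ops mult)
    show "a \<odot>\<^bsub>W\<^esub> x \<in> carrier W" using xy smult_closed[of "\<alpha> a" x] by (simp add: assms(3,5) K)
    show "\<one>\<^bsub>ring_of_type_algebra\<^esub> \<odot>\<^bsub>W\<^esub> x = x" using xy smult_one[of x] by (simp add: assms(3,5) ops)
  qed (use assms(2) cring_from_type_algebra in auto)
qed

lemma is_lie_rep_twist:
  assumes "is_lie_rep (H :: ('k, 'l, 'v) lie_rep)"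
  shows "is_lie_rep (twist \<alpha> H)"
proof -
  note H = assms[unfolded is_lie_rep_def Let_def]
  note L = H[THEN conjunct1, unfolded is_lie_algebra_def]
  note mL = L[THEN conjunct1] and mV = H[THEN conjunct2, THEN conjunct1]
  have "abelian_group (lie_sort (twist \<alpha> H))"
    by (rule abelian_group_cong[OF module.axioms(2)[OF mL]]) (simp_all add: twist_def)
  then have 1: "module (ring_of_type_algebra :: 'k ring) (lie_sort (twist \<alpha> H))"
    by (rule twist_module[OF mL]) (simp_all add: twist_def)
  have "abelian_group (vec_sort (twist \<alpha> H))"
    by (rule abelian_group_cong[OF module.axioms(2)[OF mV]]) (simp_all add: twist_def)
  then have 2: "module (ring_of_type_algebra :: 'k ring) (vec_sort (twist \<alpha> H))"
    by (rule twist_module[OF mV]) (simp_all add: twist_def)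
  have 3: "is_lie_algebra (lie_sort (twist \<alpha> H))"
    unfolding is_lie_algebra_def twist_simps using 1 L[THEN conjunct2] by blast
  show ?thesis
    unfolding is_lie_rep_def Let_def twist_simps twist_minus using 2 3 H[THEN conjunct2, THEN conjunct2] by blast
qed

text \<open>The coefficient maps are semilinear over \<open>\<alpha>\<close>, and in the twist the
  scalar \<open>c\<close> operates as \<open>\<alpha> c\<close>; so composing an assignment with
  them makes it linear into the twist.\<close>

lemma twist_hom:
  assumes "(f, g) \<in> rep_hom (abs_free_rep UNIV UNIV) H"
  shows "(f \<circ> fl_map, g \<circ> fm_map) \<in> rep_hom (abs_free_rep UNIV UNIV) (twist \<alpha> H)"
  using assms by (auto simp: rep_hom_def linear_maps_def abs_free_rep_def simp flip: fl_iota_map)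

lemma untwist_hom:
  assumes "(f, g) \<in> rep_hom (abs_free_rep UNIV UNIV) (twist \<alpha> H)"
  shows "(f \<circ> field_automorphism.fl_map (inv_into UNIV \<alpha>), g \<circ> field_automorphism.fm_map (inv_into UNIV \<alpha>))
    \<in> rep_hom (abs_free_rep UNIV UNIV) H"
proof -
  interpret i: field_automorphism "inv_into UNIV \<alpha>" by (rule field_automorphism_inv) unfold_locales
  have "\<alpha> (inv_into UNIV \<alpha> c) = c" for c using bij by (simp add: bij_is_surj surj_f_inv_f)
  then show ?thesis
    using assms by (auto simp: rep_hom_def linear_maps_def abs_free_rep_def simp flip: i.fl_iota_map)
qed

text \<open>An assignment into the twist becomes one into \<open>H\<close> after the inverse
  coefficient maps. These fix integral identities, so what holds in \<open>H\<close> also holds in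
  the twist.\<close>

lemma twist_variety:
  assumes \<Theta>: "defined_over_int \<Theta>" and H: "H \<in> \<Theta>"
  shows "twist \<alpha> H \<in> \<Theta>"
proof -
  interpret i: field_automorphism "inv_into UNIV \<alpha>" by (rule field_automorphism_inv) unfold_locales
  obtain U1 U2 where U: "U1 \<subseteq> int_free_lie" "U2 \<subseteq> int_free_mod"
    "\<Theta> = {H. is_lie_rep H \<and> (\<forall>u\<in>U1. sat_lie H u 0) \<and> (\<forall>u\<in>U2. sat_vec H u 0)}"
    using \<Theta> unfolding defined_over_int_def by blast
  have "sat_lie (twist \<alpha> H) u 0" if u: "u \<in> U1" for u
    unfolding sat_lie_def
  proof safe
    fix f g assume "(f, g) \<in> rep_hom (abs_free_rep UNIV UNIV) (twist \<alpha> H)"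
    from untwist_hom[OF this] have "(f \<circ> i.fl_map) u = (f \<circ> i.fl_map) 0"
      using H u unfolding U(3) sat_lie_def by blast
    then show "f u = f 0" using i.fl_map_int[of u] u U(1) by auto
  qed
  moreover have "sat_vec (twist \<alpha> H) u 0" if u: "u \<in> U2" for u
    unfolding sat_vec_def
  proof safe
    fix f g assume "(f, g) \<in> rep_hom (abs_free_rep UNIV UNIV) (twist \<alpha> H)"
    from untwist_hom[OF this] have "(g \<circ> i.fm_map) u = (g \<circ> i.fm_map) 0"
      using H u unfolding U(3) sat_vec_def by blast
    then show "g u = g 0" using i.fm_map_int[of u] u U(2) by auto
  qed
  ultimately show ?thesis using H is_lie_rep_twist unfolding U(3) by blast
qed

end

section \<open>The automorphism of the category attached to a field automorphism\<close>

locale twist_automorphism = action_variety \<Theta> + field_automorphism \<alpha>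
  for \<Theta> :: "('k::field_char_0, 'l, 'v) lie_rep set" and \<alpha> :: "'k \<Rightarrow> 'k" +
  assumes over_int: "defined_over_int \<Theta>"
begin

lemma inverse_twist: "twist_automorphism \<Theta> (inv_into UNIV \<alpha>)"
  by (intro twist_automorphism.intro action_variety_axioms field_automorphism_inv
      field_automorphism_axioms twist_automorphism_axioms.intro over_int)

text \<open>The twist of a member of the variety is a member, so \<open>v\<close> vanishes there;
  read in \<open>H\<close>, this says that \<open>fm_map v\<close> vanishes.\<close>

lemma fm_map_vec_ideal:
  assumes "v \<in> vec_ideal"
  shows "fm_map v \<in> vec_ideal"
proof (rule vec_idealI)
  fix H f g assume H: "H \<in> \<Theta>" and h: "(f, g) \<in> rep_hom (abs_free_rep UNIV UNIV) H"
  from vec_idealD[OF assms twist_variety[OF over_int H] twist_hom[OF h]]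
  show "g (fm_map v) = g 0" by simp
qed

text \<open>Elements of an object are classes, that is, sets of elements of the free representation,
  so a coefficient map acts on them by taking images.\<close>

definition act1 :: "'k free_lie set \<Rightarrow> 'k free_lie set" where "act1 x = fl_map ` x"
definition act2 :: "'k free_mod set \<Rightarrow> 'k free_mod set" where "act2 v = fm_map ` v"

abbreviation "inv1 \<equiv> twist_automorphism.act1 (inv_into UNIV \<alpha>)"
abbreviation "inv2 \<equiv> twist_automorphism.act2 (inv_into UNIV \<alpha>)"

lemma inverse_simps:
  "field_automorphism.fl_map (inv_into UNIV \<alpha>) (fl_map u) = u" "fl_map (field_automorphism.fl_map (inv_into UNIV \<alpha>) u) = u"
  "field_automorphism.fm_map (inv_into UNIV \<alpha>) (fm_map v) = v" "fm_map (field_automorphism.fm_map (inv_into UNIV \<alpha>) v) = v"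
proof -
  note i = field_automorphism_inv[OF field_automorphism_axioms]
  have "inv_into UNIV \<alpha> (\<alpha> c) = c" "\<alpha> (inv_into UNIV \<alpha> c) = c" for c
    using bij by (simp_all add: bij_is_inj bij_is_surj surj_f_inv_f)
  then show "field_automorphism.fl_map (inv_into UNIV \<alpha>) (fl_map u) = u"
    "fl_map (field_automorphism.fl_map (inv_into UNIV \<alpha>) u) = u"
    "field_automorphism.fm_map (inv_into UNIV \<alpha>) (fm_map v) = v"
    "fm_map (field_automorphism.fm_map (inv_into UNIV \<alpha>) v) = v"
    by (simp_all add: fl_map_inverse[OF field_automorphism_axioms i] fl_map_inverse[OF i field_automorphism_axioms])
qed

lemma inv_act: "inv1 (act1 x) = x" "act1 (inv1 x) = x" "inv2 (act2 v) = v" "act2 (inv2 v) = v"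
proof -
  interpret i: twist_automorphism \<Theta> "inv_into UNIV \<alpha>" by (rule inverse_twist)
  show "inv1 (act1 x) = x" "act1 (inv1 x) = x" "inv2 (act2 v) = v" "act2 (inv2 v) = v"
    by (simp_all add: act1_def act2_def i.act1_def i.act2_def image_image inverse_simps)
qed

lemma act1_singleton: "act1 {u} = {fl_map u}"
  by (simp add: act1_def)

text \<open>For the image to be a whole class, the inverse coefficient map must preserve
  \<open>vec_ideal\<close> as well; hence the instance of the locale for the inverse
  automorphism.\<close>

lemma act2_vcls:
  assumes v: "v \<in> free_mod_on X1 X2"
  shows "act2 (vcls X1 X2 v) = vcls X1 X2 (fm_map v)"
proof -
  interpret i: twist_automorphism \<Theta> "inv_into UNIV \<alpha>" by (rule inverse_twist)
  have mem: "w \<in> vcls X1 X2 v \<longleftrightarrow> w \<in> free_mod_on X1 X2 \<and> v - w \<in> vec_ideal" if "v \<in> free_mod_on X1 X2" for v w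
    using that by (auto simp: vcls_def Id_vec_iff)
  have "fm_map w \<in> vcls X1 X2 (fm_map v)" if "w \<in> vcls X1 X2 v" for w
    using that fm_map_vec_ideal[of "v - w"] by (simp add: mem v fm_map_closed fm_map_minus)
  moreover have "\<exists>w'\<in>vcls X1 X2 v. w = fm_map w'" if w: "w \<in> vcls X1 X2 (fm_map v)" for w
  proof
    show "w = fm_map (i.fm_map w)" by (simp add: inverse_simps)
    show "i.fm_map w \<in> vcls X1 X2 v"
      using w i.fm_map_vec_ideal[of "fm_map v - w"]
      by (simp add: mem v fm_map_closed i.fm_map_closed i.fm_map_minus inverse_simps)
  qed
  ultimately show ?thesis unfolding act2_def by blast
qed

lemma act1_rules:
  assumes "A \<in> obs" "x \<in> lie_car A" "y \<in> lie_car A"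
  shows "act1 x \<in> lie_car A"
    "act1 (x \<oplus>\<^bsub>lie_sort A\<^esub> y) = act1 x \<oplus>\<^bsub>lie_sort A\<^esub> act1 y"
    "act1 (lie_bracket (lie_sort A) x y) = lie_bracket (lie_sort A) (act1 x) (act1 y)"
    "act1 (c \<odot>\<^bsub>lie_sort A\<^esub> x) = \<alpha> c \<odot>\<^bsub>lie_sort A\<^esub> act1 x"
  using assms by (auto simp: obs_def obj_lie_carrier obj_lie_simps act1_singleton fl_map_closed free_lie_on.intros)

lemma act2_rules:
  assumes "A \<in> obs" "v \<in> vec_car A" "w \<in> vec_car A"
  shows "act2 v \<in> vec_car A"
    "act2 (v \<oplus>\<^bsub>vec_sort A\<^esub> w) = act2 v \<oplus>\<^bsub>vec_sort A\<^esub> act2 w"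
    "act2 (c \<odot>\<^bsub>vec_sort A\<^esub> v) = \<alpha> c \<odot>\<^bsub>vec_sort A\<^esub> act2 v"
    "x \<in> lie_car A \<Longrightarrow> act2 (action A x v) = action A (act1 x) (act2 v)"
  using assms
  by (auto simp: obs_def obj_lie_carrier obj_vec_carrier obj_vec_simps obj_action act1_singleton act2_vcls
      fl_iota_map fm_map_closed free_mod_on_closed(2) free_mod_on_scale free_mod_on_action fl_map_closed)

text \<open>Conjugation by the semilinear maps. The twists by \<open>\<alpha>\<close> and by its
  inverse cancel, so the result is linear again although both conjugating maps are only
  semilinear.\<close>

definition conj_hom where
  "conj_hom A h = (\<lambda>x\<in>lie_car A. act1 (fst h (inv1 x)), \<lambda>v\<in>vec_car A. act2 (snd h (inv2 v)))"

lemma conj_hom_simps: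
  "x \<in> lie_car A \<Longrightarrow> fst (conj_hom A h) x = act1 (fst h (inv1 x))"
  "v \<in> vec_car A \<Longrightarrow> snd (conj_hom A h) v = act2 (snd h (inv2 v))"
  by (simp_all add: conj_hom_def)

lemma conj_hom_in:
  assumes A: "A \<in> obs" and B: "B \<in> obs" and h: "h \<in> rep_hom A B"
  shows "conj_hom A h \<in> rep_hom A B"
proof -
  interpret i: twist_automorphism \<Theta> "inv_into UNIV \<alpha>" by (rule inverse_twist)
  note hs = hom_simps[OF h]
  have \<alpha>: "\<alpha> (inv_into UNIV \<alpha> c) = c" for c using bij by (simp add: bij_is_surj surj_f_inv_f)
  let ?h = "conj_hom A h"
  have m1: "i.act1 x \<in> lie_car A" if "x \<in> lie_car A" for x
    by (rule i.act1_rules(1)[OF A that that])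
  have m2: "i.act2 v \<in> vec_car A" if "v \<in> vec_car A" for v
    by (rule i.act2_rules(1)[OF A that that])
  have n1: "fst h (i.act1 x) \<in> lie_car B" if "x \<in> lie_car A" for x
    by (rule hs(1)[OF m1[OF that]])
  have n2: "snd h (i.act2 v) \<in> vec_car B" if "v \<in> vec_car A" for v
    by (rule hs(2)[OF m2[OF that]])
  have "fst ?h \<in> lie_car A \<rightarrow>\<^sub>E lie_car B"
    unfolding conj_hom_def fst_conv by (rule restrict_PiE_iff[THEN iffD2]) (use act1_rules(1)[OF B n1 n1] in blast)
  moreover have "snd ?h \<in> vec_car A \<rightarrow>\<^sub>E vec_car B"
    unfolding conj_hom_def snd_conv by (rule restrict_PiE_iff[THEN iffD2]) (use act2_rules(1)[OF B n2 n2] in blast)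
  moreover have "fst ?h (x \<oplus>\<^bsub>lie_sort A\<^esub> y) = fst ?h x \<oplus>\<^bsub>lie_sort B\<^esub> fst ?h y"
    "fst ?h (lie_bracket (lie_sort A) x y) = lie_bracket (lie_sort B) (fst ?h x) (fst ?h y)"
    if x: "x \<in> lie_car A" and y: "y \<in> lie_car A" for x y
    by (simp_all only: conj_hom_simps x y obs_lie_rules(1)[OF A x y] obs_lie_rules(3)[OF A x y]
        i.act1_rules(2,3)[OF A x y] hs(3)[OF m1[OF x] m1[OF y]] hs(5)[OF m1[OF x] m1[OF y]]
        act1_rules(2,3)[OF B n1[OF x] n1[OF y]])
  moreover have "fst ?h (c \<odot>\<^bsub>lie_sort A\<^esub> x) = c \<odot>\<^bsub>lie_sort B\<^esub> fst ?h x" if x: "x \<in> lie_car A" for c x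
    by (simp only: conj_hom_simps x obs_lie_rules(2)[OF A x x] i.act1_rules(4)[OF A x x] hs(4)[OF m1[OF x]]
        act1_rules(4)[OF B n1[OF x] n1[OF x]] \<alpha>)
  moreover have "snd ?h (v \<oplus>\<^bsub>vec_sort A\<^esub> w) = snd ?h v \<oplus>\<^bsub>vec_sort B\<^esub> snd ?h w"
    if v: "v \<in> vec_car A" and w: "w \<in> vec_car A" for v w
    by (simp only: conj_hom_simps v w obs_vec_rules(1)[OF A v w] i.act2_rules(2)[OF A v w]
        hs(6)[OF m2[OF v] m2[OF w]] act2_rules(2)[OF B n2[OF v] n2[OF w]])
  moreover have "snd ?h (c \<odot>\<^bsub>vec_sort A\<^esub> v) = c \<odot>\<^bsub>vec_sort B\<^esub> snd ?h v" if v: "v \<in> vec_car A" for c v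
    by (simp only: conj_hom_simps v obs_vec_rules(2)[OF A v v] i.act2_rules(3)[OF A v v] hs(7)[OF m2[OF v]]
        act2_rules(3)[OF B n2[OF v] n2[OF v]] \<alpha>)
  moreover have "snd ?h (action A x v) = action B (fst ?h x) (snd ?h v)"
    if x: "x \<in> lie_car A" and v: "v \<in> vec_car A" for x v
    by (simp only: conj_hom_simps x v obs_action_rules(1)[OF A x x v] i.act2_rules(4)[OF A v v x]
        hs(8)[OF m1[OF x] m2[OF v]] act2_rules(4)[OF B n2[OF v] n2[OF v] n1[OF x]])
  ultimately show ?thesis unfolding rep_hom_def linear_maps_def mem_Collect_eq case_prod_beta by simp
qed

lemma conj_hom_inverse:
  assumes A: "A \<in> obs" and B: "B \<in> obs" and h: "h \<in> rep_hom A B"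
  shows "twist_automorphism.conj_hom (inv_into UNIV \<alpha>) A (conj_hom A h) = h"
    "conj_hom A (twist_automorphism.conj_hom (inv_into UNIV \<alpha>) A h) = h"
proof -
  interpret i: twist_automorphism \<Theta> "inv_into UNIV \<alpha>" by (rule inverse_twist)
  have ii: "inv_into UNIV (inv_into UNIV \<alpha>) = \<alpha>" using bij by (rule inv_inv_eq)
  have m1: "i.act1 x \<in> lie_car A" "act1 x \<in> lie_car A" if "x \<in> lie_car A" for x
    using i.act1_rules(1)[OF A that that] act1_rules(1)[OF A that that] .
  have m2: "i.act2 x \<in> vec_car A" "act2 x \<in> vec_car A" if "x \<in> vec_car A" for x
    using i.act2_rules(1)[OF A that that] act2_rules(1)[OF A that that] .
  show "i.conj_hom A (conj_hom A h) = h"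
    by (rule hom_ext[OF i.conj_hom_in[OF A B conj_hom_in[OF A B h]] h])
      (simp_all add: i.conj_hom_simps conj_hom_simps ii m1 m2 inv_act)
  show "conj_hom A (i.conj_hom A h) = h"
    by (rule hom_ext[OF conj_hom_in[OF A B i.conj_hom_in[OF A B h]] h])
      (simp_all add: i.conj_hom_simps conj_hom_simps ii m1 m2 inv_act)
qed

lemma conj_hom_hcomp:
  assumes A: "A \<in> obs" and B: "B \<in> obs" and C: "C \<in> obs" and h: "h \<in> rep_hom A B" and h': "h' \<in> rep_hom B C"
  shows "conj_hom A (hcomp A h' h) = hcomp A (conj_hom B h') (conj_hom A h)"
proof (rule hom_ext[OF conj_hom_in[OF A C hcomp_in[OF A h h']] hcomp_in[OF A conj_hom_in[OF A B h] conj_hom_in[OF B C h']]])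
  interpret i: twist_automorphism \<Theta> "inv_into UNIV \<alpha>" by (rule inverse_twist)
  show "fst (conj_hom A (hcomp A h' h)) x = fst (hcomp A (conj_hom B h') (conj_hom A h)) x"
    if x: "x \<in> lie_car A" for x
  proof -
    have a: "i.act1 x \<in> lie_car A" by (rule i.act1_rules(1)[OF A x x])
    have b: "fst h (i.act1 x) \<in> lie_car B" by (rule hom_simps(1)[OF h a])
    show ?thesis using x a act1_rules(1)[OF B b b] by (simp add: conj_hom_simps inv_act)
  qed
  show "snd (conj_hom A (hcomp A h' h)) x = snd (hcomp A (conj_hom B h') (conj_hom A h)) x"
    if x: "x \<in> vec_car A" for x
  proof -
    have a: "i.act2 x \<in> vec_car A" by (rule i.act2_rules(1)[OF A x x])
    have b: "snd h (i.act2 x) \<in> vec_car B" by (rule hom_simps(2)[OF h a])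
    show ?thesis using x a act2_rules(1)[OF B b b] by (simp add: conj_hom_simps inv_act)
  qed
qed

definition twist_functor where
  "twist_functor = (\<lambda>A\<in>obs. A, \<lambda>(A, h, B)\<in>Arr (Theta0 \<Theta>). (A, conj_hom A h, B))"

lemma twist_functor_arrow:
  "A \<in> obs \<Longrightarrow> B \<in> obs \<Longrightarrow> h \<in> rep_hom A B \<Longrightarrow> snd twist_functor (A, h, B) = (A, conj_hom A h, B)"
  by (simp add: twist_functor_def Theta0_simps)

lemma twist_functor_automorphism: "twist_functor \<in> cat_automorphisms (Theta0 \<Theta>)"
proof -
  interpret i: twist_automorphism \<Theta> "inv_into UNIV \<alpha>" by (rule inverse_twist)
  let ?F = "\<lambda>A\<in>obs. A" and ?f = "snd twist_functor"
  let ?g = "\<lambda>(A, h, B). (A, i.conj_hom A h, B)"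
  note arr = twist_functor_arrow
  have "bij_betw ?f (Arr (Theta0 \<Theta>)) (Arr (Theta0 \<Theta>))"
  proof (rule bij_betw_byWitness[where f' = ?g])
    show "\<forall>a\<in>Arr (Theta0 \<Theta>). ?g (?f a) = a"
    proof
      fix a assume "a \<in> Arr (Theta0 \<Theta>)"
      then obtain A h B where "a = (A, h, B)" "A \<in> obs" "B \<in> obs" "h \<in> rep_hom A B"
        by (rule Theta0_arrE)
      then show "?g (?f a) = a" by (simp add: arr conj_hom_inverse)
    qed
    show "\<forall>a\<in>Arr (Theta0 \<Theta>). ?f (?g a) = a"
    proof
      fix a assume "a \<in> Arr (Theta0 \<Theta>)"
      then obtain A h B where "a = (A, h, B)" "A \<in> obs" "B \<in> obs" "h \<in> rep_hom A B"
        by (rule Theta0_arrE)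
      then show "?f (?g a) = a" by (simp add: arr i.conj_hom_in conj_hom_inverse)
    qed
    show "?f ` Arr (Theta0 \<Theta>) \<subseteq> Arr (Theta0 \<Theta>)"
    proof (rule image_subsetI)
      fix a assume "a \<in> Arr (Theta0 \<Theta>)"
      then obtain A h B where "a = (A, h, B)" "A \<in> obs" "B \<in> obs" "h \<in> rep_hom A B"
        by (rule Theta0_arrE)
      then show "?f a \<in> Arr (Theta0 \<Theta>)" by (simp add: Theta0_simps arr conj_hom_in)
    qed
    show "?g ` Arr (Theta0 \<Theta>) \<subseteq> Arr (Theta0 \<Theta>)"
    proof (rule image_subsetI)
      fix a assume "a \<in> Arr (Theta0 \<Theta>)"
      then obtain A h B where "a = (A, h, B)" "A \<in> obs" "B \<in> obs" "h \<in> rep_hom A B"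
        by (rule Theta0_arrE)
      then show "?g a \<in> Arr (Theta0 \<Theta>)" by (simp add: Theta0_simps i.conj_hom_in)
    qed
  qed
  then have "?f \<in> Bij (Arr (Theta0 \<Theta>))" by (simp add: Bij_def twist_functor_def)
  moreover have "?F \<in> Bij (Ob (Theta0 \<Theta>))" unfolding Theta0_simps by (rule id_Bij)
  moreover have "Dom (Theta0 \<Theta>) (?f a) = ?F (Dom (Theta0 \<Theta>) a) \<and> Cod (Theta0 \<Theta>) (?f a) = ?F (Cod (Theta0 \<Theta>) a)"
    if a: "a \<in> Arr (Theta0 \<Theta>)" for a
  proof -
    obtain A h B where "a = (A, h, B)" "A \<in> obs" "B \<in> obs" "h \<in> rep_hom A B"
      using a by (rule Theta0_arrE)
    then show ?thesis by (simp add: arr Theta0_simps)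
  qed
  moreover have "?f (Ident (Theta0 \<Theta>) A) = Ident (Theta0 \<Theta>) (?F A)" if A: "A \<in> Ob (Theta0 \<Theta>)" for A
  proof -
    have A: "A \<in> obs" using A by (simp add: Theta0_simps)
    let ?e = "hid A"
    have e: "Ident (Theta0 \<Theta>) A = (A, ?e, A)" by (simp add: Theta0_def rep_category_def)
    interpret c: is_category "Theta0 \<Theta>"
      unfolding Theta0_def by (rule rep_category_is_category) (auto intro: is_lie_rep_free_rep)
    have eh: "?e \<in> rep_hom A A"
      using c.ident_closed[of A] A by (simp add: e Theta0_simps)
    have "conj_hom A ?e = ?e"
    proof (rule hom_ext[OF conj_hom_in[OF A A eh] eh])
      show "fst (conj_hom A ?e) x = fst ?e x" if x: "x \<in> lie_car A" for x
        using x i.act1_rules(1)[OF A x x] by (simp add: conj_hom_simps inv_act)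
      show "snd (conj_hom A ?e) x = snd ?e x" if x: "x \<in> vec_car A" for x
        using x i.act2_rules(1)[OF A x x] by (simp add: conj_hom_simps inv_act)
    qed
    then show ?thesis using A eh by (simp add: e arr)
  qed
  moreover have "?f (Comp (Theta0 \<Theta>) b a) = Comp (Theta0 \<Theta>) (?f b) (?f a)"
    if ab: "a \<in> Arr (Theta0 \<Theta>)" "b \<in> Arr (Theta0 \<Theta>)" "Dom (Theta0 \<Theta>) b = Cod (Theta0 \<Theta>) a" for a b
  proof -
    obtain A h B where a: "a = (A, h, B)" "A \<in> obs" "B \<in> obs" "h \<in> rep_hom A B"
      using ab(1) by (rule Theta0_arrE)
    obtain B' h' C where b: "b = (B', h', C)" "B' \<in> obs" "C \<in> obs" "h' \<in> rep_hom B' C"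
      using ab(2) by (rule Theta0_arrE)
    have B: "B' = B" using ab(3) a b by (simp add: Theta0_simps)
    show ?thesis
      using a b hcomp_in[OF a(2,4) b(4)[unfolded B]] conj_hom_hcomp[OF a(2,3) b(3) a(4) b(4)[unfolded B]]
      by (simp add: B Theta0_simps arr)
  qed
  ultimately show ?thesis
    unfolding cat_automorphisms_def twist_functor_def by (simp add: twist_functor_def)
qed

text \<open>The coefficient maps themselves form the family; naturality is the definition of
  conjugation.\<close>

lemma twist_functor_semilinear:
  "semilinear_family \<alpha> (fst twist_functor) (snd twist_functor) (\<lambda>_. act1) (\<lambda>_. act2)"
  unfolding semilinear_family_def
proof (intro conjI ballI allI)
  interpret i: twist_automorphism \<Theta> "inv_into UNIV \<alpha>" by (rule inverse_twist)
  fix A assume A: "A \<in> obs"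
  have F: "fst twist_functor A = A" using A by (simp add: twist_functor_def)
  show "bij_betw act1 (lie_car A) (lie_car (fst twist_functor A))"
    unfolding F by (rule bij_betw_byWitness[where f' = i.act1])
      (use act1_rules(1)[OF A] i.act1_rules(1)[OF A] in \<open>auto simp: inv_act\<close>)
  show "bij_betw act2 (vec_car A) (vec_car (fst twist_functor A))"
    unfolding F by (rule bij_betw_byWitness[where f' = i.act2])
      (use act2_rules(1)[OF A] i.act2_rules(1)[OF A] in \<open>auto simp: inv_act\<close>)
  fix B h assume B: "B \<in> obs" and h: "h \<in> rep_hom A B"
  show "act1 (fst h a) = fst (fst (snd (snd twist_functor (A, h, B)))) (act1 a)" if a: "a \<in> lie_car A" for a
    using act1_rules(1)[OF A a a] by (simp add: twist_functor_arrow A B h conj_hom_simps inv_act)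
  show "act2 (snd h v) = snd (fst (snd (snd twist_functor (A, h, B)))) (act2 v)" if v: "v \<in> vec_car A" for v
    using act2_rules(1)[OF A v v] by (simp add: twist_functor_arrow A B h conj_hom_simps inv_act)
qed (simp_all add: twist_functor_def act1_rules act2_rules)

end

section \<open>Automorphisms modulo inner automorphisms\<close>

context action_variety
begin

lemma semilinearD:
  assumes "semilinear_family \<alpha> F f t1 t2" "A \<in> obs"
  shows "bij_betw (t1 A) (lie_car A) (lie_car (F A))"
    "bij_betw (t2 A) (vec_car A) (vec_car (F A))"
    "a \<in> lie_car A \<Longrightarrow> b \<in> lie_car A \<Longrightarrow>
      t1 A (a \<oplus>\<^bsub>lie_sort A\<^esub> b) = t1 A a \<oplus>\<^bsub>lie_sort (F A)\<^esub> t1 A b"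
    "a \<in> lie_car A \<Longrightarrow> b \<in> lie_car A \<Longrightarrow>
      t1 A (lie_bracket (lie_sort A) a b) = lie_bracket (lie_sort (F A)) (t1 A a) (t1 A b)"
    "v \<in> vec_car A \<Longrightarrow> w \<in> vec_car A \<Longrightarrow>
      t2 A (v \<oplus>\<^bsub>vec_sort A\<^esub> w) = t2 A v \<oplus>\<^bsub>vec_sort (F A)\<^esub> t2 A w"
    "a \<in> lie_car A \<Longrightarrow> t1 A (c \<odot>\<^bsub>lie_sort A\<^esub> a) = \<alpha> c \<odot>\<^bsub>lie_sort (F A)\<^esub> t1 A a"
    "v \<in> vec_car A \<Longrightarrow> t2 A (c \<odot>\<^bsub>vec_sort A\<^esub> v) = \<alpha> c \<odot>\<^bsub>vec_sort (F A)\<^esub> t2 A v"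
    "a \<in> lie_car A \<Longrightarrow> v \<in> vec_car A \<Longrightarrow>
      t2 A (action A a v) = action (F A) (t1 A a) (t2 A v)"
    "a \<in> lie_car A \<Longrightarrow> t1 A a \<in> lie_car (F A)"
    "v \<in> vec_car A \<Longrightarrow> t2 A v \<in> vec_car (F A)"
proof -
  note s = assms(1)[unfolded semilinear_family_def, THEN conjunct1, rule_format, OF assms(2)]
  show b1: "bij_betw (t1 A) (lie_car A) (lie_car (F A))"
    and b2: "bij_betw (t2 A) (vec_car A) (vec_car (F A))"
    using s by blast+
  show "a \<in> lie_car A \<Longrightarrow> t1 A a \<in> lie_car (F A)"
    using bij_betwE[OF b1] by blast
  show "v \<in> vec_car A \<Longrightarrow> t2 A v \<in> vec_car (F A)"
    using bij_betwE[OF b2] by blast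
qed (use assms(1)[unfolded semilinear_family_def, THEN conjunct1, rule_format, OF assms(2)] in blast)+

lemma semilinear_nat:
  assumes "semilinear_family \<alpha> F f t1 t2" "A \<in> obs" "B \<in> obs" "h \<in> rep_hom A B"
  shows "a \<in> lie_car A \<Longrightarrow> t1 B (fst h a) = fst (fst (snd (f (A, h, B)))) (t1 A a)"
    "v \<in> vec_car A \<Longrightarrow> t2 B (snd h v) = snd (fst (snd (f (A, h, B)))) (t2 A v)"
  using assms(1)[unfolded semilinear_family_def, THEN conjunct2, rule_format, OF assms(2-4)] by blast+

text \<open>Scaling by \<open>c\<close> is an endomorphism of \<open>vecL\<close>. Its image under
  the functor does not depend on the family, but seen through the first family it multiplies by
  \<open>\<alpha> c\<close>, and through the second by \<open>\<beta> c\<close>.\<close>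

lemma semilinear_unique:
  assumes s: "semilinear_family \<alpha> F f t1 t2" and s': "semilinear_family \<beta> F f t1' t2'" and \<beta>: "surj \<beta>"
  shows "\<alpha> = \<beta>"
proof
  fix c
  have V: "vecL \<in> obs" by simp
  note y = y0_carrier
  have sc: "d \<odot>\<^bsub>vec_sort vecL\<^esub> v \<in> vec_car vecL" if "v \<in> vec_car vecL" for v and d :: 'k
    by (rule obs_vec_rules(2)[OF V that that])
  define w where "w = t2' vecL y0"
  have w: "w \<in> vec_car (F vecL)" unfolding w_def by (rule semilinearD(10)[OF s' V y])
  then have "w \<in> t2 vecL ` vec_car vecL"
    unfolding bij_betw_imp_surj_on[OF semilinearD(2)[OF s V]] .
  then obtain v where v: "v \<in> vec_car vecL" "t2 vecL v = w" by auto
  let ?m = "point_vec vecL (c \<odot>\<^bsub>vec_sort vecL\<^esub> y0)"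
  note m = point_vec(1,2)[OF V sc[OF y, of c]]
  obtain d where d: "v = vcls {} {0} (fm_scale d (fm_gen 0))" using v(1) by (rule singleton_gen_2)
  have vd: "v = d \<odot>\<^bsub>vec_sort vecL\<^esub> y0" by (simp add: d obj_vec_simps free_mod_on_gen)
  have "snd ?m v = c \<odot>\<^bsub>vec_sort vecL\<^esub> v"
    unfolding vd hom_simps(7)[OF m(1) y] m(2) obs_vec_rules(5)[OF V y y] by (simp add: mult.commute)
  then have "\<alpha> c \<odot>\<^bsub>vec_sort (F vecL)\<^esub> w = snd (fst (snd (f (vecL, ?m, vecL)))) w"
    using semilinear_nat(2)[OF s V V m(1) v(1)] semilinearD(7)[OF s V v(1), of c] v(2) by simp
  also have "\<dots> = t2' vecL (c \<odot>\<^bsub>vec_sort vecL\<^esub> y0)"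
    using semilinear_nat(2)[OF s' V V m(1) y] m(2) by (simp add: w_def)
  finally have 1: "\<alpha> c \<odot>\<^bsub>vec_sort (F vecL)\<^esub> w = t2' vecL (c \<odot>\<^bsub>vec_sort vecL\<^esub> y0)" .
  \<comment> \<open>Writing \<open>\<alpha> c\<close> as a value of \<open>\<beta>\<close> moves the
    comparison back to \<open>vecL\<close>, where injectivity of \<open>t2'\<close> and the
    generator decide.\<close>
  obtain e where e: "\<beta> e = \<alpha> c" using \<beta> by (metis surjD)
  have "t2' vecL (e \<odot>\<^bsub>vec_sort vecL\<^esub> y0) = t2' vecL (c \<odot>\<^bsub>vec_sort vecL\<^esub> y0)"
    using semilinearD(7)[OF s' V y, of e] 1 by (simp add: e w_def)
  then have "e \<odot>\<^bsub>vec_sort vecL\<^esub> y0 = c \<odot>\<^bsub>vec_sort vecL\<^esub> y0"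
    by (rule inj_onD[OF bij_betw_imp_inj_on[OF semilinearD(2)[OF s' V]] _ sc[OF y] sc[OF y]])
  then have "vcls {} {0} (fm_scale e (fm_gen 0)) = vcls {} {0} (fm_scale c (fm_gen 0))"
    by (simp add: obj_vec_simps free_mod_on_gen)
  then have "e = c" by (rule vcls_scale_cancel[rotated 2]) (auto intro: free_mod_on_gen simp: fm_gen_notin)
  then show "\<alpha> c = \<beta> c" using e by simp
qed

text \<open>Scalars pass first through \<open>\<beta>\<close> and then through
  \<open>\<alpha>\<close>, so field automorphisms compose in the same order as functors.\<close>

lemma semilinear_compose:
  assumes aut: "(F, f) \<in> cat_automorphisms (Theta0 \<Theta>)" and aut': "(G, g) \<in> cat_automorphisms (Theta0 \<Theta>)"
    and s: "semilinear_family \<alpha> F f t1 t2" and s': "semilinear_family \<beta> G g u1 u2"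
  shows "semilinear_family (\<alpha> \<circ> \<beta>) (compose (Ob (Theta0 \<Theta>)) F G) (compose (Arr (Theta0 \<Theta>)) f g)
    (\<lambda>A. t1 (G A) \<circ> u1 A) (\<lambda>A. t2 (G A) \<circ> u2 A)"
proof -
  interpret a: theta_automorphism \<Theta> F f by unfold_locales (rule aut)
  interpret b: theta_automorphism \<Theta> G g by unfold_locales (rule aut')
  let ?F = "compose (Ob (Theta0 \<Theta>)) F G" and ?f = "compose (Arr (Theta0 \<Theta>)) f g"
  let ?t1 = "\<lambda>A. t1 (G A) \<circ> u1 A" and ?t2 = "\<lambda>A. t2 (G A) \<circ> u2 A"
  show ?thesis
    unfolding semilinear_family_def
  proof (intro conjI ballI allI)
    fix A assume A: "A \<in> obs"
    have GA: "G A \<in> obs" using A by simp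
    have F: "?F A = F (G A)" using A by (simp add: compose_eq Theta0_simps)
    note S = semilinearD[OF s GA] and S' = semilinearD[OF s' A]
    show "bij_betw (?t1 A) (lie_car A) (lie_car (?F A))"
      unfolding F by (rule bij_betw_trans[OF S'(1) S(1)])
    show "bij_betw (?t2 A) (vec_car A) (vec_car (?F A))"
      unfolding F by (rule bij_betw_trans[OF S'(2) S(2)])
    show "?t1 A (a \<oplus>\<^bsub>lie_sort A\<^esub> b)
        = ?t1 A a \<oplus>\<^bsub>lie_sort (?F A)\<^esub> ?t1 A b"
      "?t1 A (lie_bracket (lie_sort A) a b)
        = lie_bracket (lie_sort (?F A)) (?t1 A a) (?t1 A b)"
      if ab: "a \<in> lie_car A" "b \<in> lie_car A" for a b
      unfolding F comp_def S'(3)[OF ab] S'(4)[OF ab]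
      by (rule S(3)[OF S'(9)[OF ab(1)] S'(9)[OF ab(2)]], rule S(4)[OF S'(9)[OF ab(1)] S'(9)[OF ab(2)]])
    show "?t2 A (v \<oplus>\<^bsub>vec_sort A\<^esub> w)
        = ?t2 A v \<oplus>\<^bsub>vec_sort (?F A)\<^esub> ?t2 A w"
      if vw: "v \<in> vec_car A" "w \<in> vec_car A" for v w
      unfolding F comp_def S'(5)[OF vw] by (rule S(5)[OF S'(10)[OF vw(1)] S'(10)[OF vw(2)]])
    show "?t1 A (c \<odot>\<^bsub>lie_sort A\<^esub> a)
        = (\<alpha> \<circ> \<beta>) c \<odot>\<^bsub>lie_sort (?F A)\<^esub> ?t1 A a"
      if a: "a \<in> lie_car A" for c a
      unfolding F comp_def S'(6)[OF a] by (rule S(6)[OF S'(9)[OF a]])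
    show "?t2 A (c \<odot>\<^bsub>vec_sort A\<^esub> v)
        = (\<alpha> \<circ> \<beta>) c \<odot>\<^bsub>vec_sort (?F A)\<^esub> ?t2 A v"
      if v: "v \<in> vec_car A" for c v
      unfolding F comp_def S'(7)[OF v] by (rule S(7)[OF S'(10)[OF v]])
    show "?t2 A (action A a v)
        = action (?F A) (?t1 A a) (?t2 A v)"
      if a: "a \<in> lie_car A" and v: "v \<in> vec_car A" for a v
      unfolding F comp_def S'(8)[OF a v] by (rule S(8)[OF S'(9)[OF a] S'(10)[OF v]])
    fix B h assume B: "B \<in> obs" and h: "h \<in> rep_hom A B"
    have GB: "G B \<in> obs" using B by simp
    note g = b.f_eq[OF A B h]
    have fg: "?f (A, h, B) = f (G A, b.fmap A B h, G B)"
      using A B h by (simp add: compose_eq Theta0_simps g)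
    show "?t1 B (fst h a) = fst (fst (snd (?f (A, h, B)))) (?t1 A a)"
      if a: "a \<in> lie_car A" for a
      unfolding fg comp_def semilinear_nat(1)[OF s' A B h a] g(1) fst_conv snd_conv
      by (rule semilinear_nat(1)[OF s GA GB g(2) S'(9)[OF a]])
    show "?t2 B (snd h v) = snd (fst (snd (?f (A, h, B)))) (?t2 A v)"
      if v: "v \<in> vec_car A" for v
      unfolding fg comp_def semilinear_nat(2)[OF s' A B h v] g(1) fst_conv snd_conv
      by (rule semilinear_nat(2)[OF s GA GB g(2) S'(10)[OF v]])
  qed
qed

section \<open>Inner automorphisms and families that are linear\<close>

lemma Theta0_Ident:
  "Ident (Theta0 \<Theta>) A = (A, hid A, A)"
  by (simp add: Theta0_def rep_category_def)

text \<open>The isomorphisms that witness innerness are homomorphisms, hence linear, and serve as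
  the family.\<close>

lemma inner_semilinear:
  assumes "(F, f) \<in> inner_automorphisms (Theta0 \<Theta>)"
  shows "\<exists>t1 t2. semilinear_family id F f t1 t2"
proof -
  have aut: "(F, f) \<in> cat_automorphisms (Theta0 \<Theta>)" using assms by (auto simp: inner_automorphisms_def)
  interpret a: theta_automorphism \<Theta> F f by unfold_locales (rule aut)
  obtain \<sigma> \<tau> where st: "\<And>A. A \<in> obs \<Longrightarrow> inverse_arrows (Theta0 \<Theta>) (\<sigma> A) (\<tau> A) \<and>
      Dom (Theta0 \<Theta>) (\<sigma> A) = A \<and> Cod (Theta0 \<Theta>) (\<sigma> A) = F A"
    and fa: "\<And>a. a \<in> Arr (Theta0 \<Theta>) \<Longrightarrow> f a = Comp (Theta0 \<Theta>) (\<sigma> (Cod (Theta0 \<Theta>) a))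
      (Comp (Theta0 \<Theta>) a (\<tau> (Dom (Theta0 \<Theta>) a)))"
    using assms unfolding inner_automorphisms_def Theta0_simps by blast
  define p where "p A = fst (snd (\<sigma> A))" for A
  define q where "q A = fst (snd (\<tau> A))" for A
  have pq: "\<sigma> A = (A, p A, F A)" "\<tau> A = (F A, q A, A)" "p A \<in> rep_hom A (F A)" "q A \<in> rep_hom (F A) A"
    "hcomp A (q A) (p A) = hid A"
    "hcomp (F A) (p A) (q A) = hid (F A)"
    if A: "A \<in> obs" for A
  proof -
    note i = st[OF A, unfolded inverse_arrows_def]
    obtain A1 h B1 where s: "\<sigma> A = (A1, h, B1)" "h \<in> rep_hom A1 B1" using i by (auto elim: Theta0_arrE)
    obtain A2 k B2 where t: "\<tau> A = (A2, k, B2)" "k \<in> rep_hom A2 B2" using i by (auto elim: Theta0_arrE)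
    have e: "A1 = A" "B1 = F A" "A2 = F A" "B2 = A" "p A = h" "q A = k"
      using i s t by (simp_all add: Theta0_simps p_def q_def)
    show "\<sigma> A = (A, p A, F A)" "\<tau> A = (F A, q A, A)" "p A \<in> rep_hom A (F A)" "q A \<in> rep_hom (F A) A"
      using s t by (simp_all add: e)
    show "hcomp A (q A) (p A) = hid A"
      "hcomp (F A) (p A) (q A) = hid (F A)"
      using i s t by (simp_all add: e Theta0_simps Theta0_Ident)
  qed
  have qp: "fst (q A) (fst (p A) x) = x" "fst (p A) (fst (q A) y) = y"
    if "A \<in> obs" "x \<in> lie_car A" "y \<in> lie_car (F A)" for A x y
    using arg_cong[OF pq(5)[OF that(1)], of "\<lambda>h. fst h x"] arg_cong[OF pq(6)[OF that(1)], of "\<lambda>h. fst h y"] that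
    by simp_all
  have qp': "snd (q A) (snd (p A) x) = x" "snd (p A) (snd (q A) y) = y"
    if "A \<in> obs" "x \<in> vec_car A" "y \<in> vec_car (F A)" for A x y
    using arg_cong[OF pq(5)[OF that(1)], of "\<lambda>h. snd h x"] arg_cong[OF pq(6)[OF that(1)], of "\<lambda>h. snd h y"] that
    by simp_all
  have "semilinear_family id F f (\<lambda>A. fst (p A)) (\<lambda>A. snd (p A))"
    unfolding semilinear_family_def
  proof (intro conjI ballI allI)
    fix A assume A: "A \<in> obs"
    note P = hom_simps[OF pq(3)[OF A]] and Q = hom_simps[OF pq(4)[OF A]]
    show "bij_betw (fst (p A)) (lie_car A) (lie_car (F A))"
      by (rule bij_betw_byWitness[where f' = "fst (q A)"])
        (use P(1) Q(1) qp(1)[OF A _ P(1)] qp(2)[OF A Q(1)] in \<open>simp_all add: image_subset_iff\<close>)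
    show "bij_betw (snd (p A)) (vec_car A) (vec_car (F A))"
      by (rule bij_betw_byWitness[where f' = "snd (q A)"])
        (use P(2) Q(2) qp'(1)[OF A _ P(2)] qp'(2)[OF A Q(2)] in \<open>simp_all add: image_subset_iff\<close>)
    fix B h assume B: "B \<in> obs" and h: "h \<in> rep_hom A B"
    have "f (A, h, B) = (F A, hcomp (F A) (p B) (hcomp (F A) h (q A)), F B)"
      using fa[of "(A, h, B)"] A B h by (simp add: Theta0_simps pq(1,2))
    then have fe: "fst (snd (f (A, h, B))) = hcomp (F A) (p B) (hcomp (F A) h (q A))" by simp
    show "fst (p B) (fst h a) = fst (fst (snd (f (A, h, B)))) (fst (p A) a)" if a: "a \<in> lie_car A" for a
      unfolding fe by (simp add: P(1)[OF a] qp(1)[OF A a P(1)[OF a]])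
    show "snd (p B) (snd h v) = snd (fst (snd (f (A, h, B)))) (snd (p A) v)" if v: "v \<in> vec_car A" for v
      unfolding fe by (simp add: P(2)[OF v] qp'(1)[OF A v P(2)[OF v]])
  qed (simp_all add: hom_simps[OF pq(3)])
  then show ?thesis by blast
qed

text \<open>For \<open>\<alpha> = id\<close> the members of the family are bijective homomorphisms,
  so their inverses are homomorphisms too. The restrictions make both extensional, as arrows have to
  be.\<close>

lemma linear_family_inverse_arrow:
  assumes F: "F A \<in> obs" and A: "A \<in> obs" and s: "semilinear_family id F f t1 t2"
  defines "p \<equiv> (restrict (t1 A) (lie_car A), restrict (t2 A) (vec_car A))"
    and "q \<equiv> (restrict (inv_into (lie_car A) (t1 A)) (lie_car (F A)),
      restrict (inv_into (vec_car A) (t2 A)) (vec_car (F A)))"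
  shows "p \<in> rep_hom A (F A)" "q \<in> rep_hom (F A) A"
    "hcomp A q p = hid A"
    "hcomp (F A) p q = hid (F A)"
proof -
  note S = semilinearD[OF s A]
  let ?i1 = "inv_into (lie_car A) (t1 A)" and ?i2 = "inv_into (vec_car A) (t2 A)"
  have i1: "?i1 (t1 A a) = a" if "a \<in> lie_car A" for a
    using S(1) that by (simp add: bij_betw_inv_into_left)
  have i2: "?i2 (t2 A a) = a" if "a \<in> vec_car A" for a
    using S(2) that by (simp add: bij_betw_inv_into_left)
  have j1: "\<exists>a\<in>lie_car A. x = t1 A a" if "x \<in> lie_car (F A)" for x
    using S(1) that unfolding bij_betw_def by blast
  have j2: "\<exists>a\<in>vec_car A. x = t2 A a" if "x \<in> vec_car (F A)" for x
    using S(2) that unfolding bij_betw_def by blast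
  have "restrict (t1 A) (lie_car A) \<in> lie_car A \<rightarrow>\<^sub>E lie_car (F A)"
    by (rule restrict_PiE_iff[THEN iffD2]) (use S(9) in blast)
  moreover have "restrict (t2 A) (vec_car A) \<in> vec_car A \<rightarrow>\<^sub>E vec_car (F A)"
    by (rule restrict_PiE_iff[THEN iffD2]) (use S(10) in blast)
  ultimately show p: "p \<in> rep_hom A (F A)"
    unfolding rep_hom_def linear_maps_def p_def mem_Collect_eq prod.case
    by (simp add: S(3-8) obs_lie_rules(1-3)[OF A] obs_vec_rules(1,2)[OF A] obs_action_rules(1)[OF A])
  have m1: "?i1 x \<in> lie_car A" if "x \<in> lie_car (F A)" for x
    using j1[OF that] i1 by force
  have m2: "?i2 x \<in> vec_car A" if "x \<in> vec_car (F A)" for x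
    using j2[OF that] i2 by force
  have k1: "t1 A (?i1 x) = x" if "x \<in> lie_car (F A)" for x
    using j1[OF that] i1 by force
  have k2: "t2 A (?i2 x) = x" if "x \<in> vec_car (F A)" for x
    using j2[OF that] i2 by force
  have "restrict ?i1 (lie_car (F A)) \<in> lie_car (F A) \<rightarrow>\<^sub>E lie_car A"
    by (rule restrict_PiE_iff[THEN iffD2]) (use m1 in blast)
  moreover have "restrict ?i2 (vec_car (F A)) \<in> vec_car (F A) \<rightarrow>\<^sub>E vec_car A"
    by (rule restrict_PiE_iff[THEN iffD2]) (use m2 in blast)
  moreover have "?i1 (x \<oplus>\<^bsub>lie_sort (F A)\<^esub> y) = ?i1 x \<oplus>\<^bsub>lie_sort A\<^esub> ?i1 y"
    "?i1 (lie_bracket (lie_sort (F A)) x y) = lie_bracket (lie_sort A) (?i1 x) (?i1 y)"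
    if x: "x \<in> lie_car (F A)" and y: "y \<in> lie_car (F A)" for x y
  proof -
    note mx = m1[OF x] m1[OF y]
    show "?i1 (x \<oplus>\<^bsub>lie_sort (F A)\<^esub> y) = ?i1 x \<oplus>\<^bsub>lie_sort A\<^esub> ?i1 y"
      using i1[OF obs_lie_rules(1)[OF A mx]] by (simp only: S(3)[OF mx] k1[OF x] k1[OF y])
    show "?i1 (lie_bracket (lie_sort (F A)) x y) = lie_bracket (lie_sort A) (?i1 x) (?i1 y)"
      using i1[OF obs_lie_rules(3)[OF A mx]] by (simp only: S(4)[OF mx] k1[OF x] k1[OF y])
  qed
  moreover have "?i1 (c \<odot>\<^bsub>lie_sort (F A)\<^esub> x) = c \<odot>\<^bsub>lie_sort A\<^esub> ?i1 x"
    if x: "x \<in> lie_car (F A)" for x c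
    using i1[OF obs_lie_rules(2)[OF A m1[OF x] m1[OF x]], of c] by (simp only: S(6)[OF m1[OF x]] k1[OF x] id_apply)
  moreover have "?i2 (x \<oplus>\<^bsub>vec_sort (F A)\<^esub> y) = ?i2 x \<oplus>\<^bsub>vec_sort A\<^esub> ?i2 y"
    if x: "x \<in> vec_car (F A)" and y: "y \<in> vec_car (F A)" for x y
    using i2[OF obs_vec_rules(1)[OF A m2[OF x] m2[OF y]]]
    by (simp only: S(5)[OF m2[OF x] m2[OF y]] k2[OF x] k2[OF y])
  moreover have "?i2 (c \<odot>\<^bsub>vec_sort (F A)\<^esub> x) = c \<odot>\<^bsub>vec_sort A\<^esub> ?i2 x"
    if x: "x \<in> vec_car (F A)" for x c
    using i2[OF obs_vec_rules(2)[OF A m2[OF x] m2[OF x]], of c] by (simp only: S(7)[OF m2[OF x]] k2[OF x] id_apply)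
  moreover have "?i2 (action (F A) l x) = action A (?i1 l) (?i2 x)"
    if l: "l \<in> lie_car (F A)" and x: "x \<in> vec_car (F A)" for l x
    using i2[OF obs_action_rules(1)[OF A m1[OF l] m1[OF l] m2[OF x]]]
    by (simp only: S(8)[OF m1[OF l] m2[OF x]] k1[OF l] k2[OF x])
  ultimately show q: "q \<in> rep_hom (F A) A"
    unfolding rep_hom_def linear_maps_def q_def mem_Collect_eq prod.case
    by (simp add: obs_lie_rules(1-3)[OF F] obs_vec_rules(1,2)[OF F] obs_action_rules(1)[OF F])
  show "hcomp A q p = hid A"
    unfolding hcomp_def p_def q_def fst_conv snd_conv compose_def
    by (simp add: S(9,10) i1 i2 cong: restrict_cong)
  show "hcomp (F A) p q = hid (F A)"
    unfolding hcomp_def p_def q_def fst_conv snd_conv compose_def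
    by (simp add: m1 m2 k1 k2 cong: restrict_cong)
qed

text \<open>Naturality, evaluated at preimages under the bijective family, is the conjugation
  formula of an inner automorphism.\<close>

lemma linear_family_inner:
  assumes aut: "(F, f) \<in> cat_automorphisms (Theta0 \<Theta>)" and s: "semilinear_family id F f t1 t2"
  shows "(F, f) \<in> inner_automorphisms (Theta0 \<Theta>)"
proof -
  interpret a: theta_automorphism \<Theta> F f by unfold_locales (rule aut)
  define p where "p A = (restrict (t1 A) (lie_car A), restrict (t2 A) (vec_car A))" for A
  define q where "q A = (restrict (inv_into (lie_car A) (t1 A)) (lie_car (F A)),
      restrict (inv_into (vec_car A) (t2 A)) (vec_car (F A)))" for A
  have pq: "p A \<in> rep_hom A (F A)" "q A \<in> rep_hom (F A) A"
    "hcomp A (q A) (p A) = hid A"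
    "hcomp (F A) (p A) (q A) = hid (F A)"
    if A: "A \<in> obs" for A
    unfolding p_def q_def by (rule linear_family_inverse_arrow[OF a.F_obs[OF A] A s])+
  let ?\<sigma> = "\<lambda>A. (A, p A, F A)" and ?\<tau> = "\<lambda>A. (F A, q A, A)"
  have inv: "inverse_arrows (Theta0 \<Theta>) (?\<sigma> A) (?\<tau> A) \<and> Dom (Theta0 \<Theta>) (?\<sigma> A) = A \<and> Cod (Theta0 \<Theta>) (?\<sigma> A) = F A"
    if A: "A \<in> Ob (Theta0 \<Theta>)" for A
    using A by (simp add: inverse_arrows_def Theta0_simps Theta0_Ident pq)
  have arr: "f x = Comp (Theta0 \<Theta>) (?\<sigma> (Cod (Theta0 \<Theta>) x)) (Comp (Theta0 \<Theta>) x (?\<tau> (Dom (Theta0 \<Theta>) x)))"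
    if x: "x \<in> Arr (Theta0 \<Theta>)" for x
  proof -
    obtain A h B where x: "x = (A, h, B)" "A \<in> obs" "B \<in> obs" "h \<in> rep_hom A B" using x by (rule Theta0_arrE)
    note A = x(2) and B = x(3) and h = x(4)
    note S = semilinearD[OF s A] and N = semilinear_nat[OF s A B h]
    have fa: "f x = (F A, a.fmap A B h, F B)" unfolding x(1) by (rule a.f_eq[OF A B h])
    note fh = a.f_eq(2)[OF A B h]
    note hq = hcomp_in[OF a.F_obs[OF A] pq(2)[OF A] h]
    note phq = hcomp_in[OF a.F_obs[OF A] hq pq(1)[OF B]]
    have "a.fmap A B h = hcomp (F A) (p B) (hcomp (F A) h (q A))"
    proof (rule hom_ext[OF fh phq])
      fix y assume y: "y \<in> lie_car (F A)"
      then obtain b where b: "b \<in> lie_car A" "y = t1 A b"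
        using S(1) unfolding bij_betw_def by blast
      have "fst (q A) y = b" using y b S(1) by (simp add: q_def bij_betw_inv_into_left)
      then show "fst (a.fmap A B h) y = fst (hcomp (F A) (p B) (hcomp (F A) h (q A))) y"
        using y b N(1)[OF b(1)] hom_simps(1)[OF h b(1)] by (simp add: p_def a.fmap_def)
    next
      fix y assume y: "y \<in> vec_car (F A)"
      then obtain b where b: "b \<in> vec_car A" "y = t2 A b"
        using S(2) unfolding bij_betw_def by blast
      have "snd (q A) y = b" using y b S(2) by (simp add: q_def bij_betw_inv_into_left)
      then show "snd (a.fmap A B h) y = snd (hcomp (F A) (p B) (hcomp (F A) h (q A))) y"
        using y b N(2)[OF b(1)] hom_simps(2)[OF h b(1)] by (simp add: p_def a.fmap_def)
    qed
    then show ?thesis using fa by (simp add: x(1) Theta0_simps)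
  qed
  show ?thesis
    unfolding inner_automorphisms_def mem_Collect_eq prod.case
    by (rule conjI[OF aut], rule exI[of _ ?\<sigma>], rule exI[of _ ?\<tau>], rule conjI)
      (rule ballI, erule inv, rule ballI, erule arr)
qed

end

section \<open>The group of field automorphisms and the quotient\<close>

lemma field_Aut_carrier: "\<alpha> \<in> carrier field_Aut \<longleftrightarrow> field_automorphism \<alpha>"
proof
  assume "\<alpha> \<in> carrier field_Aut"
  then show "field_automorphism \<alpha>"
    by unfold_locales (auto simp: field_Aut_def ring_iso_def ring_hom_def ring_of_type_algebra_def)
next
  assume "field_automorphism \<alpha>"
  then interpret field_automorphism \<alpha> .
  show "\<alpha> \<in> carrier field_Aut"
    using bij by (auto simp: field_Aut_def ring_iso_def ring_hom_def ring_of_type_algebra_def add mult)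
qed

lemma field_automorphism_id: "field_automorphism id"
  by unfold_locales simp_all

lemma field_automorphism_comp:
  assumes "field_automorphism \<alpha>" "field_automorphism \<beta>"
  shows "field_automorphism (\<alpha> \<circ> \<beta>)"
proof -
  interpret a: field_automorphism \<alpha> by fact
  interpret b: field_automorphism \<beta> by fact
  show ?thesis by unfold_locales (simp_all add: bij_comp a.bij b.bij a.add b.add a.mult b.mult)
qed

lemma group_field_Aut: "group (field_Aut :: ('k::field_char_0 \<Rightarrow> 'k) monoid)"
proof (rule groupI)
  have m: "x \<otimes>\<^bsub>field_Aut\<^esub> y = x \<circ> y" "\<one>\<^bsub>field_Aut\<^esub> = id" for x y :: "'k \<Rightarrow> 'k"
    by (simp_all add: field_Aut_def)
  fix x y z :: "'k \<Rightarrow> 'k" assume x: "x \<in> carrier field_Aut" and y: "y \<in> carrier field_Aut"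
  show "x \<otimes>\<^bsub>field_Aut\<^esub> y \<in> carrier field_Aut"
    using x y by (simp add: m field_Aut_carrier field_automorphism_comp)
  show "x \<otimes>\<^bsub>field_Aut\<^esub> y \<otimes>\<^bsub>field_Aut\<^esub> z = x \<otimes>\<^bsub>field_Aut\<^esub> (y \<otimes>\<^bsub>field_Aut\<^esub> z)"
    by (simp add: m comp_assoc)
  show "\<one>\<^bsub>field_Aut\<^esub> \<otimes>\<^bsub>field_Aut\<^esub> x = x" by (simp add: m)
  have "inv_into UNIV x \<circ> x = id"
    using x field_automorphism.bij[of x] by (simp add: field_Aut_carrier bij_is_inj)
  then show "\<exists>y\<in>carrier field_Aut. y \<otimes>\<^bsub>field_Aut\<^esub> x = \<one>\<^bsub>field_Aut\<^esub>"
    using x by (intro bexI[of _ "inv_into UNIV x"]) (simp_all add: m field_Aut_carrier field_automorphism_inv)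
next
  show "\<one>\<^bsub>field_Aut\<^esub> \<in> carrier (field_Aut :: ('k \<Rightarrow> 'k) monoid)"
    using field_automorphism_id by (simp add: field_Aut_carrier[symmetric]) (simp add: field_Aut_def)
qed

theorem theorem4p1:
  fixes \<Theta> :: "('k::field_char_0, 'l, 'v) lie_rep set"
    and e1 :: "'k free_lie \<Rightarrow> 'l" and e2 :: "'k free_mod \<Rightarrow> 'v"
  assumes "inj e1" and "inj e2"
    and "variety \<Theta>"
    and "action_type \<Theta>"
    and "\<not> degenerated \<Theta>"
    and "defined_over_int \<Theta>"
  shows "cat_Aut (Theta0 \<Theta>) Mod inner_automorphisms (Theta0 \<Theta>) \<cong> (field_Aut :: ('k \<Rightarrow> 'k) monoid)"
proof -
  interpret action_variety \<Theta> by unfold_locales (fact assms)+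
  interpret cat: is_category "Theta0 \<Theta>"
    unfolding Theta0_def by (rule rep_category_is_category) (auto intro: is_lie_rep_free_rep)
  let ?G = "cat_Aut (Theta0 \<Theta>)" and ?K = "field_Aut :: ('k \<Rightarrow> 'k) monoid"
  have G: "carrier ?G = cat_automorphisms (Theta0 \<Theta>)"
    "(F, f) \<otimes>\<^bsub>?G\<^esub> (H, h) = (compose (Ob (Theta0 \<Theta>)) F H, compose (Arr (Theta0 \<Theta>)) f h)" for F f H h
    by (simp_all add: cat_Aut_def)
  \<comment> \<open>Only the scalars of a family are recorded: the family is not unique, as
    \<open>t2\<close> may be multiplied by a nonzero constant, whereas
    \<open>semilinear_unique\<close> determines \<open>\<alpha>\<close>.\<close>
  define good where "good \<Phi> \<alpha> \<longleftrightarrow> field_automorphism \<alpha> \<and> (\<exists>t1 t2. semilinear_family \<alpha> (fst \<Phi>) (snd \<Phi>) t1 t2)"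
    for \<Phi> :: "(('k, 'k free_lie set, 'k free_mod set) lie_rep \<Rightarrow> ('k, 'k free_lie set, 'k free_mod set) lie_rep) \<times>
      (('k, 'k free_lie set, 'k free_mod set) rep_arrow \<Rightarrow> ('k, 'k free_lie set, 'k free_mod set) rep_arrow)" and \<alpha>
  have ex: "\<exists>\<alpha>. good \<Phi> \<alpha>" if "\<Phi> \<in> carrier ?G" for \<Phi>
  proof -
    interpret theta_automorphism \<Theta> "fst \<Phi>" "snd \<Phi>" by unfold_locales (use that in \<open>simp add: G\<close>)
    obtain \<alpha> t1 t2 where "bij \<alpha>" "\<And>c d. \<alpha> (c + d) = \<alpha> c + \<alpha> d" "\<And>c d. \<alpha> (c * d) = \<alpha> c * \<alpha> d"
      "semilinear_family \<alpha> (fst \<Phi>) (snd \<Phi>) t1 t2"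
      using semilinear_family_exists by blast
    then show ?thesis unfolding good_def by (intro exI[of _ \<alpha>] conjI exI field_automorphism.intro)
  qed
  have uniq: "\<alpha> = \<beta>" if "good \<Phi> \<alpha>" "good \<Phi> \<beta>" for \<Phi> \<alpha> \<beta>
    using that semilinear_unique field_automorphism.bij[THEN bij_is_surj] unfolding good_def by blast
  define scalar where "scalar \<Phi> = (THE \<alpha>. good \<Phi> \<alpha>)" for \<Phi>
  have scalar_eq: "scalar \<Phi> = \<alpha>" if "good \<Phi> \<alpha>" for \<Phi> \<alpha>
    unfolding scalar_def by (rule the_equality) (rule that, erule uniq[OF _ that])
  have scalar: "good \<Phi> (scalar \<Phi>)" if "\<Phi> \<in> carrier ?G" for \<Phi>
    using ex[OF that] scalar_eq by metis
  have "scalar \<in> hom ?G ?K"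
  proof (rule homI)
    fix \<Phi> assume "\<Phi> \<in> carrier ?G"
    then show "scalar \<Phi> \<in> carrier ?K" using scalar by (simp add: field_Aut_carrier good_def)
  next
    fix \<Phi> \<Psi> assume \<Phi>: "\<Phi> \<in> carrier ?G" and \<Psi>: "\<Psi> \<in> carrier ?G"
    obtain F f H h where e: "\<Phi> = (F, f)" "\<Psi> = (H, h)" by fastforce
    have "good (\<Phi> \<otimes>\<^bsub>?G\<^esub> \<Psi>) (scalar \<Phi> \<circ> scalar \<Psi>)"
      using scalar[OF \<Phi>] scalar[OF \<Psi>] semilinear_compose[of F f H h] \<Phi> \<Psi> field_automorphism_comp
      unfolding good_def e G fst_conv snd_conv by blast
    then show "scalar (\<Phi> \<otimes>\<^bsub>?G\<^esub> \<Psi>) = scalar \<Phi> \<otimes>\<^bsub>?K\<^esub> scalar \<Psi>"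
      using scalar_eq by (simp add: field_Aut_def)
  qed
  then interpret h: group_hom ?G ?K scalar
    by (intro group_hom.intro group_hom_axioms.intro cat.group_cat_Aut group_field_Aut)
  have "scalar ` carrier ?G = carrier ?K"
  proof
    show "carrier ?K \<subseteq> scalar ` carrier ?G"
    proof
      fix \<alpha> :: "'k \<Rightarrow> 'k" assume "\<alpha> \<in> carrier ?K"
      then have \<alpha>: "field_automorphism \<alpha>" by (simp add: field_Aut_carrier)
      \<comment> \<open>Surjectivity: conjugation by the coefficient maps of \<open>\<alpha>\<close>
        is an automorphism whose scalars are \<open>\<alpha>\<close>; integrality of the identities
        enters here.\<close>
      interpret t: twist_automorphism \<Theta> \<alpha>
        by (intro twist_automorphism.intro twist_automorphism_axioms.intro action_variety_axioms \<alpha> assms(6))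
      have "good t.twist_functor \<alpha>" using \<alpha> t.twist_functor_semilinear unfolding good_def by blast
      then have "scalar t.twist_functor = \<alpha>" by (rule scalar_eq)
      then show "\<alpha> \<in> scalar ` carrier ?G"
        using imageI[OF t.twist_functor_automorphism, of scalar] unfolding G by simp
    qed
  qed auto
  from h.FactGroup_iso[OF this] have "?G Mod kernel ?G ?K scalar \<cong> ?K" .
  \<comment> \<open>Trivial scalars mean a linear family, that is, a natural isomorphism to the
    identity functor.\<close>
  moreover have "kernel ?G ?K scalar = inner_automorphisms (Theta0 \<Theta>)"
  proof
    show "kernel ?G ?K scalar \<subseteq> inner_automorphisms (Theta0 \<Theta>)"
    proof
      fix \<Phi> assume "\<Phi> \<in> kernel ?G ?K scalar"
      then have \<Phi>: "\<Phi> \<in> carrier ?G" "scalar \<Phi> = id" by (auto simp: kernel_def field_Aut_def)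
      then obtain t1 t2 where "semilinear_family id (fst \<Phi>) (snd \<Phi>) t1 t2"
        using scalar[OF \<Phi>(1)] unfolding good_def by auto
      then show "\<Phi> \<in> inner_automorphisms (Theta0 \<Theta>)"
        using linear_family_inner[of "fst \<Phi>" "snd \<Phi>"] \<Phi>(1) by (simp add: G)
    qed
    show "inner_automorphisms (Theta0 \<Theta>) \<subseteq> kernel ?G ?K scalar"
    proof
      fix \<Phi> assume \<Phi>: "\<Phi> \<in> inner_automorphisms (Theta0 \<Theta>)"
      then have "\<Phi> \<in> carrier ?G" unfolding G inner_automorphisms_def by blast
      moreover have "good \<Phi> id"
        using inner_semilinear[of "fst \<Phi>" "snd \<Phi>"] \<Phi> field_automorphism_id by (simp add: good_def)
      ultimately show "\<Phi> \<in> kernel ?G ?K scalar"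
        using scalar_eq by (simp add: kernel_def field_Aut_def)
    qed
  qed
  ultimately show ?thesis by simp
qed

end
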